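(* Let $1\le k\le n$, $n\ge 3$, and let $\Omega\subset\mathbb{R}^n$ be a bounded domain. Let $u,v\in\Phi^k(\Omega)\cap C^2(\bar\Omega)$ satisfy $u\ge v$ in $\Omega$ and $u=v$ on $\partial\Omega$. Then for any $\alpha\ge 0$, $$\int_\Omega\sum_{l=0}^k b_l\,u^\alpha|\nabla u|^{2l}S_{k-l}(u)\ \le\ \int_\Omega\sum_{l=0}^k b_l\,v^\alpha|\nabla v|^{2l}S_{k-l}(v),$$ where $$b_l=\big[(k+l)\alpha+kn+2kl\big]\cdot\frac{(\alpha+n+l-1)!}{2^l\,l!\,(\alpha+n)!}\ \ge 0,\qquad l=0,\dots,k.$$
   Context: For $\lambda\in\mathbb{R}^n$, $\sigma_k(\lambda)=\sum_{1\le i_1<\cdots<i_k\le n}\lambda_{i_1}\cdots\lambda_{i_k}$, $\sigma_0=1$, and $\Gamma_k=\{\lambda\in\mathbb{R}^n:\sigma_i(\lambda)\ge 0\ \text{for all } 1\le i\le k\}$. For a positive $C^2$ function $v$, set $A_{ij}(v)=v\,v_{ij}-\frac12|\nabla v|^2\delta_{ij}$, where $v_{ij}=\partial_i\partial_j v$, let $\lambda\{A_{ij}(v)\}$ denote the vector of eigenvalues of $(A_{ij}(v))$, and $S_m(v)=\sigma_m(\lambda\{A_{ij}(v)\})$, $S_0=1$. $\tilde\Phi^k(\Omega)=\{u\in C^2(\Omega): u>0,\ \lambda\{A_{ij}(u)\}\in\Gamma_k \text{ in } \Omega\}$. $\Phi^k(\Omega)$ is the set of $u\in L^1_{loc}(\Omega)$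 with $u>0$ for which there exists a sequence $\{u^{(m)}\}\subset\tilde\Phi^k(\Omega)$ such that $u^{(m)}\to u$ in $L^1_{loc}(\Omega)$. For non-integer arguments, $x!$ means $\Gamma(x+1)$ with $\Gamma$ the Gamma function. *)

theory Defs
  imports "HOL-Analysis.Analysis"
begin

definition esym :: "nat \<Rightarrow> real ^ 'n \<Rightarrow> real" where
  "esym k lam = (\<Sum>I | I \<subseteq> (UNIV :: 'n set) \<and> card I = k. \<Prod>i\<in>I. lam $ i)"

definition Gamma_cone :: "nat \<Rightarrow> (real ^ 'n) set" where
  "Gamma_cone k = {lam. \<forall>i\<in>{1..k}. esym i lam \<ge> 0}"

text \<open>
  The vector of eigenvalues, listed with algebraic multiplicity. It exists for every real
  symmetric matrix and is unique up to a permutation of its entries, so for such matrices the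
  choice does not affect the value of a symmetric function such as \<open>esym\<close>.
\<close>
definition eigenvalue_vector :: "real ^ 'n ^ 'n \<Rightarrow> real ^ 'n" where
  "eigenvalue_vector A =
    (SOME lam. \<forall>t. det (mat t - A) = (\<Prod>i\<in>UNIV. t - lam $ i))"

definition pderiv_vec :: "'n \<Rightarrow> (real ^ 'n \<Rightarrow> real) \<Rightarrow> real ^ 'n \<Rightarrow> real" where
  "pderiv_vec i f x = frechet_derivative f (at x) (axis i 1)"

definition grad :: "(real ^ 'n \<Rightarrow> real) \<Rightarrow> real ^ 'n \<Rightarrow> real ^ 'n" where
  "grad f x = (\<chi> i. pderiv_vec i f x)"

definition hess :: "(real ^ 'n \<Rightarrow> real) \<Rightarrow> real ^ 'n \<Rightarrow> real ^ 'n ^ 'n" where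
  "hess f x = (\<chi> i j. pderiv_vec i (pderiv_vec j f) x)"

definition C2_on :: "(real ^ 'n) set \<Rightarrow> (real ^ 'n \<Rightarrow> real) set" where
  "C2_on \<Omega> = {f.
     (\<forall>x\<in>\<Omega>. f differentiable (at x)) \<and>
     (\<forall>i. \<forall>x\<in>\<Omega>. pderiv_vec i f differentiable (at x)) \<and>
     (\<forall>i j. continuous_on \<Omega> (pderiv_vec i (pderiv_vec j f)))}"

text \<open>
  \<open>C\<^sup>2\<close> up to the boundary of an open set \<open>\<Omega>\<close>: the function is \<open>C\<^sup>2\<close> in \<open>\<Omega>\<close>, and it and all its
  partial derivatives of order at most two extend continuously to \<open>closure \<Omega>\<close>. The function
  itself is required to be continuous on \<open>closure \<Omega>\<close>, so its values on the boundary are those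
  of the extension.
\<close>
definition C2_closure :: "(real ^ 'n) set \<Rightarrow> (real ^ 'n \<Rightarrow> real) set" where
  "C2_closure \<Omega> = {f. f \<in> C2_on \<Omega> \<and> continuous_on (closure \<Omega>) f \<and>
     (\<forall>i. \<exists>g. continuous_on (closure \<Omega>) g \<and> (\<forall>x\<in>\<Omega>. g x = pderiv_vec i f x)) \<and>
     (\<forall>i j. \<exists>g. continuous_on (closure \<Omega>) g \<and>
        (\<forall>x\<in>\<Omega>. g x = pderiv_vec i (pderiv_vec j f) x))}"

definition A_matrix :: "(real ^ 'n \<Rightarrow> real) \<Rightarrow> real ^ 'n \<Rightarrow> real ^ 'n ^ 'n" where
  "A_matrix v x =
    (\<chi> i j. v x * hess v x $ i $ j - (1/2) * (norm (grad v x))\<^sup>2 * (if i = j then 1 else 0))"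

definition S_op :: "nat \<Rightarrow> (real ^ 'n \<Rightarrow> real) \<Rightarrow> real ^ 'n \<Rightarrow> real" where
  "S_op m v x = esym m (eigenvalue_vector (A_matrix v x))"

definition Phi_tilde :: "nat \<Rightarrow> (real ^ 'n) set \<Rightarrow> (real ^ 'n \<Rightarrow> real) set" where
  "Phi_tilde k \<Omega> = {u \<in> C2_on \<Omega>.
     (\<forall>x\<in>\<Omega>. u x > 0) \<and> (\<forall>x\<in>\<Omega>. eigenvalue_vector (A_matrix u x) \<in> Gamma_cone k)}"

definition L1_loc :: "(real ^ 'n) set \<Rightarrow> (real ^ 'n \<Rightarrow> real) set" where
  "L1_loc \<Omega> = {u. \<forall>K. compact K \<and> K \<subseteq> \<Omega> \<longrightarrow> set_integrable lebesgue K u}"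

definition L1_loc_tendsto ::
    "(real ^ 'n) set \<Rightarrow> (nat \<Rightarrow> real ^ 'n \<Rightarrow> real) \<Rightarrow> (real ^ 'n \<Rightarrow> real) \<Rightarrow> bool" where
  "L1_loc_tendsto \<Omega> w u \<longleftrightarrow>
    (\<forall>K. compact K \<and> K \<subseteq> \<Omega> \<longrightarrow> (\<lambda>m. LINT x:K|lebesgue. \<bar>w m x - u x\<bar>) \<longlonglongrightarrow> 0)"

definition Phi :: "nat \<Rightarrow> (real ^ 'n) set \<Rightarrow> (real ^ 'n \<Rightarrow> real) set" where
  "Phi k \<Omega> = {u \<in> L1_loc \<Omega>. (\<forall>x\<in>\<Omega>. u x > 0) \<and>
     (\<exists>w. (\<forall>m. w m \<in> Phi_tilde k \<Omega>) \<and> L1_loc_tendsto \<Omega> w u)}"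

definition gfact :: "real \<Rightarrow> real" where
  "gfact x = Gamma (x + 1)"

definition b_coeff :: "real \<Rightarrow> nat \<Rightarrow> nat \<Rightarrow> nat \<Rightarrow> real" where
  "b_coeff \<alpha> n k l =
    ((real k + real l) * \<alpha> + real k * real n + 2 * real k * real l) *
    (gfact (\<alpha> + real n + real l - 1) / (2 ^ l * fact l * gfact (\<alpha> + real n)))"

end

theory Submission
  imports Defs "HOL-Computational_Algebra.Fundamental_Theorem_Algebra"
begin

text \<open>
  Write \<open>\<sigma>\<^sub>j\<close> for the \<open>j\<close>-th elementary symmetric function of the eigenvalues of a symmetric matrix and
  \<open>L(w)\<close> for the integrand of the theorem.

  First, \<open>L(w)\<close> is a polynomial in the Hessian. Expanding \<open>\<sigma>\<^sub>m(w D\<^sup>2w - (|\<nabla>w|\<^sup>2/2) I)\<close> and summing the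
  coefficients with the Chu--Vandermonde identity gives
  \<open>L(w) = \<Sum>\<^sub>j e\<^sub>j w\<^bsup>\<alpha>+j\<^esup> |\<nabla>w|\<^bsup>2(k-j)\<^esup> \<sigma>\<^sub>j(D\<^sup>2w)\<close> (\<open>weighted_sum_eq_integrand\<close>), where
  \<open>e\<^sub>j = (2k - j) d\<^sub>j\<close> and \<open>(\<alpha>+j+1) d\<^sub>j\<^sub>+\<^sub>1 = 2(k - j) d\<^sub>j\<close>.

  Second, the Newton tensors \<open>\<partial>\<sigma>\<^sub>j(D\<^sup>2w)\<close> are divergence free (\<open>integral_newton_tensor_zero\<close>).
  Integrating by parts, and using the recursion of the \<open>d\<^sub>j\<close> to cancel every term without a derivative
  of the test function \<open>\<psi>\<close>, one finds for the derivative \<open>dL\<close> of \<open>L\<close> in a direction \<open>\<phi>\<close> that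
  \<open>\<integral> \<psi> dL = - \<integral> (M(\<nabla>\<phi>, \<nabla>\<psi>) + \<phi> Z(\<nabla>\<psi>))\<close> (\<open>first_variation\<close>). The
  quadratic form \<open>M\<close> is the change of \<open>L\<close> when \<open>\<xi>\<otimes>\<xi>\<close> is added to the Hessian.
  Since the weights \<open>b\<^sub>l\<close> are nonnegative and \<open>\<sigma>\<^sub>1, \<dots>, \<sigma>\<^sub>k\<close> do not decrease
  in positive rank-one directions on the cone \<open>\<Gamma>\<^sub>k\<close>, \<open>M\<close> is nonnegative whenever \<open>A(w)\<close> lies in
  \<open>\<Gamma>\<^sub>k\<close> (\<open>gradient_form_nonneg\<close>).

  Third, let \<open>\<phi> = u - v\<close> and \<open>w = v + t\<phi>\<close> with \<open>0 \<le> t \<le> 1\<close>. The matrix \<open>A(w)\<close> is a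
  combination of \<open>A(u)\<close>, \<open>A(v)\<close> and \<open>I\<close> with nonnegative coefficients (\<open>segment_gcone\<close>), hence lies in \<open>\<Gamma>\<^sub>k\<close>
  because \<open>\<Gamma>\<^sub>k\<close> is a convex cone (\<open>gcone_add\<close>, Garding's theorem). Take \<open>\<psi> = h\<^sub>\<epsilon>(\<phi>)\<close>,
  where \<open>h\<^sub>\<epsilon>\<close> is nondecreasing, vanishes on \<open>[0,\<epsilon>]\<close> and tends to the indicator of \<open>(0,\<infinity>)\<close>; this \<open>\<psi>\<close>
  has compact support since \<open>\<phi>\<close> vanishes on the boundary. The \<open>M\<close>-term then has a sign, and the
  \<open>Z\<close>-term is at most \<open>C \<integral> \<phi> h\<^sub>\<epsilon>'(\<phi>)\<close>, which tends to \<open>0\<close>. By the mean value theorem in \<open>t\<close>,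
  letting \<open>\<epsilon>\<close> tend to \<open>0\<close> gives \<open>\<integral>\<^bsub>u>v\<^esub> (L(u) - L(v)) \<le> 0\<close>. On the contact set
  \<open>u = v\<close> the functions have the same gradients, and almost everywhere the same Hessians
  (\<open>contact_set_jets_vanish\<close>), so it contributes nothing (\<open>energy_comparison\<close>).

  It remains to see that a \<open>C\<^sup>2\<close> function in the closed class \<open>\<Phi>\<^sup>k\<close> satisfies the cone condition pointwise
  (\<open>Phi_C2_A_matrix_gcone\<close>). The condition \<open>A(w) \<in> \<Gamma>\<^sub>k\<close> implies linear differential inequalities for \<open>w\<close>, one
  for each half space containing \<open>\<Gamma>\<^sub>k\<close> and each gradient vector; these pass to
  \<open>L\<^sup>1\<close> limits by testing, and for a \<open>C\<^sup>2\<close> function they imply the condition.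

  The eigenvalues enter only through \<open>\<sigma>\<^sub>j\<close>, which is handled throughout as the sum \<open>msig j\<close> of the
  principal minors of size \<open>j\<close>.
\<close>

section \<open>Sums of principal minors\<close>

text \<open>
  Replacing the rows outside \<open>I\<close> by those of the identity leaves the principal
  minor with index set \<open>I\<close> as the determinant, and keeps the matrix in the same
  type for all \<open>I\<close>.
\<close>
definition minor_mat :: "'n set \<Rightarrow> 'a::comm_ring_1^'n^'n \<Rightarrow> 'a^'n^'n" where
  "minor_mat I A = (\<chi> i. if i \<in> I then A $ i else axis i 1)"

text \<open>
  The \<open>k\<close>-th elementary symmetric function of the eigenvalues, in a form that is
  visibly polynomial in the entries and makes sense for complex and for nonsymmetric matrices.
\<close>
definition msig :: "nat \<Rightarrow> 'a::comm_ring_1^'n^'n \<Rightarrow> 'a" where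
  "msig k A = (\<Sum>I | card I = k. det (minor_mat I A))"

text \<open>
  The derivative of the determinant at \<open>M\<close> in the direction \<open>B\<close>.
\<close>
definition ldet :: "'a::comm_ring_1^'n^'n \<Rightarrow> 'a^'n^'n \<Rightarrow> 'a" where
  "ldet M B = (\<Sum>l\<in>UNIV. det (\<chi> i. if i = l then B $ i else M $ i))"

text \<open>
  The derivative of \<open>msig k\<close> at \<open>H\<close> in the direction \<open>B\<close>,
  that is, the contraction of \<open>B\<close> with a Newton tensor of \<open>H\<close>.
\<close>
definition dsig :: "nat \<Rightarrow> 'a::comm_ring_1^'n^'n \<Rightarrow> 'a^'n^'n \<Rightarrow> 'a" where
  "dsig k H B = (\<Sum>I | card I = k. \<Sum>l\<in>I. det (\<chi> i. if i = l then B $ i else minor_mat I H $ i))"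

definition outer :: "'a::times^'n \<Rightarrow> 'a^'n \<Rightarrow> 'a^'n^'n" where
  "outer x y = (\<chi> i j. x $ i * y $ j)"

text \<open>
  Multilinearity splits one row of \<open>S\<close> at a time. The rows \<open>c\<close> outside
  \<open>S\<close> vary in the induction, because a row that has been split joins them.
\<close>
lemma det_expand_rows_aux:
  fixes a b c :: "'n::finite \<Rightarrow> 'a::comm_ring_1^'n"
  assumes "finite S"
  shows "det (\<chi> i. if i \<in> S then a i + b i else c i) =
    (\<Sum>I\<in>Pow S. det (\<chi> i. if i \<in> I then a i else if i \<in> S then b i else c i))"
  using assms
proof (induction S arbitrary: c rule: finite_induct)
  case (insert x S)
  have "det (\<chi> i. if i \<in> insert x S then a i + b i else c i)
      = det (\<chi> i. if i = x then a i + b i else if i \<in> S then a i + b i else c i)"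
    by (intro arg_cong[of _ _ det]) (auto simp: vec_eq_iff)
  also have "\<dots> = det (\<chi> i. if i = x then a i else if i \<in> S then a i + b i else c i)
       + det (\<chi> i. if i = x then b i else if i \<in> S then a i + b i else c i)"
    by (rule det_row_add)
  also have "det (\<chi> i. if i = x then a i else if i \<in> S then a i + b i else c i)
      = det (\<chi> i. if i \<in> S then a i + b i else (c(x := a x)) i)"
    using insert.hyps by (intro arg_cong[of _ _ det]) (auto simp: vec_eq_iff)
  also have "\<dots> = (\<Sum>I\<in>Pow S. det (\<chi> i. if i \<in> I then a i else if i \<in> S then b i else (c(x := a x)) i))"
    by (rule insert.IH)
  also have "\<dots> = (\<Sum>I\<in>insert x ` Pow S. det (\<chi> i. if i \<in> I then a i else if i \<in> insert x S then b i else c i))"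
  proof (subst sum.reindex)
    show "inj_on (insert x) (Pow S)"
      using insert.hyps by (auto simp: inj_on_def)
    show "(\<Sum>I\<in>Pow S. det (\<chi> i. if i \<in> I then a i else if i \<in> S then b i else (c(x := a x)) i)) =
      sum ((\<lambda>I. det (\<chi> i. if i \<in> I then a i else if i \<in> insert x S then b i else c i)) \<circ> insert x) (Pow S)"
      using insert.hyps
      by (intro sum.cong refl) (auto simp: vec_eq_iff intro!: arg_cong[of _ _ det])
  qed
  also have "det (\<chi> i. if i = x then b i else if i \<in> S then a i + b i else c i)
      = det (\<chi> i. if i \<in> S then a i + b i else (c(x := b x)) i)"
    using insert.hyps by (intro arg_cong[of _ _ det]) (auto simp: vec_eq_iff)
  also have "\<dots> = (\<Sum>I\<in>Pow S. det (\<chi> i. if i \<in> I then a i else if i \<in> S then b i else (c(x := b x)) i))"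
    by (rule insert.IH)
  also have "\<dots> = (\<Sum>I\<in>Pow S. det (\<chi> i. if i \<in> I then a i else if i \<in> insert x S then b i else c i))"
    using insert.hyps
    by (intro sum.cong refl arg_cong[of _ _ det]) (auto simp: vec_eq_iff)
  also have "(\<Sum>I\<in>insert x ` Pow S. det (\<chi> i. if i \<in> I then a i else if i \<in> insert x S then b i else c i))
      + (\<Sum>I\<in>Pow S. det (\<chi> i. if i \<in> I then a i else if i \<in> insert x S then b i else c i))
      = (\<Sum>I\<in>Pow (insert x S). det (\<chi> i. if i \<in> I then a i else if i \<in> insert x S then b i else c i))"
    unfolding Pow_insert using insert.hyps
    by (subst sum.union_disjoint) (auto simp: add.commute)
  finally show ?case .
qed simp

lemma det_expand_rows:
  fixes a b :: "'n::finite \<Rightarrow> 'a::comm_ring_1^'n"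
  shows "det (\<chi> i. a i + b i) = (\<Sum>I\<in>UNIV. det (\<chi> i. if i \<in> I then a i else b i))"
  using det_expand_rows_aux[of UNIV a b undefined] by (simp only: Pow_UNIV UNIV_I if_True finite)

lemma sum_by_card:
  fixes f :: "nat \<Rightarrow> 'n::finite set \<Rightarrow> 'a::comm_monoid_add"
  shows "(\<Sum>I\<in>UNIV. f (card I) I) = (\<Sum>k\<le>CARD('n). \<Sum>I | card I = k. f k I)"
proof -
  have "(\<Sum>I\<in>UNIV. f (card I) I) = (\<Sum>k\<le>CARD('n). \<Sum>I | I \<in> UNIV \<and> card I = k. f (card I) I)"
    by (rule sum.group[symmetric]) (auto intro: card_mono)
  also have "\<dots> = (\<Sum>k\<le>CARD('n). \<Sum>I | card I = k. f k I)"
    by (intro sum.cong) auto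
  finally show ?thesis .
qed

lemma prod_if_card:
  fixes s t :: "'a::comm_monoid_mult"
  shows "(\<Prod>i\<in>UNIV. if i \<in> (I::'n::finite set) then s else t) = s ^ card I * t ^ (CARD('n) - card I)"
proof -
  have "(\<Prod>i\<in>UNIV. if i \<in> I then s else t) = (\<Prod>i\<in>I. s) * (\<Prod>i\<in>-I. t)"
    by (subst prod.If_cases) auto
  then show ?thesis by (simp add: card_Diff_subset Compl_eq_Diff_UNIV)
qed

text \<open>
  The generating function of the sums of principal minors. The identities for a fixed
  \<open>k\<close> below follow from identities between determinants by comparing coefficients
  in \<open>s\<close>.
\<close>
lemma det_msig:
  fixes A :: "'a::comm_ring_1^'n^'n"
  shows "det (\<chi> i j. s * A $ i $ j + (if i = j then t else 0)) =
    (\<Sum>k\<le>CARD('n). s ^ k * t ^ (CARD('n) - k) * msig k A)"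
proof -
  have "det (\<chi> i j. s * A $ i $ j + (if i = j then t else 0)) = det (\<chi> i. s *s (A $ i) + t *s axis i 1)"
    by (intro arg_cong[of _ _ det]) (auto simp: vec_eq_iff axis_def)
  also have "\<dots> = (\<Sum>I\<in>UNIV. det (\<chi> i. if i \<in> I then s *s (A $ i) else t *s axis i 1))"
    by (rule det_expand_rows)
  also have "\<dots> = (\<Sum>I\<in>UNIV. s ^ card I * t ^ (CARD('n) - card I) * det (minor_mat I A))"
  proof (intro sum.cong refl)
    fix I :: "'n set"
    have "det (\<chi> i. if i \<in> I then s *s (A $ i) else t *s axis i 1) =
      det (\<chi> i. (if i \<in> I then s else t) *s (minor_mat I A $ i))"
      by (intro arg_cong[of _ _ det]) (auto simp: vec_eq_iff minor_mat_def)
    also have "\<dots> = (\<Prod>i\<in>UNIV. if i \<in> I then s else t) * det (\<chi> i. minor_mat I A $ i)"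
      by (rule det_rows_mul)
    finally show "det (\<chi> i. if i \<in> I then s *s (A $ i) else t *s axis i 1) =
      s ^ card I * t ^ (CARD('n) - card I) * det (minor_mat I A)"
      by (simp add: prod_if_card)
  qed
  also have "\<dots> = (\<Sum>k\<le>CARD('n). \<Sum>I | card I = k. s ^ k * t ^ (CARD('n) - k) * det (minor_mat I A))"
    by (rule sum_by_card)
  finally show ?thesis by (simp add: msig_def sum_distrib_left)
qed

lemma power_sum_coeffs_unique:
  fixes a b :: "nat \<Rightarrow> 'a::field_char_0"
  assumes "\<And>s. (\<Sum>k\<le>n. s ^ k * a k) = (\<Sum>k\<le>n. s ^ k * b k)" "k \<le> n"
  shows "a k = b k"
proof -
  have P: "poly (\<Sum>k\<le>n. monom (c k) k) s = (\<Sum>k\<le>n. s ^ k * c k)" for c :: "nat \<Rightarrow> 'a" and s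
    by (simp add: poly_sum poly_monom mult.commute)
  have C: "coeff (\<Sum>k\<le>n. monom (c k) k) k = c k" for c :: "nat \<Rightarrow> 'a"
    using assms(2) by (simp add: coeff_sum sum.delta' if_distrib cong: if_cong)
  have "poly (\<Sum>k\<le>n. monom (a k) k) = poly (\<Sum>k\<le>n. monom (b k) k)"
    by (rule ext) (simp only: P assms)
  then have "(\<Sum>k\<le>n. monom (a k) k) = (\<Sum>k\<le>n. monom (b k) k)"
    by (simp only: poly_eq_poly_eq_iff)
  then show ?thesis using C by metis
qed

lemma msig_gt: "CARD('n) < k \<Longrightarrow> msig k (A::'a::comm_ring_1^'n^'n) = 0"
proof -
  assume "CARD('n) < k"
  moreover have "card (I::'n set) \<le> CARD('n)" for I by (intro card_mono) auto
  ultimately have "{I::'n set. card I = k} = {}" by (auto simp: not_le[symmetric])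
  then show ?thesis by (simp add: msig_def)
qed

lemma minor_mat_empty [simp]: "minor_mat {} A = mat 1"
  by (auto simp: minor_mat_def vec_eq_iff axis_def mat_def)

lemma msig_0 [simp]: "msig 0 (A::'a::comm_ring_1^'n::finite^'n) = 1"
proof -
  have "{I::'n set. card I = 0} = {{}}" by auto
  then show ?thesis by (simp add: msig_def)
qed

lemma dsig_0 [simp]: "dsig 0 (A::'a::comm_ring_1^'n::finite^'n) B = 0"
proof -
  have "{I::'n set. card I = 0} = {{}}" by auto
  then show ?thesis by (simp add: dsig_def)
qed

lemma det_one_add_msig:
  fixes A :: "'a::comm_ring_1^'n^'n"
  shows "det (\<chi> i j. s * A $ i $ j + (if i = j then 1 else 0)) = (\<Sum>k\<le>CARD('n). s ^ k * msig k A)"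
  by (subst det_msig) simp

text \<open>
  Both sides have the same generating function: the determinant of \<open>s (a A + t I) +
  I\<close>, which is \<open>(s a) A + (s t + 1) I\<close>, is expanded once in \<open>s\<close>
  and once with the two-variable generating function and the binomial theorem.
\<close>
lemma msig_shift:
  fixes A :: "'a::field_char_0^'n^'n"
  assumes "k \<le> CARD('n)"
  shows "msig k (\<chi> i j. a * A $ i $ j + (if i = j then t else 0)) =
    (\<Sum>j\<le>k. of_nat ((CARD('n) - j) choose (k - j)) * a ^ j * t ^ (k - j) * msig j A)"
proof -
  let ?n = "CARD('n)"
  have eq: "(\<Sum>k\<le>?n. s ^ k * msig k (\<chi> i j. a * A $ i $ j + (if i = j then t else 0))) =
    (\<Sum>k\<le>?n. s ^ k * (\<Sum>j\<le>k. of_nat ((?n - j) choose (k - j)) * a ^ j * t ^ (k - j) * msig j A))" for s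
  proof -
  have "(\<Sum>k\<le>?n. s ^ k * msig k (\<chi> i j. a * A $ i $ j + (if i = j then t else 0))) =
     det (\<chi> i j. s * (\<chi> i j. a * A $ i $ j + (if i = j then t else 0)) $ i $ j + (if i = j then 1 else 0))"
    by (rule det_one_add_msig[symmetric])
  also have "\<dots> = det (\<chi> i j. (s * a) * A $ i $ j + (if i = j then s * t + 1 else 0))"
    by (intro arg_cong[of _ _ det]) (auto simp: vec_eq_iff algebra_simps)
  also have "\<dots> = (\<Sum>j\<le>?n. (s * a) ^ j * (s * t + 1) ^ (?n - j) * msig j A)"
    by (rule det_msig)
  also have "\<dots> = (\<Sum>j\<le>?n. \<Sum>i\<le>?n - j. s ^ (i + j) * (of_nat ((?n - j) choose i) * a ^ j * t ^ i * msig j A))"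
    by (simp add: binomial_ring sum_distrib_left sum_distrib_right power_mult_distrib power_add mult_ac)
  also have "\<dots> = (\<Sum>j\<le>?n. \<Sum>k\<in>{j..?n}. s ^ k * (of_nat ((?n - j) choose (k - j)) * a ^ j * t ^ (k - j) * msig j A))"
  proof (rule sum.cong[OF refl])
    fix j assume "j \<in> {..?n}"
    then show "(\<Sum>i\<le>?n - j. s ^ (i + j) * (of_nat ((?n - j) choose i) * a ^ j * t ^ i * msig j A)) =
      (\<Sum>k\<in>{j..?n}. s ^ k * (of_nat ((?n - j) choose (k - j)) * a ^ j * t ^ (k - j) * msig j A))"
      by (intro sum.reindex_bij_witness[of _ "\<lambda>k. k - j" "\<lambda>i. i + j"]) auto
  qed
  also have "\<dots> = (\<Sum>k\<le>?n. \<Sum>j\<le>k. s ^ k * (of_nat ((?n - j) choose (k - j)) * a ^ j * t ^ (k - j) * msig j A))"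
  proof -
    have "{j..?n} = {k \<in> {..?n}. j \<le> k}" for j by auto
    moreover have "{..k} = {j \<in> {..?n}. j \<le> k}" if "k \<in> {..?n}" for k using that by auto
    ultimately show ?thesis
      by (simp only: sum.swap_restrict[of "{..?n}" "{..?n}" _ "(\<le>)", OF finite_atMost finite_atMost] cong: sum.cong)
  qed
  finally show ?thesis
    by (simp add: sum_distrib_left)
  qed
  show ?thesis by (rule power_sum_coeffs_unique[OF eq assms])
qed

lemma msig_scale:
  fixes A :: "'a::field_char_0^'n^'n"
  shows "msig k (\<chi> i j. c * A $ i $ j) = c ^ k * msig k A"
proof (cases "k \<le> CARD('n)")
  case True
  have "(\<chi> i j. c * A $ i $ j) = (\<chi> i j. c * A $ i $ j + (if i = j then 0 else 0))"
    by (simp add: vec_eq_iff)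
  then have "msig k (\<chi> i j. c * A $ i $ j) = (\<Sum>j\<le>k. if j = k then c ^ k * msig k A else 0)"
    unfolding msig_shift[OF True, of c A 0, folded \<open>(\<chi> i j. c * A $ i $ j) = _\<close>]
    by (intro sum.cong) (auto simp: power_0_left)
  then show ?thesis by simp
qed (simp add: msig_gt)

lemma msig_diag:
  "msig k (\<chi> i j. if i = j then lam $ i else 0) = esym k lam"
  unfolding msig_def esym_def
proof (intro sum.cong)
  fix I :: "'a set"
  assume "I \<in> {I. I \<subseteq> UNIV \<and> card I = k}"
  have "det (minor_mat I (\<chi> i j. if i = j then lam $ i else 0)) =
    (\<Prod>i\<in>UNIV. minor_mat I (\<chi> i j. if i = j then lam $ i else 0) $ i $ i)"
    by (rule det_diagonal) (auto simp: minor_mat_def axis_def)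
  also have "\<dots> = (\<Prod>i\<in>UNIV. if i \<in> I then lam $ i else 1)"
    by (intro prod.cong) (auto simp: minor_mat_def axis_def)
  finally show "det (minor_mat I (\<chi> i j. if i = j then lam $ i else 0)) = (\<Prod>i\<in>I. lam $ i)"
    by (simp add: prod.If_cases)
qed auto

lemma msig_transpose:
  fixes A :: "'a::field_char_0^'n^'n"
  shows "msig k (transpose A) = msig k A"
proof (cases "k \<le> CARD('n)")
  case True
  show ?thesis
  proof (rule power_sum_coeffs_unique[OF _ True, where a="\<lambda>k. msig k _"])
    fix s :: 'a
    have "(\<chi> i j. s * transpose A $ i $ j + (if i = j then 1 else 0)) =
      transpose (\<chi> i j. s * A $ i $ j + (if i = j then 1 else 0))"
      by (auto simp: vec_eq_iff transpose_def)
    then show "(\<Sum>k\<le>CARD('n). s ^ k * msig k (transpose A)) = (\<Sum>k\<le>CARD('n). s ^ k * msig k A)"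
      unfolding det_one_add_msig[symmetric] by simp
  qed
qed (simp add: msig_gt)

lemma det_affine_expand:
  fixes M B :: "'a::comm_ring_1^'n^'n"
  shows "det (\<chi> i j. M $ i $ j + \<tau> * B $ i $ j) =
    (\<Sum>m\<le>CARD('n). \<tau> ^ m * (\<Sum>J | card J = m. det (\<chi> i. if i \<in> J then B $ i else M $ i)))"
proof -
  have "det (\<chi> i j. M $ i $ j + \<tau> * B $ i $ j) = det (\<chi> i. \<tau> *s B $ i + M $ i)"
    by (intro arg_cong[of _ _ det]) (auto simp: vec_eq_iff)
  also have "\<dots> = (\<Sum>J\<in>UNIV. det (\<chi> i. if i \<in> J then \<tau> *s B $ i else M $ i))"
    by (rule det_expand_rows)
  also have "\<dots> = (\<Sum>J\<in>UNIV. \<tau> ^ card J * det (\<chi> i. if i \<in> J then B $ i else M $ i))"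
  proof (intro sum.cong refl)
    fix J :: "'n set"
    have "det (\<chi> i. if i \<in> J then \<tau> *s B $ i else M $ i) =
      det (\<chi> i. (if i \<in> J then \<tau> else 1) *s (if i \<in> J then B $ i else M $ i))"
      by (intro arg_cong[of _ _ det]) (auto simp: vec_eq_iff)
    also have "\<dots> = (\<Prod>i\<in>UNIV. if i \<in> J then \<tau> else 1) * det (\<chi> i. if i \<in> J then B $ i else M $ i)"
      by (rule det_rows_mul)
    finally show "det (\<chi> i. if i \<in> J then \<tau> *s B $ i else M $ i) = \<tau> ^ card J * det (\<chi> i. if i \<in> J then B $ i else M $ i)"
      by (simp add: prod_if_card)
  qed
  also have "\<dots> = (\<Sum>m\<le>CARD('n). \<Sum>J | card J = m. \<tau> ^ m * det (\<chi> i. if i \<in> J then B $ i else M $ i))"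
    by (rule sum_by_card)
  finally show ?thesis by (simp add: sum_distrib_left)
qed

lemma sum_card_1:
  fixes f :: "'n::finite set \<Rightarrow> 'a::comm_monoid_add"
  shows "(\<Sum>J | card J = Suc 0. f J) = (\<Sum>l\<in>UNIV. f {l})"
  by (rule sum.reindex_bij_witness[of _ "\<lambda>l. {l}" "\<lambda>J. the_elem J"]) (auto simp: card_1_singleton_iff)

lemma ldet_alt: "ldet M B = (\<Sum>J | card J = Suc 0. det (\<chi> i. if i \<in> J then B $ i else M $ i))"
  unfolding sum_card_1 ldet_def by simp

text \<open>
  The coefficient of \<open>\<tau>\<^sup>m\<close> in \<open>msig k (H + \<tau> B)\<close>: on
  the rows with index in \<open>J\<close> the matrix \<open>B\<close> is chosen, and those rows
  vanish unless they belong to the minor.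
\<close>
definition mixsig :: "nat \<Rightarrow> nat \<Rightarrow> 'a::comm_ring_1^'n^'n \<Rightarrow> 'a^'n^'n \<Rightarrow> 'a" where
  "mixsig k m H B = (\<Sum>I | card I = k. \<Sum>J | card J = m.
      det (\<chi> i. if i \<in> J then (if i \<in> I then B $ i else 0) else minor_mat I H $ i))"

lemma msig_affine_expand:
  fixes H B :: "'a::comm_ring_1^'n^'n"
  shows "msig k (\<chi> i j. H $ i $ j + \<tau> * B $ i $ j) = (\<Sum>m\<le>CARD('n). \<tau> ^ m * mixsig k m H B)"
proof -
  have "det (minor_mat I (\<chi> i j. H $ i $ j + \<tau> * B $ i $ j)) = (\<Sum>m\<le>CARD('n). \<tau> ^ m *
     (\<Sum>J | card J = m. det (\<chi> i. if i \<in> J then (if i \<in> I then B $ i else 0) else minor_mat I H $ i)))" for I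
  proof -
    have "minor_mat I (\<chi> i j. H $ i $ j + \<tau> * B $ i $ j) =
      (\<chi> i j. minor_mat I H $ i $ j + \<tau> * (\<chi> i. if i \<in> I then B $ i else 0) $ i $ j)"
      by (auto simp: vec_eq_iff minor_mat_def)
    then have "det (minor_mat I (\<chi> i j. H $ i $ j + \<tau> * B $ i $ j)) =
      det (\<chi> i j. minor_mat I H $ i $ j + \<tau> * (\<chi> i. if i \<in> I then B $ i else 0) $ i $ j)"
      by (rule arg_cong)
    also note det_affine_expand
    finally show ?thesis by (simp only: vec_lambda_beta)
  qed
  then show ?thesis unfolding msig_def mixsig_def
    by (simp add: sum_distrib_left) (rule sum.swap)
qed

lemma mixsig_0: "mixsig k 0 (H::'a::comm_ring_1^'n::finite^'n) B = msig k H"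
proof -
  have "{J::'n set. card J = 0} = {{}}" by auto
  then show ?thesis unfolding mixsig_def msig_def by simp
qed

lemma mixsig_1: "mixsig k (Suc 0) (H::'a::comm_ring_1^'n^'n) B = dsig k H B"
  unfolding mixsig_def dsig_def sum_card_1
proof (rule sum.cong[OF refl])
  fix I :: "'n set"
  have "(\<Sum>l\<in>UNIV. det (\<chi> i. if i \<in> {l} then (if i \<in> I then B $ i else 0) else minor_mat I H $ i))
    = (\<Sum>l\<in>UNIV. if l \<in> I then det (\<chi> i. if i = l then B $ i else minor_mat I H $ i) else 0)"
  proof (intro sum.cong refl)
    fix l :: 'n
    have "det (\<chi> i. if i \<in> {l} then (if i \<in> I then B $ i else 0) else minor_mat I H $ i) = 0" if "l \<notin> I"
    proof -
      have "(\<chi> i. if i \<in> {l} then (if i \<in> I then B $ i else 0) else minor_mat I H $ i)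
        = (\<chi> i. if i = l then 0 else minor_mat I H $ i)"
        using that by (auto simp: vec_eq_iff)
      then show ?thesis by (simp only: det_row_0)
    qed
    moreover have "(\<chi> i. if i \<in> {l} then (if i \<in> I then B $ i else 0) else minor_mat I H $ i)
      = (\<chi> i. if i = l then B $ i else minor_mat I H $ i)" if "l \<in> I"
      using that by (auto simp: vec_eq_iff)
    ultimately show "det (\<chi> i. if i \<in> {l} then (if i \<in> I then B $ i else 0) else minor_mat I H $ i) =
       (if l \<in> I then det (\<chi> i. if i = l then B $ i else minor_mat I H $ i) else 0)" by auto
  qed
  also have "\<dots> = (\<Sum>l\<in>I. det (\<chi> i. if i = l then B $ i else minor_mat I H $ i))"
    by (simp add: sum.If_cases)
  finally show "(\<Sum>l\<in>UNIV. det (\<chi> i. if i \<in> {l} then (if i \<in> I then B $ i else 0) else minor_mat I H $ i))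
    = (\<Sum>l\<in>I. det (\<chi> i. if i = l then B $ i else minor_mat I H $ i))" .
qed

lemma dsig_gt: "CARD('n) < k \<Longrightarrow> dsig k (A::'a::comm_ring_1^'n^'n) B = 0"
proof -
  assume "CARD('n) < k"
  moreover have "card (I::'n set) \<le> CARD('n)" for I by (intro card_mono) auto
  ultimately have "{I::'n set. card I = k} = {}" by (auto simp: not_le[symmetric])
  then show ?thesis by (simp add: dsig_def)
qed

text \<open>
  Derivative at \<open>\<tau> = 0\<close> of the generating function of \<open>msig k (H +
  \<tau> B)\<close>, read off as the coefficient of \<open>\<tau>\<close>.
\<close>
lemma dsig_generating:
  fixes H B :: "'a::field_char_0^'n^'n"
  shows "(\<Sum>k\<le>CARD('n). s ^ k * dsig k H B) = s * ldet (\<chi> i j. s * H $ i $ j + (if i = j then 1 else 0)) B"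
proof -
  let ?M = "\<chi> i j. s * H $ i $ j + (if i = j then 1 else 0)"
  have eq: "(\<Sum>m\<le>CARD('n). \<tau> ^ m * (\<Sum>k\<le>CARD('n). s ^ k * mixsig k m H B)) =
    (\<Sum>m\<le>CARD('n). \<tau> ^ m * (s ^ m * (\<Sum>J | card J = m. det (\<chi> i. if i \<in> J then B $ i else ?M $ i))))" for \<tau>
  proof -
    have "(\<Sum>m\<le>CARD('n). \<tau> ^ m * (\<Sum>k\<le>CARD('n). s ^ k * mixsig k m H B)) =
      (\<Sum>k\<le>CARD('n). s ^ k * msig k (\<chi> i j. H $ i $ j + \<tau> * B $ i $ j))"
      unfolding msig_affine_expand sum_distrib_left by (subst sum.swap) (simp add: mult_ac)
    also have "\<dots> = det (\<chi> i j. s * (\<chi> i j. H $ i $ j + \<tau> * B $ i $ j) $ i $ j + (if i = j then 1 else 0))"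
      by (rule det_one_add_msig[symmetric])
    also have "(\<chi> i j. s * (\<chi> i j. H $ i $ j + \<tau> * B $ i $ j) $ i $ j + (if i = j then 1 else 0)) =
      (\<chi> i j. ?M $ i $ j + (\<tau> * s) * B $ i $ j)"
      by (auto simp: vec_eq_iff algebra_simps)
    finally show ?thesis unfolding det_affine_expand power_mult_distrib by (simp only: mult.assoc)
  qed
  have "Suc 0 \<le> CARD('n)" using zero_less_card_finite[where 'a='n] by linarith
  from power_sum_coeffs_unique[OF eq this] show ?thesis
    by (simp only: mixsig_1 ldet_alt power_Suc0_right)
qed

text \<open>
  Each determinant in the sum has one row replaced by a multiple of a combination of the rows of
  \<open>M\<close>, so Cramer's rule evaluates it.
\<close>
lemma ldet_outer:
  fixes M :: "'a::field^'n^'n"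
  shows "ldet M (outer x (y v* M)) = det M * (\<Sum>i\<in>UNIV. x $ i * y $ i)"
proof -
  have "det (\<chi> i. if i = l then outer x (y v* M) $ i else M $ i) = x $ l * (y $ l * det M)" for l
  proof -
    have "(\<chi> i. if i = l then outer x (y v* M) $ i else M $ i) =
      (\<chi> i. if i = l then x $ l *s (\<Sum>i\<in>UNIV. y $ i *s row i M) else row i M)"
      by (auto simp: vec_eq_iff outer_def row_def vector_matrix_mult_def mult.commute)
    also have "det \<dots> = x $ l * det (\<chi> i. if i = l then (\<Sum>i\<in>UNIV. y $ i *s row i M) else row i M)"
      by (rule det_row_mul)
    also have "det (\<chi> i. if i = l then (\<Sum>i\<in>UNIV. y $ i *s row i M) else row i M) = y $ l * det M"
      by (rule cramer_lemma_transpose)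
    finally show ?thesis .
  qed
  then show ?thesis by (simp add: ldet_def sum_distrib_left mult_ac)
qed

lemma ldet_add: "ldet M (B + C) = ldet M B + ldet M C"
  unfolding ldet_def sum.distrib[symmetric] vector_add_component by (intro sum.cong refl) (rule det_row_add)

lemma dsig_add: "dsig k M (B + C) = dsig k M B + dsig k M C"
  unfolding dsig_def sum.distrib[symmetric] vector_add_component by (intro sum.cong refl) (rule det_row_add)

lemma dsig_scale: "dsig k M (\<chi> i j. c * B $ i $ j) = c * dsig k M B"
proof -
  have row: "(\<chi> i j. c * B $ i $ j) $ i = c *s (B $ i)" for i by (simp add: vec_eq_iff)
  show ?thesis
    unfolding dsig_def sum_distrib_left row
    by (intro sum.cong refl) (rule det_row_mul)
qed

lemma ldet_scale: "ldet M (\<chi> i j. c * B $ i $ j) = c * ldet M B"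
proof -
  have row: "(\<chi> i j. c * B $ i $ j) $ i = c *s (B $ i)" for i by (simp add: vec_eq_iff)
  show ?thesis
    unfolding ldet_def sum_distrib_left row
    by (intro sum.cong refl) (rule det_row_mul)
qed

lemma dsig_self: "dsig k (H::'a::comm_ring_1^'n^'n) H = of_nat k * msig k H"
proof -
  have "(\<Sum>l\<in>I. det (\<chi> i. if i = l then H $ i else minor_mat I H $ i)) = of_nat (card I) * det (minor_mat I H)"
    for I :: "'n set"
  proof -
    have "(\<Sum>l\<in>I. det (\<chi> i. if i = l then H $ i else minor_mat I H $ i)) = (\<Sum>l\<in>I. det (minor_mat I H))"
      by (intro sum.cong refl arg_cong[of _ _ det]) (auto simp: vec_eq_iff minor_mat_def)
    then show ?thesis by simp
  qed
  then show ?thesis by (simp add: dsig_def msig_def sum_distrib_left)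
qed

text \<open>
  The recursion of the Newton tensors, \<open>T\<^sub>k\<^sub>+\<^sub>1 = \<sigma>\<^sub>k I -
  T\<^sub>k H\<close>, tested against \<open>x \<otimes> y\<close>. It is the coefficient of
  \<open>s\<^sup>k\<^sup>+\<^sup>1\<close> in the cofactor identity \<open>ldet_outer\<close>
  for the matrix \<open>s H + I\<close>.
\<close>
lemma dsig_Suc_outer:
  fixes H :: "'a::field_char_0^'n^'n"
  shows "dsig (Suc k) H (outer x y) = msig k H * (\<Sum>i\<in>UNIV. x $ i * y $ i) - dsig k H (outer x (y v* H))"
proof (cases "k \<le> CARD('n)")
  case True
  let ?n = "CARD('n)"
  let ?c = "\<Sum>i\<in>UNIV. x $ i * y $ i"
  have eq: "(\<Sum>k\<le>Suc ?n. s ^ k * (dsig k H (outer x y) + (if k = 0 then 0 else dsig (k - 1) H (outer x (y v* H))))) =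
    (\<Sum>k\<le>Suc ?n. s ^ k * (if k = 0 then 0 else msig (k - 1) H * ?c))" for s
  proof -
    let ?M = "\<chi> i j. s * H $ i $ j + (if i = j then 1 else 0)"
    have 1: "(\<Sum>k\<le>Suc ?n. s ^ k * dsig k H (outer x y)) = s * ldet ?M (outer x y)"
      using dsig_generating[of s H "outer x y"] by (simp add: dsig_gt)
    have 2: "(\<Sum>k\<le>Suc ?n. s ^ k * (if k = 0 then 0 else g (k - 1))) = s * (\<Sum>k\<le>?n. s ^ k * g k)"
      for g :: "nat \<Rightarrow> 'a"
      by (subst sum.atMost_Suc_shift) (simp add: sum_distrib_left mult_ac)
    have 3: "outer x (y v* ?M) = outer x y + (\<chi> i j. s * outer x (y v* H) $ i $ j)"
    proof -
      have "(\<Sum>n\<in>UNIV. (s * H $ n $ j + (if n = j then 1 else 0)) * y $ n) =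
        s * (\<Sum>n\<in>UNIV. H $ n $ j * y $ n) + y $ j" for j
      proof -
        have "(\<Sum>n\<in>UNIV. (s * H $ n $ j + (if n = j then 1 else 0)) * y $ n) =
          (\<Sum>n\<in>UNIV. s * (H $ n $ j * y $ n) + (if n = j then y $ n else 0))"
          by (intro sum.cong refl) (auto simp: algebra_simps)
        then show ?thesis by (simp add: sum.distrib sum_distrib_left)
      qed
      then show ?thesis
        by (simp add: vec_eq_iff outer_def vector_matrix_mult_def algebra_simps)
    qed
    have 5: "ldet ?M (outer x y) + s * ldet ?M (outer x (y v* H)) = det ?M * ?c"
      using ldet_outer[of ?M x y] unfolding 3 by (simp add: ldet_add ldet_scale)
    have 4: "s * ldet ?M (outer x y) + s * (s * ldet ?M (outer x (y v* H))) = s * (det ?M * ?c)"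
      using arg_cong[OF 5, of "\<lambda>z. s * z"] by (simp only: distrib_left)
    have "(\<Sum>k\<le>Suc ?n. s ^ k * (dsig k H (outer x y) + (if k = 0 then 0 else dsig (k - 1) H (outer x (y v* H)))))
      = s * ldet ?M (outer x y) + s * (s * ldet ?M (outer x (y v* H)))"
      by (simp only: distrib_left sum.distrib 1 2[of "\<lambda>k. dsig k H (outer x (y v* H))"] dsig_generating)
    also have "\<dots> = s * (det ?M * ?c)" by (rule 4)
    also have "\<dots> = (\<Sum>k\<le>Suc ?n. s ^ k * (if k = 0 then 0 else msig (k - 1) H * ?c))"
      by (simp only: 2[of "\<lambda>k. msig k H * ?c"] det_one_add_msig sum_distrib_right mult.assoc)
    finally show ?thesis .
  qed
  have "Suc k \<le> Suc ?n" using True by simp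
  from power_sum_coeffs_unique[OF eq this] show ?thesis by (simp add: algebra_simps)
qed (simp add: dsig_gt msig_gt)

lemma dsig_transpose:
  fixes H B :: "'a::field_char_0^'n^'n"
  shows "dsig k (transpose H) (transpose B) = dsig k H B"
proof -
  have eq: "(\<Sum>m\<le>CARD('n). \<tau> ^ m * mixsig k m (transpose H) (transpose B)) = (\<Sum>m\<le>CARD('n). \<tau> ^ m * mixsig k m H B)" for \<tau>
  proof -
    have "(\<chi> i j. transpose H $ i $ j + \<tau> * transpose B $ i $ j) = transpose (\<chi> i j. H $ i $ j + \<tau> * B $ i $ j)"
      by (simp add: vec_eq_iff transpose_def)
    then show ?thesis
      unfolding msig_affine_expand[symmetric] by (simp add: msig_transpose)
  qed
  have "Suc 0 \<le> CARD('n)" using zero_less_card_finite[where 'a='n] by linarith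
  from power_sum_coeffs_unique[OF eq this] show ?thesis by (simp add: mixsig_1)
qed

lemma outer_transpose: "transpose (outer x y) = outer y (x::'a::comm_ring_1^'n)"
  by (simp add: transpose_def outer_def vec_eq_iff mult.commute)

text \<open>
  Two rows proportional to \<open>y\<close> make each determinant vanish.
\<close>
lemma mixsig_outer:
  fixes H :: "'a::comm_ring_1^'n^'n"
  assumes "m \<ge> 2"
  shows "mixsig k m H (outer x y) = 0"
  unfolding mixsig_def
proof (intro sum.neutral ballI)
  fix I J :: "'n set" assume "J \<in> {J. card J = m}"
  then have "card J \<ge> 2" using assms by simp
  then obtain p q where pq: "p \<in> J" "q \<in> J" "p \<noteq> q"
    by (metis One_nat_def card_le_Suc0_iff_eq finite not_less_eq_eq numeral_2_eq_2)
  have "det (\<chi> i. if i \<in> J then if i \<in> I then outer x y $ i else 0 else minor_mat I H $ i) =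
    det (\<chi> i. (if i \<in> J then (if i \<in> I then x $ i else 0) else 1) *s (if i \<in> J then y else minor_mat I H $ i))"
    by (intro arg_cong[of _ _ det]) (auto simp: vec_eq_iff outer_def)
  also have "\<dots> = (\<Prod>i\<in>UNIV. (if i \<in> J then (if i \<in> I then x $ i else 0) else 1)) * det (\<chi> i. (if i \<in> J then y else minor_mat I H $ i))"
    by (rule det_rows_mul)
  also have "det (\<chi> i. (if i \<in> J then y else minor_mat I H $ i)) = 0"
    using pq by (intro det_identical_rows[of p q]) (auto simp: row_def vec_eq_iff)
  finally show "det (\<chi> i. if i \<in> J then if i \<in> I then outer x y $ i else 0 else minor_mat I H $ i) = 0" by simp
qed

lemma msig_rank_one:
  fixes H :: "'a::comm_ring_1^'n^'n"
  shows "msig k (\<chi> i j. H $ i $ j + \<tau> * outer x y $ i $ j) = msig k H + \<tau> * dsig k H (outer x y)"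
proof -
  have "Suc 0 \<le> CARD('n)" using zero_less_card_finite[where 'a='n] by linarith
  then obtain n where n: "CARD('n) = Suc n" using Suc_le_D by blast
  have "(\<Sum>m\<le>Suc n. \<tau> ^ m * mixsig k m H (outer x y)) = mixsig k 0 H (outer x y) + \<tau> * mixsig k (Suc 0) H (outer x y)
    + (\<Sum>m\<in>{2..Suc n}. \<tau> ^ m * mixsig k m H (outer x y))"
  proof -
    have "{..Suc n} = insert 0 (insert (Suc 0) {2..Suc n})" by auto
    then show ?thesis by simp
  qed
  also have "(\<Sum>m\<in>{2..Suc n}. \<tau> ^ m * mixsig k m H (outer x y)) = 0"
    by (intro sum.neutral) (simp add: mixsig_outer)
  finally show ?thesis unfolding msig_affine_expand n by (simp add: mixsig_0 mixsig_1)
qed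

definition cmat :: "real^'n^'n \<Rightarrow> complex^'n^'n" where
  "cmat A = (\<chi> i j. complex_of_real (A $ i $ j))"

lemma cmat_nth [simp]: "cmat A $ i $ j = complex_of_real (A $ i $ j)"
  by (simp add: cmat_def)

lemma det_cmat: "det (cmat A) = complex_of_real (det A)"
  by (simp add: det_def of_real_sum of_real_prod)

lemma minor_mat_cmat: "minor_mat I (cmat A) = cmat (minor_mat I A)"
  by (auto simp: minor_mat_def vec_eq_iff axis_def)

lemma msig_cmat: "msig k (cmat A) = complex_of_real (msig k A)"
  by (simp add: msig_def minor_mat_cmat det_cmat)

lemma mat_nth: "mat t $ i $ j = (if i = j then t else 0)"
  by (simp add: mat_def)

lemma msig_add_mat:
  fixes A :: "'a::field_char_0^'n^'n"
  assumes "k \<le> CARD('n)"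
  shows "msig k (A + mat t) = (\<Sum>i\<le>k. of_nat ((CARD('n) - (k - i)) choose i) * t ^ i * msig (k - i) A)"
proof -
  have "msig k (A + mat t) = msig k (\<chi> i j. 1 * A $ i $ j + (if i = j then t else 0))"
    by (intro arg_cong[of _ _ "msig k"]) (simp add: vec_eq_iff mat_nth)
  also have "\<dots> = (\<Sum>j\<le>k. of_nat ((CARD('n) - j) choose (k - j)) * 1 ^ j * t ^ (k - j) * msig j A)"
    by (rule msig_shift[OF assms])
  also have "\<dots> = (\<Sum>i\<le>k. of_nat ((CARD('n) - (k - i)) choose i) * t ^ i * msig (k - i) A)"
    by (rule sum.reindex_bij_witness[of _ "\<lambda>i. k - i" "\<lambda>i. k - i"]) auto
  finally show ?thesis .
qed

lemma mixsig_diag: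
  fixes H B :: "'a::comm_ring_1^'n^'n"
  shows mixsig_gt: "k < m \<Longrightarrow> mixsig k m H B = 0" and mixsig_self: "mixsig k k H B = msig k B"
proof -
  have z: "det (\<chi> i. if i \<in> J then if i \<in> I then B $ i else 0 else minor_mat I H $ i) = 0" if JI: "\<not> J \<subseteq> I" for I J
  proof -
    obtain l where l: "l \<in> J" "l \<notin> I" using JI by blast
    have "(\<chi> i. if i \<in> J then if i \<in> I then B $ i else 0 else minor_mat I H $ i) =
      (\<chi> i. if i = l then 0 else (if i \<in> J then if i \<in> I then B $ i else 0 else minor_mat I H $ i))"
      using l by (auto simp: vec_eq_iff)
    then show ?thesis by (simp only: det_row_0)
  qed
  show "mixsig k m H B = 0" if "k < m"
    unfolding mixsig_def
  proof (intro sum.neutral ballI z)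
    fix I J :: "'n set" assume "I \<in> {I. card I = k}" "J \<in> {J. card J = m}"
    then show "\<not> J \<subseteq> I" using card_mono[of I J] that by auto
  qed
  show "mixsig k k H B = msig k B"
    unfolding mixsig_def msig_def
  proof (rule sum.cong[OF refl])
    fix I :: "'n set" assume I: "I \<in> {I. card I = k}"
    have "(\<Sum>J | card J = k. det (\<chi> i. if i \<in> J then if i \<in> I then B $ i else 0 else minor_mat I H $ i)) =
      (\<Sum>J\<in>{I}. det (\<chi> i. if i \<in> J then if i \<in> I then B $ i else 0 else minor_mat I H $ i))"
    proof (rule sum.mono_neutral_right)
      show "\<forall>J\<in>{J. card J = k} - {I}. det (\<chi> i. if i \<in> J then if i \<in> I then B $ i else 0 else minor_mat I H $ i) = 0"
      proof
        fix J assume J: "J \<in> {J. card J = k} - {I}"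
        have "\<not> J \<subseteq> I"
        proof
          assume "J \<subseteq> I"
          then have "J = I" using I J by (intro card_subset_eq) auto
          then show False using J by simp
        qed
        then show "det (\<chi> i. if i \<in> J then if i \<in> I then B $ i else 0 else minor_mat I H $ i) = 0" by (rule z)
      qed
    qed (use I in auto)
    also have "\<dots> = det (minor_mat I B)"
      by (auto intro!: arg_cong[of _ _ det] simp: vec_eq_iff minor_mat_def)
    finally show "(\<Sum>J | card J = k. det (\<chi> i. if i \<in> J then if i \<in> I then B $ i else 0 else minor_mat I H $ i)) = det (minor_mat I B)" .
  qed
qed

lemma msig_affine_expand':
  fixes H B :: "'a::comm_ring_1^'n^'n"
  assumes "k \<le> CARD('n)"
  shows "msig k (\<chi> i j. H $ i $ j + \<tau> * B $ i $ j) = (\<Sum>m\<le>k. \<tau> ^ m * mixsig k m H B)"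
  unfolding msig_affine_expand using assms by (intro sum.mono_neutral_right) (auto simp: mixsig_gt)

lemma tendsto_det:
  fixes M :: "'b \<Rightarrow> 'a::real_normed_field^'n^'n"
  assumes "\<And>i j. ((\<lambda>x. M x $ i $ j) \<longlongrightarrow> L $ i $ j) F"
  shows "((\<lambda>x. det (M x)) \<longlongrightarrow> det L) F"
  unfolding det_def by (intro tendsto_intros assms)

lemma tendsto_msig:
  fixes M :: "'b \<Rightarrow> 'a::real_normed_field^'n^'n"
  assumes "\<And>i j. ((\<lambda>x. M x $ i $ j) \<longlongrightarrow> L $ i $ j) F"
  shows "((\<lambda>x. msig k (M x)) \<longlongrightarrow> msig k L) F"
  unfolding msig_def minor_mat_def by (intro tendsto_sum tendsto_det) (auto intro: assms)

lemma tendsto_dsig: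
  fixes M B :: "'b \<Rightarrow> 'a::real_normed_field^'n^'n"
  assumes "\<And>i j. ((\<lambda>x. M x $ i $ j) \<longlongrightarrow> L $ i $ j) F" "\<And>i j. ((\<lambda>x. B x $ i $ j) \<longlongrightarrow> N $ i $ j) F"
  shows "((\<lambda>x. dsig k (M x) (B x)) \<longlongrightarrow> dsig k L N) F"
  unfolding dsig_def minor_mat_def by (intro tendsto_sum tendsto_det) (auto intro: assms)

lemma tendsto_mixsig:
  fixes M B :: "'b \<Rightarrow> 'a::real_normed_field^'n^'n"
  assumes "\<And>i j. ((\<lambda>x. M x $ i $ j) \<longlongrightarrow> L $ i $ j) F" "\<And>i j. ((\<lambda>x. B x $ i $ j) \<longlongrightarrow> N $ i $ j) F"
  shows "((\<lambda>x. mixsig k m (M x) (B x)) \<longlongrightarrow> mixsig k m L N) F"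
  unfolding mixsig_def minor_mat_def by (intro tendsto_sum tendsto_det) (auto intro: assms)

lemma continuous_on_msig:
  fixes M :: "'b::topological_space \<Rightarrow> 'a::real_normed_field^'n^'n"
  assumes "\<And>i j. continuous_on S (\<lambda>x. M x $ i $ j)"
  shows "continuous_on S (\<lambda>x. msig k (M x))"
  using assms unfolding continuous_on_def by (auto intro!: tendsto_msig)

lemma continuous_on_dsig:
  fixes M B :: "'b::topological_space \<Rightarrow> 'a::real_normed_field^'n^'n"
  assumes "\<And>i j. continuous_on S (\<lambda>x. M x $ i $ j)" "\<And>i j. continuous_on S (\<lambda>x. B x $ i $ j)"
  shows "continuous_on S (\<lambda>x. dsig k (M x) (B x))"
  using assms unfolding continuous_on_def by (auto intro!: tendsto_dsig)

lemma continuous_on_mixsig: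
  fixes M B :: "'b::topological_space \<Rightarrow> 'a::real_normed_field^'n^'n"
  assumes "\<And>i j. continuous_on S (\<lambda>x. M x $ i $ j)" "\<And>i j. continuous_on S (\<lambda>x. B x $ i $ j)"
  shows "continuous_on S (\<lambda>x. mixsig k m (M x) (B x))"
  using assms unfolding continuous_on_def by (auto intro!: tendsto_mixsig)

section \<open>Polynomials with roots in a half plane\<close>

lemma complex_poly_factor:
  assumes "degree (P::complex poly) > 0"
  obtains r Q where "P = [:-r, 1:] * Q" "Q \<noteq> 0" "degree P = Suc (degree Q)" "lead_coeff P = lead_coeff Q"
proof -
  obtain r where "poly P r = 0" using alg_closed_imp_poly_has_root[OF assms] by blast
  then obtain Q where Q: "P = [:-r, 1:] * Q" using poly_eq_0_iff_dvd by (blast elim: dvdE)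
  moreover have "Q \<noteq> 0" using Q assms by auto
  moreover have "degree P = Suc (degree Q)" unfolding Q using \<open>Q \<noteq> 0\<close> by (subst degree_mult_eq) auto
  moreover have "lead_coeff P = lead_coeff Q" unfolding Q lead_coeff_mult by simp
  ultimately show ?thesis using that by blast
qed

text \<open>
  Each linear factor \<open>z - r\<close> has modulus at least \<open>Im z\<close> when
  \<open>Im r \<le> 0\<close>.
\<close>
lemma poly_lower_bound:
  assumes "P \<noteq> 0" "\<And>r. poly P r = 0 \<Longrightarrow> Im r \<le> 0" "Im z \<ge> 0"
  shows "norm (poly P z) \<ge> norm (lead_coeff P) * Im z ^ degree P"
  using assms(1,2)
proof (induction "degree P" arbitrary: P)
  case 0
  then obtain c where "P = [:c:]" by (metis degree_eq_zeroE)
  then show ?case by simp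
next
  case (Suc d)
  obtain r Q where Q: "P = [:-r, 1:] * Q" "Q \<noteq> 0" "degree P = Suc (degree Q)" "lead_coeff P = lead_coeff Q"
    using complex_poly_factor[of P] Suc.hyps(2) by (metis zero_less_Suc)
  have r: "Im r \<le> 0" using Suc.prems(2)[of r] Q by simp
  have IH: "norm (poly Q z) \<ge> norm (lead_coeff Q) * Im z ^ degree Q"
    using Q Suc by (intro Suc.hyps(1)) auto
  have "Im z \<le> norm (z - r)" using abs_Im_le_cmod[of "z - r"] r by simp
  then have "Im z * (norm (lead_coeff Q) * Im z ^ degree Q) \<le> norm (z - r) * norm (poly Q z)"
    using IH assms(3) by (intro mult_mono) auto
  moreover have "poly P z = (z - r) * poly Q z" unfolding Q(1) by (simp add: algebra_simps)
  ultimately show ?case unfolding Q(4) unfolding Q(3) by (simp add: norm_mult mult_ac)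
qed

text \<open>
  The logarithmic derivative is the sum of \<open>1 / (z - r)\<close> over the roots, and each
  summand has negative imaginary part. In particular, the derivative has no root in the upper
  half plane either.
\<close>
lemma gauss_lucas_half_plane:
  assumes "P \<noteq> 0" "\<And>r. poly P r = 0 \<Longrightarrow> Im r \<le> 0" "Im z > 0"
  shows "Im (poly (pderiv P) z / poly P z) \<le> 0 \<and> (degree P > 0 \<longrightarrow> Im (poly (pderiv P) z / poly P z) < 0)"
  using assms(1,2)
proof (induction "degree P" arbitrary: P)
  case 0
  then obtain c where "P = [:c:]" by (metis degree_eq_zeroE)
  then show ?case by (simp add: pderiv_pCons)
next
  case (Suc d)
  obtain r Q where Q: "P = [:-r, 1:] * Q" "Q \<noteq> 0" "degree P = Suc (degree Q)"
    using complex_poly_factor[of P] Suc.hyps(2) by (metis zero_less_Suc)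
  have r: "Im r \<le> 0" using Suc.prems(2)[of r] Q by simp
  have IH: "Im (poly (pderiv Q) z / poly Q z) \<le> 0"
    using Q Suc by (metis (no_types, lifting) mult_eq_0_iff nat.inject poly_mult)
  have zr: "z - r \<noteq> 0" using r assms(3) by auto
  have Qz: "poly Q z \<noteq> 0" using Suc.prems(2)[of z] assms(3) Q by auto
  have "poly (pderiv P) z = poly Q z + (z - r) * poly (pderiv Q) z"
    unfolding Q(1) pderiv_mult by (simp add: pderiv_pCons algebra_simps)
  moreover have "poly P z = (z - r) * poly Q z" unfolding Q(1) by (simp add: algebra_simps)
  ultimately have "poly (pderiv P) z / poly P z = (poly Q z + (z - r) * poly (pderiv Q) z) / ((z - r) * poly Q z)"
    by simp
  also have "\<dots> = inverse (z - r) + poly (pderiv Q) z / poly Q z"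
    using zr Qz by (simp add: divide_simps)
  finally have "poly (pderiv P) z / poly P z = inverse (z - r) + poly (pderiv Q) z / poly Q z" .
  moreover have "Im (inverse (z - r)) < 0"
  proof -
    have "(Re (z - r))\<^sup>2 + (Im (z - r))\<^sup>2 > 0" using r assms(3) by (intro add_nonneg_pos) auto
    moreover have "Im (z - r) > 0" using r assms(3) by simp
    ultimately show ?thesis by (simp add: divide_neg_pos del: minus_complex.simps)
  qed
  ultimately show ?case using IH by simp
qed

text \<open>
  Every linear factor \<open>X - r\<close> with \<open>r < 0\<close> has positive coefficients.
\<close>
lemma coeffs_pos_of_negative_roots:
  fixes P :: "complex poly"
  assumes "\<And>r. poly P r = 0 \<Longrightarrow> Im r = 0 \<and> Re r < 0" "Im (lead_coeff P) = 0" "Re (lead_coeff P) > 0" "i \<le> degree P"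
  shows "Im (coeff P i) = 0 \<and> Re (coeff P i) > 0"
  using assms
proof (induction "degree P" arbitrary: P i)
  case 0
  then show ?case by auto
next
  case (Suc d)
  obtain r Q where Q: "P = [:-r, 1:] * Q" "Q \<noteq> 0" "degree P = Suc (degree Q)" "lead_coeff P = lead_coeff Q"
    using complex_poly_factor[of P] Suc.hyps(2) by (metis zero_less_Suc)
  have r: "Im r = 0" "Re r < 0" using Suc.prems(1)[of r] Q(1) by simp_all
  have IH: "Im (coeff Q i) = 0 \<and> Re (coeff Q i) > 0" if "i \<le> degree Q" for i
    using that Q Suc.prems(2,3) Suc.hyps(2) by (intro Suc.hyps(1) Suc.prems(1)) auto
  have IH0: "Im (coeff Q i) = 0 \<and> Re (coeff Q i) \<ge> 0" for i
    using IH[of i] by (cases "i \<le> degree Q") (auto simp: coeff_eq_0)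
  have c: "coeff P i = - r * coeff Q i + (if i = 0 then 0 else coeff Q (i - 1))" for i
    unfolding Q(1) by (cases i) simp_all
  show ?case
  proof (cases "i \<le> degree Q")
    case True
    have "Re (- r * coeff Q i) > 0" using r IH[OF True] by (simp add: mult_neg_pos)
    moreover have "Re (coeff Q (i - 1)) \<ge> 0" "Im (coeff Q (i - 1)) = 0" "Im (coeff Q i) = 0" using IH0 by auto
    ultimately show ?thesis unfolding c using r by (cases "i = 0") simp_all
  next
    case False
    then have "i = Suc (degree Q)" using Suc.prems(4) Q(3) by simp
    then show ?thesis using Suc.prems(2,3) Q(3) by metis
  qed
qed

section \<open>Real-rootedness in the direction of the identity\<close>

text \<open>
  The polynomial \<open>z \<mapsto> \<sigma>\<^sub>k(A + z I)\<close>.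
\<close>
definition shift_poly :: "nat \<Rightarrow> real^'n^'n \<Rightarrow> complex poly" where
  "shift_poly k A = (\<Sum>i\<le>k. monom (of_real (real ((CARD('n) - (k - i)) choose i) * msig (k - i) A)) i)"

lemma poly_shift_poly:
  fixes A :: "real^'n^'n"
  assumes "k \<le> CARD('n)"
  shows "poly (shift_poly k A) z = msig k (cmat A + mat z)"
  unfolding msig_add_mat[OF assms] shift_poly_def
  by (simp add: poly_sum poly_monom msig_cmat mult_ac)

lemma coeff_shift_poly:
  fixes A :: "real^'n^'n"
  shows "coeff (shift_poly k A) i = (if i \<le> k then of_real (real ((CARD('n) - (k - i)) choose i) * msig (k - i) A) else 0)"
  unfolding shift_poly_def by (simp add: coeff_sum sum.delta' if_distrib cong: if_cong)

lemma degree_shift_poly: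
  fixes A :: "real^'n^'n"
  assumes "k \<le> CARD('n)"
  shows "degree (shift_poly k A) = k" "lead_coeff (shift_poly k A) = of_nat (CARD('n) choose k)"
proof -
  have c: "coeff (shift_poly k A) k = of_nat (CARD('n) choose k)" by (simp add: coeff_shift_poly)
  have "degree (shift_poly k A) \<le> k" by (intro degree_le) (simp add: coeff_shift_poly)
  moreover have "coeff (shift_poly k A) k \<noteq> 0" using c assms by simp
  ultimately show "degree (shift_poly k A) = k" by (simp add: le_antisym le_degree)
  then show "lead_coeff (shift_poly k A) = of_nat (CARD('n) choose k)" using c by simp
qed

text \<open>
  Going from \<open>\<sigma>\<^sub>k\<^sub>+\<^sub>1\<close> to \<open>\<sigma>\<^sub>k\<close>
  amounts to differentiating along the identity; this links the real-rootedness of all these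
  polynomials to that of the characteristic polynomial.
\<close>
lemma pderiv_shift_poly:
  fixes A :: "real^'n^'n"
  assumes "Suc k \<le> CARD('n)"
  shows "pderiv (shift_poly (Suc k) A) = smult (of_nat (CARD('n) - k)) (shift_poly k A)"
proof (rule poly_eqI)
  fix i
  show "coeff (pderiv (shift_poly (Suc k) A)) i = coeff (smult (of_nat (CARD('n) - k)) (shift_poly k A)) i"
  proof (cases "i \<le> k")
    case True
    define N where "N = CARD('n) - (k - i)"
    have "Suc i * (N choose Suc i) = (N - i) * (N choose i)"
      by (metis binomial_absorb_comp Suc_times_binomial_eq binomial_absorption mult.commute)
    moreover have "N - i = CARD('n) - k" using True assms unfolding N_def by simp
    ultimately have "complex_of_nat (Suc i * (N choose Suc i)) = of_nat ((CARD('n) - k) * (N choose i))" by simp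
    then show ?thesis using True unfolding coeff_pderiv coeff_smult coeff_shift_poly N_def
      by (simp only: of_nat_mult) (simp add: mult_ac)
  qed (simp add: coeff_pderiv coeff_shift_poly)
qed

lemma cnj_shift_poly: "poly (shift_poly k A) (cnj z) = cnj (poly (shift_poly k A) z)"
  unfolding shift_poly_def by (simp add: poly_sum poly_monom)

text \<open>
  For a null vector \<open>x\<close>, the number \<open>x\<^sup>* A x = - z |x|\<^sup>2\<close>
  equals its own conjugate.
\<close>
lemma symmetric_eigenvalues_real:
  fixes A :: "real^'n^'n"
  assumes "transpose A = A" "det (cmat A + mat z) = 0"
  shows "Im z = 0"
proof -
  have "\<not> invertible (cmat A + mat z)" using assms(2) by (simp add: invertible_det_nz)
  then obtain x where x: "(cmat A + mat z) *v x = 0" "x \<noteq> 0"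
    by (auto simp: invertible_left_inverse matrix_left_invertible_ker)
  have row: "(\<Sum>j\<in>UNIV. of_real (A $ i $ j) * x $ j) = - z * x $ i" for i
  proof -
    have "((cmat A + mat z) *v x) $ i = (\<Sum>j\<in>UNIV. of_real (A $ i $ j) * x $ j + (if i = j then z * x $ j else 0))"
      unfolding matrix_vector_mult_def by (auto simp: mat_nth algebra_simps intro!: sum.cong)
    then show ?thesis using x(1) by (simp add: sum.distrib eq_neg_iff_add_eq_0)
  qed
  define s where "s = (\<Sum>i\<in>UNIV. \<Sum>j\<in>UNIV. cnj (x $ i) * of_real (A $ i $ j) * x $ j)"
  define N where "N = (\<Sum>i\<in>UNIV. (norm (x $ i))\<^sup>2)"
  have "s = (\<Sum>i\<in>UNIV. cnj (x $ i) * (\<Sum>j\<in>UNIV. of_real (A $ i $ j) * x $ j))"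
    unfolding s_def by (simp add: sum_distrib_left mult_ac)
  also have "\<dots> = - z * of_real N"
  proof -
    have "cnj (x $ i) * x $ i = of_real ((norm (x $ i))\<^sup>2)" for i
      by (metis complex_norm_square mult.commute)
    then show ?thesis
      unfolding row N_def of_real_sum sum_distrib_left
      by (intro sum.cong refl) (metis mult.left_commute)
  qed
  finally have s: "s = - z * of_real N" .
  have "A $ j $ i = A $ i $ j" for i j using assms(1) by (metis transpose_def vec_lambda_beta)
  then have "cnj s = (\<Sum>i\<in>UNIV. \<Sum>j\<in>UNIV. cnj (x $ j) * of_real (A $ j $ i) * x $ i)"
    unfolding s_def by (simp add: mult_ac)
  also have "\<dots> = s" unfolding s_def by (rule sum.swap)
  finally have "Im s = 0" by (metis complex_cnj_cancel_iff cnj.simps(2) neg_equal_zero)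
  then have "Im z * N = 0" using s by simp
  moreover have "N > 0"
  proof -
    obtain i where "x $ i \<noteq> 0" using x(2) by (auto simp: vec_eq_iff)
    then show ?thesis unfolding N_def by (intro sum_pos2[of _ i]) auto
  qed
  ultimately show ?thesis by simp
qed

lemma msig_CARD: "msig CARD('n) (A::'a::comm_ring_1^'n^'n) = det A"
proof -
  have "{I::'n set. card I = CARD('n)} = {UNIV}" using card_eq_UNIV_imp_eq_UNIV[where 'a='n] by auto
  moreover have "minor_mat UNIV A = A" by (simp add: minor_mat_def vec_eq_iff)
  ultimately show ?thesis by (simp add: msig_def)
qed

text \<open>
  Descending induction on \<open>k\<close>: for \<open>k = n\<close> this is the reality of the
  eigenvalues, and passing from \<open>k + 1\<close> to \<open>k\<close> is differentiation,
  which preserves real-rootedness by Gauss--Lucas.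
\<close>
lemma msig_shift_roots_real:
  fixes A :: "real^'n^'n"
  assumes "transpose A = A" "k \<le> CARD('n)" "msig k (cmat A + mat z) = 0"
  shows "Im z = 0"
  using assms(2,3)
proof (induction k arbitrary: z rule: inc_induct)
  case base
  then show ?case using symmetric_eigenvalues_real[OF assms(1)] by (simp add: msig_CARD)
next
  case (step k)
  have k: "k \<le> CARD('n)" "Suc k \<le> CARD('n)" using step.hyps by auto
  have roots: "Im r = 0" if "poly (shift_poly (Suc k) A) r = 0" for r
    using step.IH[of r] that by (simp add: poly_shift_poly[OF k(2)])
  have nz: "shift_poly (Suc k) A \<noteq> 0" using degree_shift_poly(1)[OF k(2), of A] by auto
  have key: "poly (shift_poly k A) w \<noteq> 0" if "Im w > 0" for w
  proof
    assume "poly (shift_poly k A) w = 0"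
    then have "poly (pderiv (shift_poly (Suc k) A)) w = 0" by (simp add: pderiv_shift_poly[OF k(2)])
    moreover have "Im (poly (pderiv (shift_poly (Suc k) A)) w / poly (shift_poly (Suc k) A) w) < 0"
      using gauss_lucas_half_plane[OF nz _ that] roots degree_shift_poly(1)[OF k(2), of A] by auto
    ultimately show False by simp
  qed
  have "poly (shift_poly k A) z = 0" using step.prems poly_shift_poly[OF k(1), of A z] by simp
  then have "poly (shift_poly k A) (cnj z) = 0" by (simp add: cnj_shift_poly)
  with key[of z] key[of "cnj z"] \<open>poly (shift_poly k A) z = 0\<close> show ?case by (auto simp: not_less[symmetric])  (meson linorder_neqE_linordered_idom)
qed

lemma real_roots_split:
  fixes P :: "complex poly" and S :: "'n::finite set"
  assumes "\<And>r. poly P r = 0 \<Longrightarrow> Im r = 0" "degree P = card S" "P \<noteq> 0"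
  shows "\<exists>lam::'n \<Rightarrow> real. P = smult (lead_coeff P) (\<Prod>i\<in>S. [:- of_real (lam i), 1:])"
proof -
  have "finite S" by simp
  then show ?thesis using assms
  proof (induction S arbitrary: P rule: finite_induct)
    case empty
    then obtain c where "P = [:c:]" by (metis degree_eq_zeroE card.empty)
    then show ?case by simp
  next
    case (insert x S)
    then have "degree P > 0" by simp
    then obtain r Q where Q: "P = [:-r, 1:] * Q" "Q \<noteq> 0" "degree P = Suc (degree Q)" "lead_coeff P = lead_coeff Q"
      by (rule complex_poly_factor)
    have r: "of_real (Re r) = r" using insert.prems(1)[of r] Q(1) by (simp add: complex_eq_iff)
    obtain lam where lam: "Q = smult (lead_coeff Q) (\<Prod>i\<in>S. [:- of_real (lam i), 1:])"
      using insert.IH[of Q] insert.prems insert.hyps Q by auto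
    have "(\<Prod>i\<in>S. [:- of_real ((lam(x := Re r)) i), 1:]) = (\<Prod>i\<in>S. [:- complex_of_real (lam i), 1:])"
      using insert.hyps by (intro prod.cong) auto
    then have "P = smult (lead_coeff P) (\<Prod>i\<in>insert x S. [:- of_real ((lam(x := Re r)) i), 1:])"
      unfolding Q(4) using insert.hyps r
      by (simp add: mult_smult_right[symmetric] lam[symmetric] Q(1) del: mult_pCons_left)
    then show ?case by blast
  qed
qed

lemma symmetric_char_poly_splits:
  fixes A :: "real^'n^'n"
  assumes "transpose A = A"
  shows "\<exists>lam::real^'n. \<forall>t. det (mat t - A) = (\<Prod>i\<in>UNIV. t - lam $ i)"
proof -
  let ?P = "shift_poly CARD('n) (- A)"
  have sym: "transpose (- A) = - A" using assms by (simp add: transpose_def vec_eq_iff)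
  have "\<exists>lam::'n \<Rightarrow> real. ?P = smult (lead_coeff ?P) (\<Prod>i\<in>UNIV. [:- of_real (lam i), 1:])"
    using msig_shift_roots_real[OF sym, of "CARD('n)"] degree_shift_poly(1)[of "CARD('n)" "- A"]
    by (intro real_roots_split) (auto simp: poly_shift_poly)
  then obtain lam where lam: "?P = (\<Prod>i\<in>(UNIV::'n set). [:- of_real (lam i), 1:])"
    using degree_shift_poly(2)[of "CARD('n)" "- A"] by auto
  have "det (mat t - A) = (\<Prod>i\<in>UNIV. t - (\<chi> i. lam i) $ i)" for t
  proof -
    have "complex_of_real (det (mat t - A)) = poly ?P (of_real t)"
    proof -
      have "cmat (- A) + mat (of_real t) = cmat (mat t - A)" by (auto simp: vec_eq_iff mat_nth)
      then show ?thesis by (simp add: poly_shift_poly msig_CARD det_cmat)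
    qed
    also have "\<dots> = of_real (\<Prod>i\<in>UNIV. t - lam i)"
      unfolding lam by (simp add: poly_prod)
    finally show ?thesis by (simp only: of_real_eq_iff) simp
  qed
  then show ?thesis by blast
qed

text \<open>
  The diagonal matrix with the chosen eigenvalues has the same characteristic polynomial as
  \<open>A\<close>, hence the same sums of principal minors.
\<close>
lemma esym_eigenvalue_vector:
  fixes A :: "real^'n^'n"
  assumes "transpose A = A"
  shows "esym k (eigenvalue_vector A) = msig k A"
proof -
  define lam where "lam = eigenvalue_vector A"
  have lam: "det (mat t - A) = (\<Prod>i\<in>UNIV. t - lam $ i)" for t
    using someI_ex[OF symmetric_char_poly_splits[OF assms]] unfolding lam_def eigenvalue_vector_def by blast
  define D where "D = (\<chi> i j. if i = j then lam $ i else 0)"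
  have D: "det (mat t - D) = (\<Prod>i\<in>UNIV. t - lam $ i)" for t
  proof -
    have "det (mat t - D) = (\<Prod>i\<in>UNIV. (mat t - D) $ i $ i)"
      by (rule det_diagonal) (auto simp: D_def mat_nth)
    then show ?thesis by (simp add: D_def mat_nth)
  qed
  have ex: "det (mat t - M) = (\<Sum>k\<le>CARD('n). t ^ k * ((-1) ^ (CARD('n) - k) * msig (CARD('n) - k) M))" for t and M :: "real^'n^'n"
  proof -
    have "mat t - M = (\<chi> i j. (-1) * M $ i $ j + (if i = j then t else 0))" by (simp add: vec_eq_iff mat_nth)
    then have "det (mat t - M) = (\<Sum>k\<le>CARD('n). (-1) ^ k * t ^ (CARD('n) - k) * msig k M)" by (simp only: det_msig)
    also have "\<dots> = (\<Sum>k\<le>CARD('n). t ^ k * ((-1) ^ (CARD('n) - k) * msig (CARD('n) - k) M))"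
      by (rule sum.reindex_bij_witness[of _ "\<lambda>i. CARD('n) - i" "\<lambda>i. CARD('n) - i"]) auto
    finally show ?thesis .
  qed
  show ?thesis
  proof (cases "k \<le> CARD('n)")
    case True
    have eq: "(\<Sum>k\<le>CARD('n). t ^ k * ((-1) ^ (CARD('n) - k) * msig (CARD('n) - k) A)) =
      (\<Sum>k\<le>CARD('n). t ^ k * ((-1) ^ (CARD('n) - k) * msig (CARD('n) - k) D))" for t
      using lam[of t] D[of t] by (simp add: ex)
    have "CARD('n) - k \<le> CARD('n)" by simp
    from power_sum_coeffs_unique[OF eq this] have "msig k A = msig k D" using True by simp
    then show ?thesis unfolding D_def msig_diag lam_def by simp
  next
    case False
    then show ?thesis using msig_diag[of k lam] by (simp add: msig_gt lam_def)
  qed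
qed

section \<open>The Garding cone\<close>

text \<open>
  The open cone serves the proof of convexity, where a continuity argument needs strict
  positivity; the closed cone is the one of the problem and inherits the result by
  approximation.
\<close>
definition ocone :: "nat \<Rightarrow> (real^'n^'n) set" where
  "ocone k = {A. transpose A = A \<and> (\<forall>j\<in>{1..k}. msig j A > 0)}"

definition gcone :: "nat \<Rightarrow> (real^'n^'n) set" where
  "gcone k = {A. transpose A = A \<and> (\<forall>j\<in>{1..k}. msig j A \<ge> 0)}"

lemma transpose_add: "transpose (A + B) = transpose A + transpose (B::'a::ab_semigroup_add^'n^'m)"
  by (simp add: transpose_def vec_eq_iff)

lemma transpose_mat: "transpose (mat t :: 'a::zero^'n^'n) = mat t"
  by (auto simp: transpose_def vec_eq_iff mat_nth)

lemma ocone_shift_pos: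
  fixes A :: "real^'n^'n"
  assumes "A \<in> gcone k" "msig k A > 0" "k \<le> CARD('n)" "t \<ge> 0"
  shows "msig k (A + mat t) > 0"
proof -
  have nn: "msig j A \<ge> 0" if "j \<le> k" for j
    using assms(1) that by (cases "j = 0") (auto simp: gcone_def)
  show ?thesis unfolding msig_add_mat[OF assms(3)]
    using assms(2,4) by (intro sum_pos2[of _ 0]) (auto intro!: mult_nonneg_nonneg nn)
qed

lemma ocone_subset_gcone: "A \<in> ocone k \<Longrightarrow> A \<in> gcone k"
  by (auto simp: ocone_def gcone_def less_imp_le)

lemma ocone_mono: "A \<in> ocone k \<Longrightarrow> j \<le> k \<Longrightarrow> A \<in> ocone j"
  by (auto simp: ocone_def)

lemma gcone_mono: "A \<in> gcone k \<Longrightarrow> j \<le> k \<Longrightarrow> A \<in> gcone j"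
  by (auto simp: gcone_def)

lemma ocone_msig_pos: "A \<in> ocone k \<Longrightarrow> msig k A > 0"
  by (cases "k = 0") (auto simp: ocone_def)

lemma cmat_add_mat: "cmat A + mat (of_real t) = cmat (A + mat t)"
  by (auto simp: vec_eq_iff mat_nth)

text \<open>
  A purely imaginary shift \<open>w\<close> keeps the zeros in \<open>z\<close> off the real
  axis while \<open>r\<close> deforms \<open>X\<close> to \<open>0\<close>.
\<close>
definition cpencil :: "real^'n^'n \<Rightarrow> real^'n^'n \<Rightarrow> complex \<Rightarrow> complex \<Rightarrow> complex \<Rightarrow> complex^'n^'n" where
  "cpencil X A r w z = (\<chi> i j. (r * of_real (X $ i $ j) + (if i = j then w else 0)) + z * of_real (A $ i $ j))"

lemma cpencil_poly:
  fixes A X :: "real^'n^'n"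
  assumes "k \<le> CARD('n)" "msig k A > 0"
  obtains P where "\<And>z. poly P z = msig k (cpencil X A r w z)" "degree P = k" "lead_coeff P = of_real (msig k A)" "P \<noteq> 0"
proof -
  define U where "U = (\<chi> i j. r * of_real (X $ i $ j) + (if i = j then w else 0))"
  define P where "P = (\<Sum>m\<le>k. monom (mixsig k m U (cmat A)) m)"
  have c: "coeff P i = (if i \<le> k then mixsig k i U (cmat A) else 0)" for i
    unfolding P_def by (simp add: coeff_sum sum.delta' if_distrib cong: if_cong)
  have ck: "coeff P k = of_real (msig k A)" by (simp add: c mixsig_self msig_cmat)
  have "degree P \<le> k" by (intro degree_le) (simp add: c)
  moreover have "coeff P k \<noteq> 0" using ck assms(2) by simp
  ultimately have d: "degree P = k" by (simp add: le_antisym le_degree)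
  have "poly P z = msig k (cpencil X A r w z)" for z
  proof -
    have "cpencil X A r w z = (\<chi> i j. U $ i $ j + z * cmat A $ i $ j)"
      by (simp add: cpencil_def U_def)
    then show ?thesis unfolding P_def
      by (simp only: msig_affine_expand'[OF assms(1)]) (simp add: poly_sum poly_monom mult.commute)
  qed
  moreover have "P \<noteq> 0" using \<open>coeff P k \<noteq> 0\<close> by auto
  ultimately show ?thesis using that d ck by blast
qed

text \<open>
  As a polynomial in \<open>z\<close>, the left-hand side has degree \<open>k\<close> and
  leading coefficient \<open>\<sigma>\<^sub>k(A)\<close>. The bound does not involve
  \<open>X\<close>, \<open>r\<close> and \<open>w\<close>, so it survives limits in these
  parameters and shows that zeros in the open upper half plane cannot appear in a limit.
\<close>
lemma cpencil_bound:
  fixes A X :: "real^'n^'n"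
  assumes "k \<le> CARD('n)" "msig k A > 0" "\<And>z. Im z > 0 \<Longrightarrow> msig k (cpencil X A r w z) \<noteq> 0" "Im z \<ge> 0"
  shows "norm (msig k (cpencil X A r w z)) \<ge> msig k A * Im z ^ k"
proof -
  obtain P where P: "\<And>z. poly P z = msig k (cpencil X A r w z)" "degree P = k" "lead_coeff P = of_real (msig k A)" "P \<noteq> 0"
    using cpencil_poly[OF assms(1,2)] by blast
  have "norm (poly P z) \<ge> norm (lead_coeff P) * Im z ^ degree P"
    using P(4) assms(4) by (intro poly_lower_bound) (use assms(3) P(1) in \<open>force simp: not_less[symmetric]\<close>)+
  then show ?thesis unfolding P(3) unfolding P(1) P(2) using assms(2) by simp
qed

lemma tendsto_cpencil:
  assumes "(f \<longlongrightarrow> r) F" "(g \<longlongrightarrow> w) F" "(h \<longlongrightarrow> z) F"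
  shows "((\<lambda>x. msig k (cpencil X A (f x) (g x) (h x))) \<longlongrightarrow> msig k (cpencil X A r w z)) F"
  unfolding cpencil_def using assms by (intro tendsto_msig) (auto intro!: tendsto_intros)

text \<open>
  Garding's argument. Deform \<open>X\<close> to \<open>0\<close> through \<open>r X\<close>. At
  a real zero \<open>z\<close>, \<open>i \<epsilon>\<close> would be a root of \<open>t
  \<mapsto> \<sigma>\<^sub>k(Y + t I)\<close> for a real symmetric matrix \<open>Y\<close>,
  which \<open>msig_shift_roots_real\<close> excludes; so no zero crosses the real axis during
  the deformation. None comes from infinity, because the leading coefficient
  \<open>\<sigma>\<^sub>k(A)\<close> is fixed. For \<open>r = 0\<close> there is none in the
  upper half plane, because \<open>A\<close> lies in the cone.
\<close>
lemma msig_pencil_nonzero_shifted: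
  fixes A X :: "real^'n^'n"
  assumes k: "k \<le> CARD('n)" and A: "A \<in> ocone k" and X: "transpose X = X" and e: "\<epsilon> > 0" and z: "Im z \<ge> 0"
  shows "msig k (cpencil X A 1 (\<i> * of_real \<epsilon>) z) \<noteq> 0"
proof -
  have Asym: "transpose A = A" using A by (simp add: ocone_def)
  have pA: "msig k A > 0" using A by (rule ocone_msig_pos)
  let ?w = "\<i> * of_real \<epsilon>"
  define f where "f r z = msig k (cpencil X A (of_real r) ?w z)" for r z
  have real: "f r z \<noteq> 0" if "Im z = 0" for r z
  proof
    assume 0: "f r z = 0"
    define Y where "Y = (\<chi> i j. r * X $ i $ j + Re z * A $ i $ j)"
    have "X $ j $ i = X $ i $ j" "A $ j $ i = A $ i $ j" for i j
      using X Asym by (metis transpose_def vec_lambda_beta)+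
    then have Y: "transpose Y = Y" by (simp add: transpose_def Y_def)
    have z: "z = of_real (Re z)" using that by (simp add: complex_eq_iff)
    have "cpencil X A (of_real r) ?w z = cmat Y + mat ?w"
      by (subst z) (auto simp: cpencil_def vec_eq_iff mat_nth Y_def)
    then have "Im ?w = 0" using msig_shift_roots_real[OF Y k, of ?w] 0 by (simp add: f_def)
    then show False using e by simp
  qed
  have start: "f 0 z \<noteq> 0" if "Im z \<ge> 0" for z
  proof (cases "z = 0")
    case True
    then show ?thesis using real[of 0 0] by simp
  next
    case False
    have "cpencil X A 0 ?w z = (\<chi> i j. z * (cmat A + mat (?w / z)) $ i $ j)"
      using False by (auto simp: cpencil_def vec_eq_iff mat_nth algebra_simps)
    then have eq: "f 0 z = z ^ k * msig k (cmat A + mat (?w / z))"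
      unfolding f_def by (simp only: of_real_0 msig_scale)
    show ?thesis
    proof
      assume "f 0 z = 0"
      then have 0: "msig k (cmat A + mat (?w / z)) = 0" using eq False by simp
      define y where "y = ?w / z"
      have Imy: "Im y = 0" using msig_shift_roots_real[OF Asym k 0] by (simp add: y_def)
      then have y: "y = of_real (Re y)" by (simp add: complex_eq_iff)
      have "msig k (A + mat (Re y)) = 0"
        using 0 unfolding y_def[symmetric] by (subst (asm) y) (simp add: cmat_add_mat msig_cmat del: of_real_Re)
      then have neg: "Re y < 0" using ocone_shift_pos[OF ocone_subset_gcone[OF A] pA k, of "Re y"] by linarith
      have "y * z = ?w" using False by (simp add: y_def)
      then have "of_real (Re y) * z = ?w" using y by simp
      then have "Im (of_real (Re y) * z) = Im ?w" by simp
      then have "Re y * Im z = \<epsilon>" by simp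
      moreover have "Re y * Im z \<le> 0" using neg that by (simp add: mult_nonpos_nonneg)
      ultimately show False using e by simp
    qed
  qed
  define Good where "Good r \<longleftrightarrow> (\<forall>z. Im z \<ge> 0 \<longrightarrow> f r z \<noteq> 0)" for r
  have cont: "continuous_on S (\<lambda>p. f (fst p) (snd p))" for S
    unfolding f_def continuous_on_def by (auto intro!: tendsto_cpencil tendsto_intros)
  \<comment> \<open>The lower bound \<open>cpencil_bound\<close> passes to the limit off the real
    axis.\<close>
  have closedG: "closed {r\<in>{0..1}. Good r}"
    unfolding closed_sequential_limits
  proof (intro allI impI)
    fix x l assume xl: "(\<forall>n. x n \<in> {r\<in>{0..1}. Good r}) \<and> x \<longlonglongrightarrow> l"
    then have x: "x n \<in> {0..1}" "Good (x n)" and l: "x \<longlonglongrightarrow> l" for n by blast+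
    have "l \<in> {0..1}" by (rule closed_sequentially[OF closed_atLeastAtMost x(1) l])
    moreover have "Good l" unfolding Good_def
    proof (intro allI impI)
      fix z assume z: "Im z \<ge> 0"
      show "f l z \<noteq> 0"
      proof (cases "Im z = 0")
        case True then show ?thesis by (rule real)
      next
        case False
        have nz: "msig k (cpencil X A (of_real (x n)) ?w z) \<noteq> 0" if "Im z > 0" for n z
          using x(2)[of n] that unfolding Good_def f_def by simp
        have b: "norm (f (x n) z) \<ge> msig k A * Im z ^ k" for n
          unfolding f_def by (rule cpencil_bound[OF k pA nz z])
        have "(\<lambda>n. norm (f (x n) z)) \<longlonglongrightarrow> norm (f l z)"
          unfolding f_def by (intro tendsto_norm tendsto_cpencil tendsto_intros l)
        then have "msig k A * Im z ^ k \<le> norm (f l z)"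
          by (rule LIMSEQ_le_const) (use b in auto)
        moreover have "msig k A * Im z ^ k > 0" using pA z False by simp
        ultimately show ?thesis by auto
      qed
    qed
    ultimately show "l \<in> {r\<in>{0..1}. Good r}" by blast
  qed
  \<comment> \<open>The bad parameters are the projection of a zero set, which is compact once the
    zeros are bounded.\<close>
  have closedB: "closed {r\<in>{0..1}. \<not> Good r}"
  proof -
    \<comment> \<open>The reversed polynomial \<open>g r\<close> has value
      \<open>\<sigma>\<^sub>k(A) > 0\<close> at \<open>0\<close>, so its zeros stay at a positive
      distance from \<open>0\<close>, uniformly in \<open>r\<close>; this bounds the zeros of
      \<open>f r\<close>.\<close>
    define g where "g r y = msig k (\<chi> i j. of_real (A $ i $ j) + y * (of_real r * of_real (X $ i $ j) + (if i = j then ?w else 0)))" for r y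
    have gcont: "continuous_on S (\<lambda>p. g (fst p) (snd p))" for S
      unfolding g_def continuous_on_def by (auto intro!: tendsto_intros tendsto_msig)
    have fg: "f r z = z ^ k * g r (1 / z)" if "z \<noteq> 0" for r z
    proof -
      have "cpencil X A (of_real r) ?w z = (\<chi> i j. z * (\<chi> i j. of_real (A $ i $ j) + (1/z) * (of_real r * of_real (X $ i $ j) + (if i = j then ?w else 0))) $ i $ j)"
        using that by (auto simp: cpencil_def vec_eq_iff field_simps)
      then show ?thesis unfolding f_def g_def by (simp only: msig_scale)
    qed
    define K where "K = {p\<in>{0..1} \<times> cball 0 1. g (fst p) (snd p) = 0}"
    have cpt0: "compact ({0..1::real} \<times> cball (0::complex) 1)" by (intro compact_Times) auto
    have "closed K" unfolding K_def
      by (intro continuous_closed_preimage_constant gcont compact_imp_closed cpt0)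
    then have "compact (({0..1::real} \<times> cball (0::complex) 1) \<inter> K)" by (rule compact_Int_closed[OF cpt0])
    moreover have "({0..1::real} \<times> cball (0::complex) 1) \<inter> K = K" by (auto simp: K_def)
    ultimately have "compact K" by simp
    then have "compact (snd ` K)" by (intro compact_continuous_image continuous_intros)
    moreover have "0 \<notin> snd ` K"
    proof
      assume "0 \<in> snd ` K"
      then obtain r where "g r 0 = 0" by (auto simp: K_def)
      then have "msig k (cmat A) = 0" by (simp add: g_def cmat_def)
      then show False using pA by (simp add: msig_cmat)
    qed
    ultimately obtain d where d: "d > 0" "\<forall>y\<in>snd ` K. d \<le> dist 0 y"
      using separate_point_closed compact_imp_closed by metis
    define R where "R = max 1 (1 / d)"
    have bound: "norm z \<le> R" if "r \<in> {0..1}" "f r z = 0" for r z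
    proof (rule ccontr)
      assume "\<not> norm z \<le> R"
      then have z: "norm z > 1" "norm z > 1 / d" by (auto simp: R_def)
      then have "z \<noteq> 0" by auto
      then have "g r (1 / z) = 0" using fg that(2) by auto
      moreover have "norm (1 / z) \<le> 1" using z(1) \<open>z \<noteq> 0\<close> by (simp add: norm_divide divide_le_eq)
      ultimately have "1 / z \<in> snd ` K" using that(1) by (force simp: K_def image_iff)
      then have "d \<le> norm (1 / z)" using d(2) by force
      then show False using z d(1) \<open>z \<noteq> 0\<close> by (simp add: norm_divide field_simps)
    qed
    define L where "L = {p\<in>{0..1} \<times> (cball 0 R \<inter> {z. Im z \<ge> 0}). f (fst p) (snd p) = 0}"
    have cl: "closed {z. Im z \<ge> 0}" by (simp add: closed_halfspace_Im_ge)
    have cpt: "compact ({0..1::real} \<times> (cball 0 R \<inter> {z. Im z \<ge> 0}))"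
      by (intro compact_Times compact_Int_closed cl) auto
    have "closed L" unfolding L_def
      by (intro continuous_closed_preimage_constant cont compact_imp_closed cpt)
    then have "compact (({0..1::real} \<times> (cball 0 R \<inter> {z. Im z \<ge> 0})) \<inter> L)" by (rule compact_Int_closed[OF cpt])
    moreover have "({0..1::real} \<times> (cball 0 R \<inter> {z. Im z \<ge> 0})) \<inter> L = L" by (auto simp: L_def)
    ultimately have "compact L" by simp
    then have "compact (fst ` L)" by (intro compact_continuous_image continuous_intros)
    moreover have "fst ` L = {r\<in>{0..1}. \<not> Good r}"
      using bound unfolding L_def Good_def by (force simp: image_iff)
    ultimately show ?thesis using compact_imp_closed by metis
  qed
  have "Good 1"
  proof (rule ccontr)
    assume "\<not> Good 1"
    then have "1 \<in> {r\<in>{0..1}. \<not> Good r} \<inter> {0..1}" by simp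
    moreover have "0 \<in> {r\<in>{0..1}. Good r} \<inter> {0..1}" using start by (simp add: Good_def)
    moreover have "{0..1} \<subseteq> {r\<in>{0..1}. Good r} \<union> {r\<in>{0..1}. \<not> Good r}" by blast
    moreover have "{r\<in>{0..1}. Good r} \<inter> {r\<in>{0..1}. \<not> Good r} \<inter> {0..1} = {}" by blast
    moreover have "connected {0..1::real}" by simp
    ultimately show False using closedG closedB unfolding connected_closed by (metis empty_iff)
  qed
  then show ?thesis using z unfolding Good_def f_def by simp
qed

text \<open>
  Let \<open>\<epsilon> \<longrightarrow> 0\<close> in
  \<open>msig_pencil_nonzero_shifted\<close>, keeping the lower bound of
  \<open>cpencil_bound\<close>.
\<close>
lemma msig_pencil_nonzero:
  fixes A X :: "real^'n^'n"
  assumes k: "k \<le> CARD('n)" and A: "A \<in> ocone k" and X: "transpose X = X" and z: "Im z > 0"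
  shows "msig k (cpencil X A 1 0 z) \<noteq> 0"
proof -
  have pA: "msig k A > 0" using A by (rule ocone_msig_pos)
  have b: "norm (msig k (cpencil X A 1 (\<i> * of_real (1 / Suc n)) z)) \<ge> msig k A * Im z ^ k" for n
    using z by (intro cpencil_bound[OF k pA] msig_pencil_nonzero_shifted[OF k A X]) auto
  have lim: "(\<lambda>n. 1 / real (Suc n)) \<longlonglongrightarrow> 0" by (rule LIMSEQ_Suc[OF lim_1_over_n])
  have "(\<lambda>n. norm (msig k (cpencil X A 1 (\<i> * of_real (1 / Suc n)) z))) \<longlonglongrightarrow> norm (msig k (cpencil X A 1 (\<i> * of_real 0) z))"
    by (intro tendsto_norm tendsto_cpencil tendsto_intros lim)
  then have "msig k A * Im z ^ k \<le> norm (msig k (cpencil X A 1 (\<i> * of_real 0) z))"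
    by (rule LIMSEQ_le_const) (use b in auto)
  moreover have "msig k A * Im z ^ k > 0" using pA z by simp
  ultimately show ?thesis by auto
qed

lemma mixsig_cmat: "mixsig k m (cmat A) (cmat B) = of_real (mixsig k m A B)"
proof -
  have "(\<chi> i. if i \<in> J then if i \<in> I then cmat B $ i else 0 else minor_mat I (cmat A) $ i) =
    cmat (\<chi> i. if i \<in> J then if i \<in> I then B $ i else 0 else minor_mat I A $ i)" for I J
    by (auto simp: vec_eq_iff minor_mat_def axis_def)
  then show ?thesis unfolding mixsig_def by (simp add: det_cmat)
qed

text \<open>
  The polynomial \<open>t \<mapsto> \<sigma>\<^sub>k(X + t A)\<close> has only real roots, by
  \<open>msig_pencil_nonzero\<close> and complex conjugation, and they are negative by
  assumption. Its coefficients are therefore positive.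
\<close>
lemma mixsig_pos:
  fixes A X :: "real^'n^'n"
  assumes k: "k \<le> CARD('n)" and A: "A \<in> ocone k" and X: "transpose X = X"
    and pos: "\<And>t. t \<ge> 0 \<Longrightarrow> msig k (\<chi> i j. X $ i $ j + t * A $ i $ j) > 0" and m: "m \<le> k"
  shows "mixsig k m X A > 0"
proof -
  have pA: "msig k A > 0" using A by (rule ocone_msig_pos)
  define P where "P = (\<Sum>m\<le>k. monom (mixsig k m (cmat X) (cmat A)) m)"
  have c: "coeff P i = (if i \<le> k then of_real (mixsig k i X A) else 0)" for i
    unfolding P_def by (simp add: coeff_sum sum.delta' if_distrib mixsig_cmat cong: if_cong)
  have ck: "coeff P k = of_real (msig k A)" by (simp add: c mixsig_self)
  have "degree P \<le> k" by (intro degree_le) (simp add: c)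
  moreover have "coeff P k \<noteq> 0" using ck pA by simp
  ultimately have d: "degree P = k" by (simp add: le_antisym le_degree)
  have ev: "poly P z = msig k (\<chi> i j. cmat X $ i $ j + z * cmat A $ i $ j)" for z
    unfolding P_def by (simp only: msig_affine_expand'[OF k]) (simp add: poly_sum poly_monom mult.commute)
  have ev': "poly P z = msig k (cpencil X A 1 0 z)" for z
    unfolding ev cpencil_def by (intro arg_cong[of _ _ "msig k"]) (simp add: vec_eq_iff)
  have evr: "poly P (of_real t) = of_real (msig k (\<chi> i j. X $ i $ j + t * A $ i $ j))" for t
    unfolding ev msig_cmat[symmetric] by (intro arg_cong[of _ _ "msig k"]) (simp add: vec_eq_iff)
  have cnj: "poly P (cnj z) = cnj (poly P z)" for z
    unfolding P_def by (simp add: poly_sum poly_monom mixsig_cmat)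
  have roots: "Im r = 0 \<and> Re r < 0" if r: "poly P r = 0" for r
  proof -
    have "\<not> Im r > 0" using msig_pencil_nonzero[OF k A X, of r] r ev' by auto
    moreover have "poly P (cnj r) = 0" using r by (simp add: cnj)
    then have "\<not> Im (cnj r) > 0" using msig_pencil_nonzero[OF k A X, of "cnj r"] ev' by auto
    ultimately have Im: "Im r = 0" by simp
    then have "r = of_real (Re r)" by (simp add: complex_eq_iff)
    then have "poly P (of_real (Re r)) = 0" using r by simp
    then have "\<not> Re r \<ge> 0" using pos[of "Re r"] unfolding evr by auto
    then show ?thesis using Im by simp
  qed
  have "Re (coeff P m) > 0"
    using coeffs_pos_of_negative_roots[of P m, OF roots] d ck pA m by auto
  then show ?thesis using m by (simp add: c)
qed

text \<open>
  Deform the identity into \<open>B\<close> along \<open>X s = s B + (1 - s) I\<close> and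
  consider the coefficients of \<open>t \<mapsto> \<sigma>\<^sub>k(X s + t A)\<close>. By
  \<open>mixsig_pos\<close> they are positive as soon as they are nonnegative, so the set of
  parameters where they are all positive is open and closed. At \<open>s = 1\<close> and
  \<open>t = 1\<close> this gives the claim.
\<close>
lemma ocone_add_pos:
  fixes A B :: "real^'n^'n"
  assumes k: "k \<le> CARD('n)" and A: "A \<in> ocone k" and B: "B \<in> ocone k"
  shows "msig k (A + B) > 0"
proof -
  define X where "X s = (\<chi> i j. s * B $ i $ j + (if i = j then 1 - s else 0))" for s
  have "B $ j $ i = B $ i $ j" for i j
    using B by (metis (mono_tags, lifting) ocone_def mem_Collect_eq transpose_def vec_lambda_beta)
  then have Xsym: "transpose (X s) = X s" for s by (simp add: transpose_def X_def vec_eq_iff)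
  have nnA: "msig j A > 0" if "j \<le> k" for j using ocone_mono[OF A that] by (rule ocone_msig_pos)
  have nnB: "msig j B > 0" if "j \<le> k" for j using ocone_mono[OF B that] by (rule ocone_msig_pos)
  have Xpos: "msig k (X s) > 0" if s: "s \<in> {0..1}" for s
    unfolding X_def msig_shift[OF k]
  proof (cases "s = 0")
    case True
    show "(\<Sum>j\<le>k. real ((CARD('n) - j) choose (k - j)) * s ^ j * (1 - s) ^ (k - j) * msig j B) > 0"
      using s True k nnB by (intro sum_pos2[of _ 0]) (auto intro!: mult_nonneg_nonneg less_imp_le[OF nnB])
  next
    case False
    then show "(\<Sum>j\<le>k. real ((CARD('n) - j) choose (k - j)) * s ^ j * (1 - s) ^ (k - j) * msig j B) > 0"
      using s k nnB by (intro sum_pos2[of _ k]) (auto intro!: mult_nonneg_nonneg less_imp_le[OF nnB])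
  qed
  define T where "T = {s\<in>{0..1}. \<forall>m\<le>k. mixsig k m (X s) A > 0}"
  have cont: "continuous_on S (\<lambda>s. mixsig k m (X s) A)" for m S
  proof -
    have "continuous_on S (\<lambda>s::real. if i = j then 1 - s else 0)" for i j :: 'n
      by (cases "i = j") (auto intro!: continuous_intros)
    then show ?thesis
      unfolding X_def by (intro continuous_on_mixsig) (auto intro!: continuous_intros)
  qed
  have T_alt: "T = {s\<in>{0..1}. \<forall>m\<le>k. mixsig k m (X s) A \<ge> 0}"
  proof (intro set_eqI iffI)
    fix s assume "s \<in> {s\<in>{0..1}. \<forall>m\<le>k. mixsig k m (X s) A \<ge> 0}"
    then have s: "s \<in> {0..1}" "\<And>m. m \<le> k \<Longrightarrow> mixsig k m (X s) A \<ge> 0" by auto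
    have "msig k (\<chi> i j. X s $ i $ j + t * A $ i $ j) > 0" if "t \<ge> 0" for t
      unfolding msig_affine_expand'[OF k] using that Xpos[OF s(1)] s(2)
      by (intro sum_pos2[of _ 0]) (auto simp: mixsig_0)
    then show "s \<in> T" using mixsig_pos[OF k A Xsym] s(1) by (simp add: T_def)
  qed (auto simp: T_def less_imp_le)
  have "closed T"
  proof -
    have T_eq: "T = (\<Inter>m\<in>{..k}. {s\<in>{0..1}. mixsig k m (X s) A \<ge> 0})" unfolding T_alt by auto
    have c1: "closed {s\<in>{0..1}. 0 \<le> mixsig k m (X s) A}" for m
      by (intro continuous_on_closed_Collect_le cont continuous_on_const closed_atLeastAtMost)
    show ?thesis unfolding T_eq by (intro closed_INT ballI c1)
  qed
  moreover have "closed ({0..1} - T)"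
  proof -
    have T_eq: "{0..1} - T = (\<Union>m\<in>{..k}. {s\<in>{0..1}. mixsig k m (X s) A \<le> 0})" unfolding T_def by (auto simp: not_less)
    have c1: "closed {s\<in>{0..1}. mixsig k m (X s) A \<le> 0}" for m
      by (intro continuous_on_closed_Collect_le cont continuous_on_const closed_atLeastAtMost)
    show ?thesis unfolding T_eq by (intro closed_UN finite_atMost ballI c1)
  qed
  moreover have "0 \<in> T"
  proof -
    have "msig k (\<chi> i j. X 0 $ i $ j + t * A $ i $ j) > 0" if "t \<ge> 0" for t
    proof -
      have "(\<chi> i j. X 0 $ i $ j + t * A $ i $ j) = (\<chi> i j. t * A $ i $ j + (if i = j then 1 else 0))"
        by (simp add: X_def vec_eq_iff)
      then show ?thesis using that k nnA
        by (simp only: msig_shift[OF k]) (intro sum_pos2[of _ 0], auto intro!: mult_nonneg_nonneg less_imp_le[OF nnA])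
    qed
    then show ?thesis using mixsig_pos[OF k A Xsym] by (simp add: T_def)
  qed
  ultimately have "T = {0..1}"
  proof -
    assume c: "closed T" "closed ({0..1} - T)" "0 \<in> T"
    have sub: "T \<subseteq> {0..1}" by (auto simp: T_def)
    have con: "connected {0..1::real}" by simp
    have "\<not> (T \<inter> {0..1} \<noteq> {} \<and> ({0..1} - T) \<inter> {0..1} \<noteq> {})"
      using con[unfolded connected_closed] c(1,2) by blast
    then show ?thesis using c(3) sub by auto
  qed
  then have "1 \<in> T" by simp
  then have pos: "mixsig k m B A > 0" if "m \<le> k" for m
  proof -
    have "X 1 = B" by (simp add: X_def vec_eq_iff)
    then show ?thesis using \<open>1 \<in> T\<close> that by (auto simp: T_def)
  qed
  have "msig k (\<chi> i j. B $ i $ j + 1 * A $ i $ j) > 0"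
    unfolding msig_affine_expand'[OF k] using pos by (intro sum_pos) auto
  moreover have "(\<chi> i j. B $ i $ j + 1 * A $ i $ j) = A + B" by (simp add: vec_eq_iff)
  ultimately show ?thesis by simp
qed

lemma gcone_shift_in_ocone:
  fixes A :: "real^'n^'n"
  assumes "k \<le> CARD('n)" "A \<in> gcone k" "t > 0"
  shows "A + mat t \<in> ocone k"
proof -
  have "msig j (A + mat t) > 0" if j: "j \<in> {1..k}" for j
  proof -
    have jn: "j \<le> CARD('n)" using assms(1) j by auto
    have nn: "msig i A \<ge> 0" if "i \<le> k" for i
      using assms(2) that by (cases "i = 0") (auto simp: gcone_def)
    show ?thesis unfolding msig_add_mat[OF jn] using assms j jn
      by (intro sum_pos2[of _ j]) (auto intro!: mult_nonneg_nonneg nn)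
  qed
  then show ?thesis using assms(2) by (simp add: ocone_def gcone_def transpose_add transpose_mat)
qed

text \<open>
  The convexity of Garding's cone. Shifting by \<open>I / (n + 1)\<close> moves both matrices
  into the open cone.
\<close>
lemma gcone_add:
  fixes A B :: "real^'n^'n"
  assumes k: "k \<le> CARD('n)" and A: "A \<in> gcone k" and B: "B \<in> gcone k"
  shows "A + B \<in> gcone k"
proof -
  have "msig j (A + B) \<ge> 0" if j: "j \<in> {1..k}" for j
  proof -
    have jk: "j \<le> k" "j \<le> CARD('n)" using j k by auto
    have p: "msig j ((A + mat (1 / real (Suc n))) + (B + mat (1 / real (Suc n)))) \<ge> 0" for n
      by (intro less_imp_le ocone_add_pos[OF jk(2)] gcone_shift_in_ocone[OF jk(2)] gcone_mono[OF A jk(1)] gcone_mono[OF B jk(1)]) simp_all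
    have lim: "(\<lambda>n. 1 / real (Suc n)) \<longlonglongrightarrow> 0" by (rule LIMSEQ_Suc[OF lim_1_over_n])
    have "(\<lambda>n. msig j ((A + mat (1 / real (Suc n))) + (B + mat (1 / real (Suc n))))) \<longlonglongrightarrow> msig j (A + B)"
    proof (rule tendsto_msig)
      fix i l :: 'n
      have l0: "(\<lambda>n. if i = l then 1 / real (Suc n) else 0) \<longlonglongrightarrow> 0"
        using lim by (cases "i = l") (auto simp del: of_nat_Suc)
      have "(\<lambda>n. (A $ i $ l + (if i = l then 1 / real (Suc n) else 0)) + (B $ i $ l + (if i = l then 1 / real (Suc n) else 0)))
         \<longlonglongrightarrow> (A $ i $ l + 0) + (B $ i $ l + 0)"
        by (intro tendsto_add tendsto_const l0)
      then show "(\<lambda>n. ((A + mat (1 / real (Suc n))) + (B + mat (1 / real (Suc n)))) $ i $ l) \<longlonglongrightarrow> (A + B) $ i $ l"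
        by (simp only: vector_add_component mat_nth add_0_right)
    qed
    then show ?thesis by (rule LIMSEQ_le_const) (use p in auto)
  qed
  then show ?thesis using A B by (simp add: gcone_def transpose_add)
qed

lemma gcone_scale:
  fixes A :: "real^'n^'n"
  assumes "A \<in> gcone k" "c \<ge> 0"
  shows "c *\<^sub>R A \<in> gcone k"
proof -
  have "c *\<^sub>R A = (\<chi> i j. c * A $ i $ j)" by (simp add: vec_eq_iff)
  then have "msig j (c *\<^sub>R A) = c ^ j * msig j A" for j by (simp add: msig_scale)
  moreover have "transpose (c *\<^sub>R A) = c *\<^sub>R transpose A" by (simp add: transpose_def vec_eq_iff)
  ultimately show ?thesis using assms by (simp add: gcone_def)
qed

lemma gcone_mat:
  fixes t :: real
  assumes "t \<ge> 0" "k \<le> CARD('n)"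
  shows "(mat t :: real^'n^'n) \<in> gcone k"
proof -
  have "msig j (mat t :: real^'n^'n) \<ge> 0" if "j \<le> k" for j
  proof -
    have jn: "j \<le> CARD('n)" using that assms by simp
    have "(mat t :: real^'n^'n) = (\<chi> i j. 0 * (0::real^'n^'n) $ i $ j + (if i = j then t else 0))"
      by (simp add: vec_eq_iff mat_nth)
    also have "msig j \<dots> \<ge> 0"
      unfolding msig_shift[OF jn] using assms(1)
      by (intro sum_nonneg) (auto simp: power_0_left)
    finally show ?thesis .
  qed
  then show ?thesis by (simp add: gcone_def transpose_mat)
qed

lemma msig_zero: "j \<ge> 1 \<Longrightarrow> msig j (0::real^'n^'n) = 0"
proof -
  assume "j \<ge> 1"
  have "(\<chi> i j. 0 * (0::real^'n^'n) $ i $ j) = (0::real^'n^'n)" by (simp add: vec_eq_iff)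
  then have "msig j (0::real^'n^'n) = 0 ^ j * msig j (0::real^'n^'n)"
    using msig_scale[of j 0 "0::real^'n^'n"] by simp
  then show ?thesis using \<open>j \<ge> 1\<close> by (simp add: power_0_left)
qed

lemma dsig_zero: "dsig j H (0::'a::comm_ring_1^'n^'n) = 0"
proof -
  have "(\<chi> i j. 0 * (0::'a^'n^'n) $ i $ j) = (0::'a^'n^'n)" by (simp add: vec_eq_iff)
  then show ?thesis using dsig_scale[of j H 0 "0::'a^'n^'n"] by simp
qed

lemma gcone_outer: "outer x x \<in> gcone k" for x :: "real^'n"
proof -
  have "msig j (outer x x) \<ge> 0" if "j \<ge> 1" for j
  proof -
    obtain i where i: "j = Suc i" using \<open>j \<ge> 1\<close> by (cases j) auto
    have "(\<chi> i j. (0::real^'n^'n) $ i $ j + 1 * outer x x $ i $ j) = outer x x" by (simp add: vec_eq_iff)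
    then have "msig j (outer x x) = msig j (0::real^'n^'n) + 1 * dsig j (0::real^'n^'n) (outer x x)"
      using msig_rank_one[of j "0::real^'n^'n" 1 x x] by simp
    also have "\<dots> = msig i (0::real^'n^'n) * (\<Sum>i\<in>UNIV. x $ i * x $ i) - dsig i (0::real^'n^'n) (outer x (x v* 0))"
      using that by (simp add: msig_zero i dsig_Suc_outer)
    also have "outer x (x v* 0) = 0" by (simp add: outer_def vec_eq_iff vector_matrix_mult_def)
    finally show ?thesis by (cases "i = 0") (auto simp: dsig_zero msig_zero sum_nonneg)
  qed
  then show ?thesis by (simp add: gcone_def outer_transpose)
qed

text \<open>
  Otherwise \<open>\<sigma>\<^sub>k(A + t x \<otimes> x)\<close>, which is affine in
  \<open>t\<close>, would become negative for large \<open>t\<close>, although the cone is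
  closed under adding \<open>t x \<otimes> x\<close>.
\<close>
lemma dsig_nonneg:
  fixes A :: "real^'n^'n"
  assumes k: "k \<le> CARD('n)" and A: "A \<in> gcone k"
  shows "dsig k A (outer x x) \<ge> 0"
proof (rule ccontr)
  assume "\<not> dsig k A (outer x x) \<ge> 0"
  then have d: "dsig k A (outer x x) < 0" by simp
  then have "k \<noteq> 0" by (metis dsig_0 less_irrefl)
  then have mA: "msig k A \<ge> 0" using A by (simp add: gcone_def)
  define t where "t = (msig k A + 1) / (- dsig k A (outer x x))"
  have t: "t \<ge> 0" using d mA by (simp add: t_def divide_nonneg_neg zero_le_divide_iff)
  have "A + t *\<^sub>R outer x x \<in> gcone k" by (intro gcone_add[OF k A] gcone_scale gcone_outer t)
  moreover have "A + t *\<^sub>R outer x x = (\<chi> i j. A $ i $ j + t * outer x x $ i $ j)" by (simp add: vec_eq_iff)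
  ultimately have "msig k A + t * dsig k A (outer x x) \<ge> 0"
    using \<open>k \<noteq> 0\<close> by (simp add: gcone_def msig_rank_one)
  moreover have "t * dsig k A (outer x x) = - (msig k A + 1)" using d by (simp add: t_def field_simps)
  ultimately show False by simp
qed

lemma gcone_closed: "closed (gcone k :: (real^'n^'n) set)"
proof -
  have c: "continuous_on UNIV (\<lambda>A::real^'n^'n. msig j A)" for j
    by (intro continuous_on_msig continuous_intros)
  have "gcone k = (\<Inter>i. \<Inter>j. {A::real^'n^'n. A $ j $ i = A $ i $ j}) \<inter> (\<Inter>j\<in>{1..k}. {A. 0 \<le> msig j A})"
    by (auto simp: gcone_def transpose_def vec_eq_iff)
  then show ?thesis
    by (auto intro!: closed_Int closed_INT closed_Collect_eq closed_Collect_le continuous_intros c)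
qed

section \<open>Null Lagrangians\<close>

lemma integrable_compact_support:
  fixes g :: "'a::euclidean_space \<Rightarrow> real"
  assumes "continuous_on UNIV g" "\<And>x. x \<notin> K \<Longrightarrow> g x = 0" "compact K"
  shows "integrable lborel g"
proof -
  have "integrable lborel (\<lambda>x. indicator K x *\<^sub>R g x)"
    using assms(1,3) by (intro borel_integrable_compact continuous_on_subset[OF assms(1)]) auto
  moreover have "(\<lambda>x. indicator K x *\<^sub>R g x) = g"
    using assms(2) by (auto simp: indicator_def fun_eq_iff)
  ultimately show ?thesis by simp
qed

lemma bounded_compact_support:
  fixes g :: "'a::euclidean_space \<Rightarrow> real"
  assumes "continuous_on UNIV g" "\<And>x. x \<notin> K \<Longrightarrow> g x = 0" "compact K"
  obtains C where "\<And>x. \<bar>g x\<bar> \<le> C" "C \<ge> 0"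
proof -
  have "compact (g ` K)" using assms by (intro compact_continuous_image continuous_on_subset[OF assms(1)]) auto
  then obtain C where C: "\<And>y. y \<in> g ` K \<Longrightarrow> norm y \<le> C" using compact_imp_bounded bounded_iff by metis
  have "\<bar>g x\<bar> \<le> max C 0" for x using assms(2)[of x] C[of "g x"] by (cases "x \<in> K") (auto simp: max_def)
  then show ?thesis using that[of "max C 0"] by simp
qed

text \<open>
  For small \<open>s\<close> the map \<open>x \<mapsto> x + s f(x)\<close> is a diffeomorphism
  of a ball onto itself, so the integral of \<open>det (I + s J)\<close> over the ball is its
  volume. This integral is a polynomial in \<open>s\<close> whose coefficients are the integrals
  of \<open>\<sigma>\<^sub>k(J)\<close>. The index type is well-ordered, as in the change of
  variables theorem that computes this integral.
\<close>
lemma null_lagrangian_wo: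
  fixes f :: "real^'n::{finite,wellorder} \<Rightarrow> real^'n::_" and J :: "real^'n::_ \<Rightarrow> real^'n::_^'n::_"
  assumes der: "\<And>x. (f has_derivative (\<lambda>h. J x *v h)) (at x)"
    and cont: "\<And>i j. continuous_on UNIV (\<lambda>x. J x $ i $ j)"
    and supp: "\<And>x. norm x \<ge> R \<Longrightarrow> f x = 0" and R: "R > 0" and k: "k \<ge> 1"
  shows "(LINT x|lborel. msig k (J x)) = 0"
proof (cases "k \<le> CARD('n::_)")
  case False
  then show ?thesis by (simp add: msig_gt)
next
  case kn: True
  define B :: "(real^'n::_) set" where "B = ball 0 (R + 1)"
  have J0: "J x = 0" if "x \<notin> B" for x
  proof -
    have x: "norm x > R" using that by (auto simp: B_def)
    have op: "open {y::real^'n::_. norm y > R}" by (intro open_Collect_less continuous_intros)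
    have "((\<lambda>y. 0) has_derivative (\<lambda>h. J x *v h)) (at x)"
    proof (rule has_derivative_transform_within_open[OF der op])
      show "x \<in> {y. R < norm y}" using x by simp
    qed (use supp in auto)
    moreover have "((\<lambda>y::real^'n::_. 0::real^'n::_) has_derivative (\<lambda>h. 0)) (at x)" by (rule has_derivative_const)
    ultimately have "(\<lambda>h. J x *v h) = (\<lambda>h. 0)" by (rule has_derivative_unique)
    then have "J x *v h = 0 *v h" for h by (metis matrix_vector_mult_0)
    then show ?thesis by (simp add: matrix_eq)
  qed
  have cpt: "compact (cball (0::real^'n::_) (R + 1))" by simp
  have J0': "J x = 0" if "x \<notin> cball 0 (R + 1)" for x using that by (intro J0) (auto simp: B_def)
  have "\<exists>C. \<forall>x. \<bar>J x $ i $ j\<bar> \<le> C" for i j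
    by (rule bounded_compact_support[OF cont _ cpt, of i j]) (auto simp: J0')
  then obtain C where C: "\<And>i j x. \<bar>J x $ i $ j\<bar> \<le> C i j" by metis
  define L where "L = (\<Sum>i\<in>UNIV. \<Sum>j\<in>UNIV. C i j)"
  have onL: "onorm ((*v) (J x)) \<le> L" for x
    unfolding L_def by (rule order_trans[OF onorm_le_matrix_component_sum]) (intro sum_mono C)
  have L0: "L \<ge> 0" unfolding L_def by (intro sum_nonneg order_trans[OF abs_ge_zero C])
  have lip: "norm (f x - f y) \<le> L * norm (x - y)" for x y
    using der onL by (intro differentiable_bound[of UNIV f "\<lambda>x h. J x *v h"]) (auto)
  define F where "F j x = msig j (J x)" for j x
  have contF: "continuous_on UNIV (F j)" for j unfolding F_def by (intro continuous_on_msig cont)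
  have F0: "F j x = 0" if "x \<notin> B" "j \<ge> 1" for j x using J0[OF that(1)] that(2) by (simp add: F_def msig_zero)
  have F0': "F j x = 0" if "x \<notin> cball 0 (R + 1)" "j \<ge> 1" for j x
    using F0[of x j] that by (auto simp: B_def)
  have intF: "integrable lborel (F j)" if "j \<ge> 1" for j
    by (rule integrable_compact_support[OF contF F0' cpt]) (use that in auto)
  have "\<exists>D\<ge>0. \<forall>x. \<bar>F (Suc j) x\<bar> \<le> D" for j
    by (rule bounded_compact_support[OF contF F0' cpt, of "Suc j"]) auto
  then obtain D where D: "\<And>j x. \<bar>F (Suc j) x\<bar> \<le> D j" "\<And>j. D j \<ge> 0" by metis
  define E where "E = (\<Sum>j<CARD('n::_). D j)"
  have E0: "E \<ge> 0" unfolding E_def by (intro sum_nonneg D)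
  \<comment> \<open>For \<open>|s| < s0\<close> the map is injective with positive Jacobian
    determinant.\<close>
  define s0 where "s0 = 1 / (1 + L + E)"
  have s0: "s0 > 0" using L0 E0 by (simp add: s0_def)
  define I where "I j = (LINT x|lborel. F j x)" for j
  have main: "(\<Sum>j<CARD('n::_). s ^ Suc j * I (Suc j)) = 0" if s: "\<bar>s\<bar> < s0" for s
  proof -
    have s1: "\<bar>s\<bar> * (1 + L + E) < 1" using s L0 E0 by (simp add: s0_def field_simps)
    have sL: "\<bar>s\<bar> * L < 1" and sE: "\<bar>s\<bar> * E < 1" and s1': "\<bar>s\<bar> < 1"
    proof -
      have "0 \<le> \<bar>s\<bar> * L" "0 \<le> \<bar>s\<bar> * E" using L0 E0 by auto
      moreover have "\<bar>s\<bar> + \<bar>s\<bar> * L + \<bar>s\<bar> * E < 1" using s1 by (simp add: algebra_simps)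
      ultimately show "\<bar>s\<bar> * L < 1" "\<bar>s\<bar> * E < 1" "\<bar>s\<bar> < 1" by linarith+
    qed
    define g where "g x = x + s *\<^sub>R f x" for x
    have inj: "inj g"
    proof (rule injI)
      fix x y assume "g x = g y"
      then have "x - y = s *\<^sub>R (f y - f x)" by (simp add: g_def algebra_simps)
      then have "norm (x - y) = \<bar>s\<bar> * norm (f y - f x)" by simp
      also have "\<dots> \<le> \<bar>s\<bar> * (L * norm (y - x))" by (intro mult_left_mono lip) auto
      finally have "norm (x - y) \<le> (\<bar>s\<bar> * L) * norm (x - y)" by (simp add: norm_minus_commute mult.assoc)
      then have "(1 - \<bar>s\<bar> * L) * norm (x - y) \<le> 0" by (simp add: algebra_simps)
      then have "norm (x - y) = 0" using sL by (simp add: mult_le_0_iff)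
      then show "x = y" by simp
    qed
    have out: "f x = 0" if "x \<notin> B" for x using supp[of x] that by (simp add: B_def)
    have img: "g ` B = B"
    proof
      show "g ` B \<subseteq> B"
      proof safe
        fix x assume x: "x \<in> B"
        show "g x \<in> B"
        proof (rule ccontr)
          assume "g x \<notin> B"
          then have "g (g x) = g x" using out[of "g x"] by (simp add: g_def[of "g x"])
          then have "g x = x" using inj by (simp add: inj_eq)
          then show False using x \<open>g x \<notin> B\<close> by simp
        qed
      qed
      show "B \<subseteq> g ` B"
      proof
        fix y assume y: "y \<in> B"
        have "\<exists>!x. y - s *\<^sub>R f x = x"
        proof (rule banach_fix_type)
          show "\<forall>x z. dist (y - s *\<^sub>R f x) (y - s *\<^sub>R f z) \<le> (\<bar>s\<bar> * L) * dist x z"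
          proof (intro allI)
            fix x z
            have "dist (y - s *\<^sub>R f x) (y - s *\<^sub>R f z) = \<bar>s\<bar> * norm (f z - f x)"
              by (simp add: dist_norm scaleR_diff_right[symmetric])
            also have "\<dots> \<le> \<bar>s\<bar> * (L * norm (z - x))" by (intro mult_left_mono lip) auto
            finally show "dist (y - s *\<^sub>R f x) (y - s *\<^sub>R f z) \<le> (\<bar>s\<bar> * L) * dist x z"
              by (simp add: dist_norm norm_minus_commute mult.assoc)
          qed
        qed (use L0 sL in auto)
        then obtain x where x: "y - s *\<^sub>R f x = x" by blast
        then have gx: "g x = y" by (simp add: g_def algebra_simps)
        have "x \<in> B" using out[of x] gx y by (cases "x \<in> B") (auto simp: g_def)
        then show "y \<in> g ` B" using gx by blast
      qed
    qed
    define M where "M x = (\<chi> i j. s * J x $ i $ j + (if i = j then 1 else 0))" for x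
    have derg: "(g has_derivative (\<lambda>h. M x *v h)) (at x)" for x
    proof -
      have "(g has_derivative (\<lambda>h. h + s *\<^sub>R (J x *v h))) (at x)"
        unfolding g_def by (auto intro!: derivative_eq_intros der)
      moreover have "h + s *\<^sub>R (J x *v h) = M x *v h" for h
      proof -
        have "(M x *v h) $ i = (\<Sum>j\<in>UNIV. s * (J x $ i $ j * h $ j) + (if i = j then h $ j else 0))" for i
          unfolding matrix_vector_mult_def M_def by (auto intro!: sum.cong simp: algebra_simps)
        then show ?thesis by (simp add: vec_eq_iff sum.distrib sum_distrib_left matrix_vector_mult_def)
      qed
      ultimately show ?thesis by simp
    qed
    have detM: "det (M x) = 1 + (\<Sum>j<CARD('n::_). s ^ Suc j * F (Suc j) x)" for x
      unfolding M_def det_one_add_msig F_def by (subst sum.atMost_shift) (simp add: lessThan_Suc_atMost)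
    have pos: "det (M x) > 0" for x
    proof -
      have "\<bar>\<Sum>j<CARD('n::_). s ^ Suc j * F (Suc j) x\<bar> \<le> (\<Sum>j<CARD('n::_). \<bar>s\<bar> * D j)"
      proof (rule order_trans[OF sum_abs], rule sum_mono)
        fix j
        have "\<bar>s ^ Suc j * F (Suc j) x\<bar> = \<bar>s\<bar> * (\<bar>s\<bar> ^ j * \<bar>F (Suc j) x\<bar>)"
          by (simp add: abs_mult power_abs mult.assoc)
        also have "\<dots> \<le> \<bar>s\<bar> * (1 * D j)"
          using s1' D by (intro mult_left_mono mult_mono power_le_one) auto
        finally show "\<bar>s ^ Suc j * F (Suc j) x\<bar> \<le> \<bar>s\<bar> * D j" by simp
      qed
      also have "\<dots> = \<bar>s\<bar> * E" by (simp add: E_def sum_distrib_left)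
      finally show ?thesis using sE unfolding detM by linarith
    qed
    have Bm: "B \<in> lmeasurable" by (simp add: B_def)
    have "((\<lambda>x. \<bar>det (matrix (\<lambda>h. M x *v h))\<bar>) has_integral measure lebesgue (g ` B)) B"
      using has_measure_differentiable_image[of B g "\<lambda>x h. M x *v h" "measure lebesgue (g ` B)"]
        derg inj Bm img by (simp add: has_derivative_at_withinI inj_on_subset fmeasurableD)
    then have 1: "((\<lambda>x. det (M x)) has_integral measure lebesgue B) B"
      using pos by (simp add: img less_imp_le)
    have 2: "((\<lambda>x. 1) has_integral measure lebesgue B) B"
      using Bm by (simp add: has_integral_iff lmeasure_integral lmeasurable_iff_integrable_on[symmetric] flip: integrable_on_const)
    have 4: "((\<lambda>x. \<Sum>j<CARD('n::_). s ^ Suc j * F (Suc j) x) has_integral 0) B"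
      using has_integral_diff[OF 1 2] unfolding detM by simp
    have "(\<lambda>x. if x \<in> B then \<Sum>j<CARD('n::_). s ^ Suc j * F (Suc j) x else 0) = (\<lambda>x. \<Sum>j<CARD('n::_). s ^ Suc j * F (Suc j) x)"
      by (simp add: fun_eq_iff F0)
    with has_integral_restrict_UNIV[of B "\<lambda>x. \<Sum>j<CARD('n::_). s ^ Suc j * F (Suc j) x" 0]
    have 3: "((\<lambda>x. \<Sum>j<CARD('n::_). s ^ Suc j * F (Suc j) x) has_integral 0) UNIV" using 4 by simp
    have "((\<lambda>x. \<Sum>j<CARD('n::_). s ^ Suc j * F (Suc j) x) has_integral (\<Sum>j<CARD('n::_). s ^ Suc j * I (Suc j))) UNIV"
      unfolding I_def by (intro has_integral_sum finite_lessThan has_integral_mult_right has_integral_integral_lborel intF) auto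
    with 3 show ?thesis using has_integral_unique by blast
  qed
  define p where "p = (\<Sum>j<CARD('n::_). monom (I (Suc j)) (Suc j))"
  have "poly p s = 0" if "\<bar>s\<bar> < s0" for s
    using main[OF that] by (simp add: p_def poly_sum poly_monom mult.commute)
  then have sub: "{- s0<..<s0} \<subseteq> {s. poly p s = 0}" by auto
  have "p = 0"
  proof (rule ccontr)
    assume "p \<noteq> 0"
    then have "finite {s. poly p s = 0}" by (rule poly_roots_finite)
    then have "finite {- s0<..<s0}" using sub finite_subset by blast
    then show False using s0 by (simp add: infinite_Ioo)
  qed
  obtain j where j: "k = Suc j" "j < CARD('n::_)" using k kn by (cases k) auto
  have "coeff p k = I k"
    unfolding p_def using j by (simp add: coeff_sum)
  then show ?thesis using \<open>p = 0\<close> by (simp add: I_def F_def)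
qed

text \<open>
  A copy of a finite type that carries an arbitrary well-order. The transfer below removes the
  ordering assumption from \<open>null_lagrangian_wo\<close>: permuting coordinates preserves
  determinants and Lebesgue measure.
\<close>
typedef 'a wo = "UNIV :: 'a set" morphisms unwo wo by simp

lemma unwo_wo [simp]: "unwo (wo x) = x" by (simp add: wo_inverse)
lemma wo_unwo [simp]: "wo (unwo x) = x" by (simp add: unwo_inverse)
lemma bij_wo: "bij wo" by (rule bijI') (simp add: wo_inject, metis wo_unwo)
lemma bij_unwo: "bij unwo" by (rule bijI') (simp add: unwo_inject, metis unwo_wo)

instance wo :: (finite) finite
proof
  have "(UNIV :: 'a wo set) = wo ` UNIV" using bij_wo by (metis bij_is_surj)
  then show "finite (UNIV :: 'a wo set)" by (metis finite finite_imageI)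
qed

instantiation wo :: (finite) wellorder
begin

definition wo_rank :: "'a wo \<Rightarrow> nat" where
  "wo_rank = (SOME f. inj f)"

definition "less_eq_wo x y \<longleftrightarrow> wo_rank x \<le> wo_rank (y::'a wo)"
definition "less_wo x y \<longleftrightarrow> wo_rank x < wo_rank (y::'a wo)"

lemma inj_wo_rank: "inj (wo_rank :: 'a wo \<Rightarrow> nat)"
proof -
  have "\<exists>f::'a wo \<Rightarrow> nat. inj f" using finite_imp_inj_to_nat_seg[of "UNIV::'a wo set"] by auto
  then show ?thesis unfolding wo_rank_def by (rule someI_ex)
qed

instance
proof
  fix P :: "'a wo \<Rightarrow> bool" and a
  assume hyp: "\<And>x. (\<And>y. y < x \<Longrightarrow> P y) \<Longrightarrow> P x"
  show "P a"
  proof (induction a rule: measure_induct_rule[of wo_rank])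
    case (less x)
    show ?case
    proof (rule hyp)
      fix y assume "y < x"
      then show "P y" by (intro less) (simp only: less_wo_def)
    qed
  qed
next
  fix x y z :: "'a wo"
  show "x < y \<longleftrightarrow> x \<le> y \<and> \<not> y \<le> x" by (auto simp: less_eq_wo_def less_wo_def)
  show "x \<le> x" by (simp add: less_eq_wo_def)
  show "x \<le> y \<Longrightarrow> y \<le> z \<Longrightarrow> x \<le> z" by (simp add: less_eq_wo_def)
  show "x \<le> y \<Longrightarrow> y \<le> x \<Longrightarrow> x = y"
    unfolding less_eq_wo_def by (rule injD[OF inj_wo_rank]) simp
  show "x \<le> y \<or> y \<le> x" by (auto simp: less_eq_wo_def)
qed

end

definition vwo :: "'b^'n \<Rightarrow> 'b^('n wo)" where "vwo x = (\<chi> i. x $ unwo i)"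
definition vunwo :: "'b^('n wo) \<Rightarrow> 'b^'n" where "vunwo y = (\<chi> i. y $ wo i)"
definition mwo :: "'b^'n^'n \<Rightarrow> 'b^('n wo)^('n wo)" where "mwo A = (\<chi> i j. A $ unwo i $ unwo j)"

lemma vwo_nth [simp]: "vwo x $ i = x $ unwo i" by (simp add: vwo_def)
lemma vunwo_nth [simp]: "vunwo x $ i = x $ wo i" by (simp add: vunwo_def)
lemma mwo_nth [simp]: "mwo x $ i $ j = x $ unwo i $ unwo j" by (simp add: mwo_def)
lemma vwo_vunwo [simp]: "vwo (vunwo y) = y" by (simp add: vec_eq_iff)
lemma vunwo_vwo [simp]: "vunwo (vwo y) = y" by (simp add: vec_eq_iff)

lemma swapidseq_unwo: "swapidseq n p \<Longrightarrow> swapidseq n (unwo \<circ> p \<circ> wo)"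
proof (induction n p rule: swapidseq.induct)
  case id
  have "unwo \<circ> id \<circ> wo = id" by (simp add: fun_eq_iff)
  then show ?case by (metis swapidseq.id)
next
  case (comp_Suc n p a b)
  have eq: "unwo \<circ> (Transposition.transpose a b \<circ> p) \<circ> wo = Transposition.transpose (unwo a) (unwo b) \<circ> (unwo \<circ> p \<circ> wo)"
    by (auto simp: fun_eq_iff Transposition.transpose_def unwo_inject)
  moreover have "unwo a \<noteq> unwo b" using comp_Suc by (simp add: unwo_inject)
  ultimately show ?case unfolding eq by (intro swapidseq.comp_Suc[OF comp_Suc.IH])
qed

lemma sign_unwo:
  assumes "permutation p"
  shows "sign (unwo \<circ> p \<circ> wo) = sign p"
proof -
  obtain n where n: "swapidseq n p" using assms by (auto simp: permutation_def)
  then have "evenperm p = even n" "evenperm (unwo \<circ> p \<circ> wo) = even n"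
    using evenperm_unique[OF n] evenperm_unique[OF swapidseq_unwo[OF n]] by auto
  then show ?thesis by (simp add: sign_def)
qed

lemma det_mwo: "det (mwo A) = det (A :: 'a::comm_ring_1^'n::finite^'n)"
  unfolding det_def
proof (rule sum.reindex_bij_witness[of _ "\<lambda>p. wo \<circ> p \<circ> unwo" "\<lambda>p. unwo \<circ> p \<circ> wo"])
  fix p :: "'n wo \<Rightarrow> 'n wo" assume "p \<in> {p. p permutes UNIV}"
  then have p: "p permutes UNIV" by simp
  show "wo \<circ> (unwo \<circ> p \<circ> wo) \<circ> unwo = p" by (simp add: fun_eq_iff)
  have "bij (unwo \<circ> p \<circ> wo)" using p bij_wo bij_unwo by (intro bij_comp) (auto simp: permutes_bij)
  then show "unwo \<circ> p \<circ> wo \<in> {p. p permutes UNIV}" by (auto intro: bij_imp_permutes)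
  have "(\<Prod>i\<in>UNIV. mwo A $ i $ p i) = (\<Prod>i\<in>UNIV. A $ i $ (unwo \<circ> p \<circ> wo) i)"
    by (rule prod.reindex_bij_witness[of _ wo unwo]) auto
  moreover have "permutation p" using p by (auto simp: permutation_permutes)
  ultimately show "of_int (sign (unwo \<circ> p \<circ> wo)) * (\<Prod>i\<in>UNIV. A $ i $ (unwo \<circ> p \<circ> wo) i) =
    of_int (sign p) * (\<Prod>i\<in>UNIV. mwo A $ i $ p i)"
    by (simp add: sign_unwo)
next
  fix p :: "'n \<Rightarrow> 'n" assume "p \<in> {p. p permutes UNIV}"
  then have p: "p permutes UNIV" by simp
  show "unwo \<circ> (wo \<circ> p \<circ> unwo) \<circ> wo = p" by (simp add: fun_eq_iff)
  have "bij (wo \<circ> p \<circ> unwo)" using p bij_wo bij_unwo by (intro bij_comp) (auto simp: permutes_bij)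
  then show "wo \<circ> p \<circ> unwo \<in> {p. p permutes UNIV}" by (auto intro: bij_imp_permutes)
qed

lemma card_wo: "CARD('n::finite wo) = CARD('n)"
  by (rule bij_betw_same_card[of unwo]) (rule bij_unwo)

lemma msig_mwo: "msig k (mwo A) = msig k (A :: 'a::field_char_0^'n::finite^'n)"
proof (cases "k \<le> CARD('n)")
  case True
  have eq: "(\<Sum>k\<le>CARD('n). s ^ k * msig k (mwo A)) = (\<Sum>k\<le>CARD('n). s ^ k * msig k A)" for s
  proof -
    have "(\<chi> i j. s * mwo A $ i $ j + (if i = j then 1 else 0)) = mwo (\<chi> i j. s * A $ i $ j + (if i = j then 1 else 0))"
      by (simp add: vec_eq_iff unwo_inject)
    then show ?thesis using det_one_add_msig[of s "mwo A"] det_one_add_msig[of s A] by (simp add: card_wo det_mwo)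
  qed
  show ?thesis by (rule power_sum_coeffs_unique[OF eq True])
qed (simp add: msig_gt card_wo)

lemma bounded_linear_vwo: "bounded_linear (vwo :: real^'n::finite \<Rightarrow> _)"
  by (intro linear_conv_bounded_linear[THEN iffD1] linearI) (simp_all add: vec_eq_iff)

lemma bounded_linear_vunwo: "bounded_linear (vunwo :: real^('n::finite wo) \<Rightarrow> _)"
  by (intro linear_conv_bounded_linear[THEN iffD1] linearI) (simp_all add: vec_eq_iff)

lemma norm_vunwo: "norm (vunwo y) = norm (y :: real^('n::finite wo))"
proof -
  have "(\<Sum>i\<in>UNIV. (y $ wo i)\<^sup>2) = (\<Sum>i\<in>UNIV. (y $ i)\<^sup>2)"
    by (rule sum.reindex_bij_witness[of _ unwo wo]) auto
  then show ?thesis by (simp add: norm_vec_def L2_set_def)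
qed

lemma prod_Basis_cart: "(\<Prod>b\<in>Basis. (x::real^'n) \<bullet> b) = (\<Prod>i\<in>UNIV. x $ i)"
proof -
  have B: "(Basis :: (real^'n) set) = (\<lambda>i. axis i 1) ` UNIV" by (auto simp: Basis_vec_def)
  moreover have "inj (\<lambda>i::'n. axis i (1::real))" by (auto simp: inj_on_def axis_eq_axis)
  ultimately show ?thesis unfolding B by (subst prod.reindex) (simp_all add: inner_axis)
qed

lemma lborel_vwo: "lborel = distr lborel borel (vwo :: real^'n::finite \<Rightarrow> _)"
proof (rule lborel_eqI)
  fix l u :: "real^('n wo)" assume le: "\<And>b. b \<in> Basis \<Longrightarrow> l \<bullet> b \<le> u \<bullet> b"
  have le': "l $ i \<le> u $ i" for i using le[of "axis i 1"] by (auto simp: inner_axis Basis_vec_def)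
  have m: "(vwo :: real^'n \<Rightarrow> _) \<in> borel_measurable borel"
    by (intro borel_measurable_continuous_onI linear_continuous_on bounded_linear_vwo)
  have "vwo -` box l u = box (vunwo l) (vunwo u :: real^'n)"
  proof -
    have "(\<forall>i::'n wo. P i (unwo i)) \<longleftrightarrow> (\<forall>j. P (wo j) j)" for P by (metis unwo_wo wo_unwo)
    from this[of "\<lambda>i j. l $ i < x $ j \<and> x $ j < u $ i" for x :: "real^'n"] show ?thesis
      by (auto simp: mem_box_cart)
  qed
  then have "emeasure (distr lborel borel (vwo :: real^'n \<Rightarrow> _)) (box l u) = emeasure lborel (box (vunwo l) (vunwo u :: real^'n))"
    using m by (simp add: emeasure_distr)
  also have "\<dots> = (\<Prod>b\<in>Basis. (vunwo u - vunwo l :: real^'n) \<bullet> b)"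
  proof (subst emeasure_lborel_box)
    fix b :: "real^'n" assume "b \<in> Basis"
    then obtain i where "b = axis i 1" by (auto simp: Basis_vec_def)
    then show "vunwo l \<bullet> b \<le> vunwo u \<bullet> b" using le' by (simp add: inner_axis)
  qed simp
  also have "(\<Prod>b\<in>Basis. (vunwo u - vunwo l :: real^'n) \<bullet> b) = (\<Prod>b\<in>Basis. (u - l) \<bullet> b)"
    unfolding prod_Basis_cart by (rule prod.reindex_bij_witness[of _ unwo wo]) auto
  finally show "emeasure (distr lborel borel (vwo :: real^'n \<Rightarrow> _)) (box l u) = (\<Prod>b\<in>Basis. (u - l) \<bullet> b)" .
qed simp

lemma null_lagrangian:
  fixes f :: "real^'n \<Rightarrow> real^'n" and J :: "real^'n \<Rightarrow> real^'n^'n"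
  assumes der: "\<And>x. (f has_derivative (\<lambda>h. J x *v h)) (at x)"
    and cont: "\<And>i j. continuous_on UNIV (\<lambda>x. J x $ i $ j)"
    and supp: "\<And>x. norm x \<ge> R \<Longrightarrow> f x = 0" and R: "R > 0" and k: "k \<ge> 1"
  shows "(LINT x|lborel. msig k (J x)) = 0"
proof -
  have cu: "continuous_on UNIV (vunwo :: real^('n wo) \<Rightarrow> real^'n)"
    by (intro linear_continuous_on bounded_linear_vunwo)
  have "(LINT y|lborel. msig k (mwo (J (vunwo y)))) = 0"
  proof (rule null_lagrangian_wo[where f="\<lambda>y. vwo (f (vunwo y))" and R=R])
    fix y :: "real^('n wo)"
    have "((\<lambda>y. vwo (f (vunwo y))) has_derivative (\<lambda>h. vwo (J (vunwo y) *v (vunwo h)))) (at y)"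
      by (rule bounded_linear.has_derivative[OF bounded_linear_vwo])
        (rule has_derivative_compose[OF bounded_linear.has_derivative[OF bounded_linear_vunwo has_derivative_ident] der])
    moreover have "vwo (J (vunwo y) *v (vunwo h)) = mwo (J (vunwo y)) *v h" for h
    proof -
      have "(\<Sum>j\<in>UNIV. A $ i $ j * h $ wo j) = (\<Sum>j\<in>UNIV. A $ i $ unwo j * h $ j)" for A :: "real^'n^'n" and i
        by (rule sum.reindex_bij_witness[of _ unwo wo]) auto
      then show ?thesis by (simp add: vec_eq_iff matrix_vector_mult_def)
    qed
    ultimately show "((\<lambda>y. vwo (f (vunwo y))) has_derivative (\<lambda>h. mwo (J (vunwo y)) *v h)) (at y)" by simp
  next
    fix i j :: "'n wo"
    show "continuous_on UNIV (\<lambda>x. mwo (J (vunwo x)) $ i $ j)"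
      unfolding mwo_nth by (rule continuous_on_compose2[OF cont cu]) auto
  next
    fix y :: "real^('n wo)" assume "R \<le> norm y"
    then show "vwo (f (vunwo y)) = 0" using supp[of "vunwo y"] by (simp add: norm_vunwo vec_eq_iff)
  qed (use R k in auto)
  then have "(LINT y|distr lborel borel (vwo :: real^'n \<Rightarrow> _). msig k (mwo (J (vunwo y)))) = 0"
    using lborel_vwo[where 'n='n] by simp
  moreover have "continuous_on UNIV (\<lambda>y. msig k (mwo (J (vunwo y))))"
    unfolding msig_mwo by (intro continuous_on_msig continuous_on_compose2[OF cont cu]) auto
  moreover have "(vwo :: real^'n \<Rightarrow> _) \<in> borel_measurable borel"
    by (intro borel_measurable_continuous_onI linear_continuous_on bounded_linear_vwo)
  ultimately show ?thesis
    by (subst (asm) integral_distr) (auto simp: msig_mwo intro: borel_measurable_continuous_onI)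
qed

section \<open>Functions of class C2\<close>

lemma has_derivative_grad:
  fixes f :: "real^'n \<Rightarrow> real"
  assumes "f differentiable (at x)"
  shows "(f has_derivative (\<lambda>h. grad f x \<bullet> h)) (at x)"
proof -
  let ?D = "frechet_derivative f (at x)"
  have D: "(f has_derivative ?D) (at x)" using assms by (simp add: frechet_derivative_works)
  then have lin: "linear ?D" by (rule has_derivative_linear)
  have "?D h = grad f x \<bullet> h" for h
  proof -
    have "?D h = ?D (\<Sum>i\<in>UNIV. h $ i *\<^sub>R axis i 1)"
      using basis_expansion[of h] by (simp add: scalar_mult_eq_scaleR)
    also have "\<dots> = (\<Sum>i\<in>UNIV. h $ i * ?D (axis i 1))"
      by (simp add: linear_sum[OF lin] linear_cmul[OF lin])
    finally show ?thesis by (simp add: grad_def pderiv_vec_def inner_vec_def mult.commute)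
  qed
  then have "?D = (\<lambda>h. grad f x \<bullet> h)" by (rule ext)
  with D show ?thesis by simp
qed

lemma C2_onD:
  assumes "f \<in> C2_on \<Omega>" "x \<in> \<Omega>"
  shows "(f has_derivative (\<lambda>h. grad f x \<bullet> h)) (at x)"
    "(pderiv_vec i f has_derivative (\<lambda>h. (\<chi> j. hess f x $ j $ i) \<bullet> h)) (at x)"
proof -
  show "(f has_derivative (\<lambda>h. grad f x \<bullet> h)) (at x)"
    using assms by (intro has_derivative_grad) (auto simp: C2_on_def)
  have "(pderiv_vec i f has_derivative (\<lambda>h. grad (pderiv_vec i f) x \<bullet> h)) (at x)"
    using assms by (intro has_derivative_grad) (auto simp: C2_on_def)
  moreover have "grad (pderiv_vec i f) x = (\<chi> j. hess f x $ j $ i)"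
    by (simp add: grad_def hess_def)
  ultimately show "(pderiv_vec i f has_derivative (\<lambda>h. (\<chi> j. hess f x $ j $ i) \<bullet> h)) (at x)" by simp
qed

lemma grad_nth [simp]: "grad f x $ i = pderiv_vec i f x" by (simp add: grad_def)

lemma C2_on_continuous:
  assumes "f \<in> C2_on \<Omega>"
  shows "continuous_on \<Omega> f" "continuous_on \<Omega> (pderiv_vec i f)" "continuous_on \<Omega> (\<lambda>x. hess f x $ i $ j)"
    "continuous_on \<Omega> (grad f)"
proof -
  show "continuous_on \<Omega> f"
    using C2_onD(1)[OF assms] has_derivative_continuous continuous_at_imp_continuous_on by blast
  show p: "continuous_on \<Omega> (pderiv_vec i f)" for i
    using C2_onD(2)[OF assms] has_derivative_continuous continuous_at_imp_continuous_on by blast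
  show "continuous_on \<Omega> (\<lambda>x. hess f x $ i $ j)"
    using assms by (simp add: C2_on_def hess_def)
  show "continuous_on \<Omega> (grad f)"
    unfolding grad_def by (intro continuous_on_vec_lambda p)
qed

text \<open>
  Two applications of the mean value theorem, first in the direction \<open>i\<close>, then in
  the direction \<open>j\<close>.
\<close>
lemma second_difference:
  fixes f :: "real^'n \<Rightarrow> real"
  assumes f: "f \<in> C2_on \<Omega>" and sub: "cball x (2 * h) \<subseteq> \<Omega>" and h: "h > 0"
  shows "\<exists>y\<in>cball x (2 * h). f (x + h *\<^sub>R axis i 1 + h *\<^sub>R axis j 1) - f (x + h *\<^sub>R axis i 1) - f (x + h *\<^sub>R axis j 1) + f x
     = h * h * hess f y $ j $ i"
proof -
  let ?a = "axis i 1 :: real^'n" and ?b = "axis j 1 :: real^'n"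
  have inn: "x + s *\<^sub>R ?a + t *\<^sub>R ?b \<in> cball x (2 * h)" if "0 \<le> s" "s \<le> h" "0 \<le> t" "t \<le> h" for s t
  proof -
    have "norm (s *\<^sub>R ?a + t *\<^sub>R ?b) \<le> norm (s *\<^sub>R ?a) + norm (t *\<^sub>R ?b)" by (rule norm_triangle_ineq)
    also have "\<dots> \<le> 2 * h" using that by (simp add: norm_axis_1)
    finally have "norm (s *\<^sub>R ?a + t *\<^sub>R ?b) \<le> 2 * h" .
    moreover have "x - (x + s *\<^sub>R ?a + t *\<^sub>R ?b) = - (s *\<^sub>R ?a + t *\<^sub>R ?b)" by simp
    ultimately show ?thesis by (simp only: mem_cball dist_norm norm_minus_cancel)
  qed
  have in\<Omega>: "x + s *\<^sub>R ?a + t *\<^sub>R ?b \<in> \<Omega>" if "0 \<le> s" "s \<le> h" "0 \<le> t" "t \<le> h" for s t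
    using inn[OF that] sub by blast
  have "\<exists>\<sigma>. 0 < \<sigma> \<and> \<sigma> < h \<and> (f (x + h *\<^sub>R ?a + h *\<^sub>R ?b) - f (x + h *\<^sub>R ?a + 0 *\<^sub>R ?b)) - (f (x + 0 *\<^sub>R ?a + h *\<^sub>R ?b) - f (x + 0 *\<^sub>R ?a + 0 *\<^sub>R ?b))
    = (h - 0) * (pderiv_vec i f (x + \<sigma> *\<^sub>R ?a + h *\<^sub>R ?b) - pderiv_vec i f (x + \<sigma> *\<^sub>R ?a + 0 *\<^sub>R ?b))"
  proof (rule MVT2[of 0 h "\<lambda>s. f (x + s *\<^sub>R ?a + h *\<^sub>R ?b) - f (x + s *\<^sub>R ?a + 0 *\<^sub>R ?b)" "\<lambda>\<sigma>. pderiv_vec i f (x + \<sigma> *\<^sub>R ?a + h *\<^sub>R ?b) - pderiv_vec i f (x + \<sigma> *\<^sub>R ?a + 0 *\<^sub>R ?b)"])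
    fix s assume s: "0 \<le> s" "s \<le> h"
    have d: "((\<lambda>s. f (x + s *\<^sub>R ?a + t *\<^sub>R ?b)) has_real_derivative pderiv_vec i f (x + s *\<^sub>R ?a + t *\<^sub>R ?b)) (at s)"
      if "0 \<le> t" "t \<le> h" for t
    proof -
      have "((\<lambda>s. x + s *\<^sub>R ?a + t *\<^sub>R ?b) has_derivative (\<lambda>d. d *\<^sub>R ?a)) (at s)"
        by (auto intro!: derivative_eq_intros)
      from has_derivative_compose[OF this C2_onD(1)[OF f in\<Omega>[OF s that]]]
      show ?thesis by (simp add: has_field_derivative_def inner_axis mult_commute_abs)
    qed
    show "((\<lambda>s. f (x + s *\<^sub>R ?a + h *\<^sub>R ?b) - f (x + s *\<^sub>R ?a + 0 *\<^sub>R ?b)) has_real_derivative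
      pderiv_vec i f (x + s *\<^sub>R ?a + h *\<^sub>R ?b) - pderiv_vec i f (x + s *\<^sub>R ?a + 0 *\<^sub>R ?b)) (at s)"
      using h by (intro DERIV_diff d) auto
  qed (use h in auto)
  then obtain \<sigma> where \<sigma>: "0 < \<sigma>" "\<sigma> < h" and e1: "(f (x + h *\<^sub>R ?a + h *\<^sub>R ?b) - f (x + h *\<^sub>R ?a)) - (f (x + h *\<^sub>R ?b) - f x)
    = h * (pderiv_vec i f (x + \<sigma> *\<^sub>R ?a + h *\<^sub>R ?b) - pderiv_vec i f (x + \<sigma> *\<^sub>R ?a + 0 *\<^sub>R ?b))" by auto
  have "\<exists>\<tau>. 0 < \<tau> \<and> \<tau> < h \<and> pderiv_vec i f (x + \<sigma> *\<^sub>R ?a + h *\<^sub>R ?b) - pderiv_vec i f (x + \<sigma> *\<^sub>R ?a + 0 *\<^sub>R ?b)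
    = (h - 0) * (hess f (x + \<sigma> *\<^sub>R ?a + \<tau> *\<^sub>R ?b) $ j $ i)"
  proof (rule MVT2[of 0 h "\<lambda>t. pderiv_vec i f (x + \<sigma> *\<^sub>R ?a + t *\<^sub>R ?b)" "\<lambda>t. hess f (x + \<sigma> *\<^sub>R ?a + t *\<^sub>R ?b) $ j $ i"])
    fix t assume t: "0 \<le> t" "t \<le> h"
    have "((\<lambda>t. x + \<sigma> *\<^sub>R ?a + t *\<^sub>R ?b) has_derivative (\<lambda>d. d *\<^sub>R ?b)) (at t)"
      by (auto intro!: derivative_eq_intros)
    moreover have "x + \<sigma> *\<^sub>R ?a + t *\<^sub>R ?b \<in> \<Omega>" using \<sigma> t by (intro in\<Omega>) auto
    ultimately have "((\<lambda>t. pderiv_vec i f (x + \<sigma> *\<^sub>R ?a + t *\<^sub>R ?b)) has_derivative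
      (\<lambda>d. (\<chi> l. hess f (x + \<sigma> *\<^sub>R ?a + t *\<^sub>R ?b) $ l $ i) \<bullet> (d *\<^sub>R ?b))) (at t)"
      by (intro has_derivative_compose[OF _ C2_onD(2)[OF f]])
    then show "((\<lambda>t. pderiv_vec i f (x + \<sigma> *\<^sub>R ?a + t *\<^sub>R ?b)) has_real_derivative hess f (x + \<sigma> *\<^sub>R ?a + t *\<^sub>R ?b) $ j $ i) (at t)"
      by (simp add: has_field_derivative_def inner_axis mult_commute_abs)
  qed (use h in auto)
  then obtain \<tau> where \<tau>: "0 < \<tau>" "\<tau> < h" and e2: "pderiv_vec i f (x + \<sigma> *\<^sub>R ?a + h *\<^sub>R ?b) - pderiv_vec i f (x + \<sigma> *\<^sub>R ?a + 0 *\<^sub>R ?b)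
    = h * (hess f (x + \<sigma> *\<^sub>R ?a + \<tau> *\<^sub>R ?b) $ j $ i)" by auto
  show ?thesis
    using e1 e2 inn[of \<sigma> \<tau>] \<sigma> \<tau> by (intro bexI[of _ "x + \<sigma> *\<^sub>R ?a + \<tau> *\<^sub>R ?b"]) auto
qed

text \<open>
  The second difference is symmetric in the two directions; by \<open>second_difference\<close>
  it is, after division by \<open>h\<^sup>2\<close>, a value of each of the two mixed
  derivatives near \<open>x\<close>.
\<close>
lemma hess_symmetric:
  fixes f :: "real^'n \<Rightarrow> real"
  assumes f: "f \<in> C2_on \<Omega>" and \<Omega>: "open \<Omega>" and x: "x \<in> \<Omega>"
  shows "hess f x $ i $ j = hess f x $ j $ i"
proof -
  obtain r where r: "r > 0" "cball x r \<subseteq> \<Omega>" using \<Omega> x open_contains_cball by blast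
  define h where "h n = r / 2 / real (Suc n)" for n
  have h: "h n > 0" "2 * h n \<le> r" for n using r(1) by (auto simp: h_def field_simps)
  have sub: "cball x (2 * h n) \<subseteq> \<Omega>" for n using r h[of n] by force
  have hl: "(\<lambda>n. 2 * h n) \<longlonglongrightarrow> 0"
  proof -
    have "(\<lambda>n. r * (1 / real (Suc n))) \<longlonglongrightarrow> r * 0"
      by (intro tendsto_mult tendsto_const LIMSEQ_Suc[OF lim_1_over_n])
    moreover have "(\<lambda>n. 2 * h n) = (\<lambda>n. r * (1 / real (Suc n)))" by (simp add: h_def del: of_nat_Suc)
    ultimately show ?thesis by simp
  qed
  have "\<exists>y y'. y \<in> cball x (2 * h n) \<and> y' \<in> cball x (2 * h n) \<and> hess f y $ j $ i = hess f y' $ i $ j" for n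
  proof -
    obtain y where y: "y \<in> cball x (2 * h n)" "f (x + h n *\<^sub>R axis i 1 + h n *\<^sub>R axis j 1) - f (x + h n *\<^sub>R axis i 1) - f (x + h n *\<^sub>R axis j 1) + f x
     = h n * h n * hess f y $ j $ i"
      using second_difference[OF f sub h(1)] by blast
    obtain y' where y': "y' \<in> cball x (2 * h n)" "f (x + h n *\<^sub>R axis j 1 + h n *\<^sub>R axis i 1) - f (x + h n *\<^sub>R axis j 1) - f (x + h n *\<^sub>R axis i 1) + f x
     = h n * h n * hess f y' $ i $ j"
      using second_difference[OF f sub h(1)] by blast
    have c: "x + h n *\<^sub>R axis j 1 + h n *\<^sub>R axis i 1 = x + h n *\<^sub>R axis i 1 + h n *\<^sub>R axis j 1"
      by (simp add: add_ac)
    have "h n * h n * hess f y $ j $ i = h n * h n * hess f y' $ i $ j"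
      using y(2) y'(2) unfolding c by linarith
    then have "hess f y $ j $ i = hess f y' $ i $ j" using h(1)[of n] by simp
    then show ?thesis using y(1) y'(1) by blast
  qed
  then obtain y y' where y: "\<And>n. y n \<in> cball x (2 * h n)" "\<And>n. y' n \<in> cball x (2 * h n)"
    "\<And>n. hess f (y n) $ j $ i = hess f (y' n) $ i $ j" by metis
  have lim: "z \<longlonglongrightarrow> x" if "\<And>n. z n \<in> cball x (2 * h n)" for z :: "nat \<Rightarrow> real^'n"
  proof -
    have "dist (z n) x \<le> 2 * h n" for n using that[of n] by (simp add: dist_commute)
    then have "(\<lambda>n. dist (z n) x) \<longlonglongrightarrow> 0"
      by (intro tendsto_sandwich[OF _ _ tendsto_const hl] always_eventually allI zero_le_dist)
    then show ?thesis by (rule tendsto_dist_iff[THEN iffD2])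
  qed
  have c: "isCont (\<lambda>x. hess f x $ a $ b) x" for a b
    using C2_on_continuous(3)[OF f, of a b] x unfolding continuous_on_eq_continuous_at[OF \<Omega>] by (rule bspec)
  have "(\<lambda>n. hess f (y n) $ j $ i) \<longlonglongrightarrow> hess f x $ j $ i"
    using isCont_tendsto_compose[OF c lim[OF y(1)]] .
  moreover have "(\<lambda>n. hess f (y n) $ j $ i) \<longlonglongrightarrow> hess f x $ i $ j"
    unfolding y(3) using isCont_tendsto_compose[OF c lim[OF y(2)]] .
  ultimately show ?thesis by (rule LIMSEQ_unique[symmetric])
qed

lemma hess_transpose: "f \<in> C2_on \<Omega> \<Longrightarrow> open \<Omega> \<Longrightarrow> x \<in> \<Omega> \<Longrightarrow> transpose (hess f x) = hess f x"
  using hess_symmetric[of f \<Omega> x] by (simp add: transpose_def vec_eq_iff)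

lemma grad_has_derivative:
  fixes f :: "real^'n \<Rightarrow> real"
  assumes f: "f \<in> C2_on \<Omega>" and \<Omega>: "open \<Omega>" and x: "x \<in> \<Omega>"
  shows "(grad f has_derivative (\<lambda>h. hess f x *v h)) (at x)"
proof (rule has_derivative_componentwise_within[THEN iffD2], intro ballI)
  fix b :: "real^'n" assume "b \<in> Basis"
  then obtain i where b: "b = axis i 1" by (auto simp: Basis_vec_def)
  have "(hess f x *v h) \<bullet> b = (\<chi> j. hess f x $ j $ i) \<bullet> h" for h
    using hess_symmetric[OF f \<Omega> x, of i] by (simp add: b inner_axis) (simp add: matrix_vector_mult_def inner_vec_def)
  then show "((\<lambda>x. grad f x \<bullet> b) has_derivative (\<lambda>h. (hess f x *v h) \<bullet> b)) (at x)"
    using C2_onD(2)[OF f x, of i] by (simp add: b inner_axis)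
qed

lemma A_matrix_transpose:
  "f \<in> C2_on \<Omega> \<Longrightarrow> open \<Omega> \<Longrightarrow> x \<in> \<Omega> \<Longrightarrow> transpose (A_matrix f x) = A_matrix f x"
  using hess_symmetric[of f \<Omega> x] by (auto simp: transpose_def A_matrix_def vec_eq_iff)

lemma S_op_msig:
  "f \<in> C2_on \<Omega> \<Longrightarrow> open \<Omega> \<Longrightarrow> x \<in> \<Omega> \<Longrightarrow> S_op m f x = msig m (A_matrix f x)"
  unfolding S_op_def by (intro esym_eigenvalue_vector A_matrix_transpose)

section \<open>Cutoff functions\<close>

lemma max_power_deriv:
  assumes "m \<ge> 2"
  shows "((\<lambda>t::real. (max 0 t) ^ m) has_real_derivative real m * (max 0 t) ^ (m - 1)) (at t)"
proof -
  consider "t > 0" | "t < 0" | "t = 0" by linarith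
  then show ?thesis
  proof cases
    case 1
    have "((\<lambda>t. t ^ m) has_real_derivative real m * (max 0 t) ^ (m - 1)) (at t)"
      using 1 by (auto intro!: derivative_eq_intros)
    then show ?thesis
      by (rule has_field_derivative_transform_within_open[of _ _ _ "{0<..}"]) (use 1 in auto)
  next
    case 2
    have "((\<lambda>t. 0) has_real_derivative real m * (max 0 t) ^ (m - 1)) (at t)"
      using 2 assms by (auto intro!: derivative_eq_intros simp: max_def)
    then show ?thesis
      by (rule has_field_derivative_transform_within_open[of _ _ _ "{..<0}"]) (use 2 assms in \<open>auto simp: max_def\<close>)
  next
    case 3
    have "((\<lambda>h::real. (max 0 h) ^ (m - 1)) \<longlongrightarrow> (max 0 0) ^ (m - 1)) (at 0)"
      by (intro tendsto_intros)
    moreover have "((max 0 (0 + h)) ^ m - (max 0 0) ^ m) / h = (max 0 h) ^ (m - 1)" if "h \<noteq> 0" for h :: real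
      using that assms by (cases "h > 0"; cases m) (auto simp: max_def)
    ultimately have "((\<lambda>h::real. ((max 0 (0 + h)) ^ m - (max 0 0) ^ m) / h) \<longlongrightarrow> (max 0 0) ^ (m - 1)) (at 0)"
      by (subst LIM_cong[OF refl]) auto
    then show ?thesis using assms unfolding 3 DERIV_def by (simp add: power_0_left)
  qed
qed

lemma bump_has_derivative:
  fixes c :: "'a::real_inner"
  assumes "m \<ge> 2"
  shows "((\<lambda>x. (max 0 (r\<^sup>2 - (x - c) \<bullet> (x - c))) ^ m) has_derivative
    (\<lambda>h. (- (2 * real m * (max 0 (r\<^sup>2 - (x - c) \<bullet> (x - c))) ^ (m - 1)) *\<^sub>R (x - c)) \<bullet> h)) (at x)"
proof -
  have "((\<lambda>x. r\<^sup>2 - (x - c) \<bullet> (x - c)) has_derivative (\<lambda>h. - 2 * ((x - c) \<bullet> h))) (at x)"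
    by (auto intro!: derivative_eq_intros simp: inner_commute)
  from DERIV_compose_FDERIV[OF max_power_deriv[OF assms] this]
  show ?thesis by (simp add: mult_ac)
qed

lemma mem_ball_inner_iff: "(x \<in> ball c r) \<longleftrightarrow> r > 0 \<and> r\<^sup>2 - (x - c) \<bullet> (x - c) > (0::real)"
proof (cases "r > 0")
  case True
  have "norm (x - c) < r \<longleftrightarrow> (norm (x - c))\<^sup>2 < r\<^sup>2"
    using True by (metis less_imp_le norm_ge_zero pos2 power_less_imp_less_base power_strict_mono)
  moreover have "x \<in> ball c r \<longleftrightarrow> norm (x - c) < r" by (simp add: dist_norm[symmetric] dist_commute)
  ultimately show ?thesis using True by (simp add: power2_norm_eq_inner)
next
  case False
  then have "ball c r = {}" by simp
  then show ?thesis using False by blast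
qed

text \<open>
  The sum \<open>\<theta>\<close> of the squares of the bumps \<open>max 0 (r\<^sup>2 - |x -
  c|\<^sup>2)\<close> over a finite cover of \<open>K\<close> by balls is bounded below on
  \<open>K\<close> by some \<open>m > 0\<close>; then \<open>\<zeta> = 1 - (max 0 (1 - \<theta>
  / m))\<^sup>2\<close> is continuously differentiable.
\<close>
lemma cutoff_exists:
  fixes K :: "(real^'n) set"
  assumes K: "compact K" "K \<subseteq> \<Omega>" "open \<Omega>"
  obtains \<zeta> D\<zeta> K' where "\<And>x. (\<zeta> has_derivative (\<lambda>h. D\<zeta> x \<bullet> h)) (at x)" "continuous_on UNIV D\<zeta>"
    "\<And>x. x \<in> K \<Longrightarrow> \<zeta> x = (1::real)" "\<And>x. x \<in> K \<Longrightarrow> D\<zeta> x = 0" "compact K'" "K' \<subseteq> \<Omega>" "\<And>x. x \<notin> K' \<Longrightarrow> \<zeta> x = 0"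
proof -
  have "\<exists>r>0. cball x r \<subseteq> \<Omega>" if "x \<in> K" for x using K that open_contains_cball by blast
  then obtain r where r: "\<And>x. x \<in> K \<Longrightarrow> r x > 0" "\<And>x. x \<in> K \<Longrightarrow> cball x (r x) \<subseteq> \<Omega>" by metis
  have "K \<subseteq> (\<Union>c\<in>K. ball c (r c))" using r(1) by force
  then obtain F where F: "F \<subseteq> K" "finite F" "K \<subseteq> (\<Union>c\<in>F. ball c (r c))"
    using compactE_image[OF K(1), of K "\<lambda>c. ball c (r c)"] by blast
  define \<theta> where "\<theta> x = (\<Sum>c\<in>F. (max 0 ((r c)\<^sup>2 - (x - c) \<bullet> (x - c)))^2)" for x
  define D\<theta> where "D\<theta> x = (\<Sum>c\<in>F. - (2 * real 2 * (max 0 ((r c)\<^sup>2 - (x - c) \<bullet> (x - c))) ^ (2 - 1)) *\<^sub>R (x - c))" for x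
  have d\<theta>: "(\<theta> has_derivative (\<lambda>h. D\<theta> x \<bullet> h)) (at x)" for x
    unfolding \<theta>_def D\<theta>_def inner_sum_left by (intro has_derivative_sum bump_has_derivative) auto
  have cD: "continuous_on UNIV D\<theta>" unfolding D\<theta>_def by (intro continuous_intros)
  have c\<theta>: "continuous_on S \<theta>" for S unfolding \<theta>_def by (intro continuous_intros)
  have pos: "\<theta> x > 0" if "x \<in> K" for x
  proof -
    obtain c where c: "c \<in> F" "x \<in> ball c (r c)" using F(3) \<open>x \<in> K\<close> by blast
    then have "(max 0 ((r c)\<^sup>2 - (x - c) \<bullet> (x - c)))^2 > 0" using mem_ball_inner_iff[of x c "r c"] by (simp add: max_def)
    then show ?thesis unfolding \<theta>_def using c F(2) by (intro sum_pos2[of _ c]) auto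
  qed
  obtain m where m: "m > 0" "\<And>x. x \<in> K \<Longrightarrow> \<theta> x \<ge> m"
  proof (cases "K = {}")
    case False
    then obtain z where "z \<in> K" "\<And>x. x \<in> K \<Longrightarrow> \<theta> z \<le> \<theta> x" using continuous_attains_inf[OF K(1) _ c\<theta>] by blast
    then show ?thesis using that pos by blast
  qed (use that[of 1] in auto)
  define \<zeta> where "\<zeta> x = 1 - (max 0 (1 - \<theta> x / m))^2" for x
  define D\<zeta> where "D\<zeta> x = (2 * max 0 (1 - \<theta> x / m) / m) *\<^sub>R D\<theta> x" for x
  define K' where "K' = (\<Union>c\<in>F. cball c (r c))"
  show ?thesis
  proof (rule that[of \<zeta> D\<zeta> K'])
    fix x
    have "((\<lambda>x. 1 - \<theta> x / m) has_derivative (\<lambda>h. - (D\<theta> x \<bullet> h) / m)) (at x)"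
      using m(1) by (auto intro!: derivative_eq_intros d\<theta>)
    from DERIV_compose_FDERIV[OF max_power_deriv[of 2] this]
    have "((\<lambda>x. (max 0 (1 - \<theta> x / m))^2) has_derivative (\<lambda>h. - (D\<zeta> x \<bullet> h))) (at x)"
      by (simp add: D\<zeta>_def mult_ac)
    from has_derivative_diff[OF has_derivative_const[of 1] this]
    show "(\<zeta> has_derivative (\<lambda>h. D\<zeta> x \<bullet> h)) (at x)"
      unfolding \<zeta>_def by simp
  next
    show "continuous_on UNIV D\<zeta>" unfolding D\<zeta>_def using m(1) by (intro continuous_intros cD c\<theta>) auto
    show "compact K'" unfolding K'_def using F(2) by (intro compact_UN) auto
    show "K' \<subseteq> \<Omega>" unfolding K'_def using F(1) r(2) by blast
  next
    fix x assume "x \<in> K"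
    then have "\<theta> x / m \<ge> 1" using m by simp
    then show "\<zeta> x = 1" "D\<zeta> x = 0" by (auto simp: \<zeta>_def D\<zeta>_def max_def)
  next
    fix x assume "x \<notin> K'"
    then have x: "x \<notin> cball c (r c)" if "c \<in> F" for c using that by (auto simp: K'_def)
    have "max 0 ((r c)\<^sup>2 - (x - c) \<bullet> (x - c)) = 0" if "c \<in> F" for c
    proof -
      have "x \<notin> ball c (r c)" using x[OF that] ball_subset_cball by blast
      moreover have "r c > 0" using that F(1) r(1) by blast
      ultimately have "\<not> (r c)\<^sup>2 - (x - c) \<bullet> (x - c) > 0" using mem_ball_inner_iff by blast
      then show ?thesis by (simp add: max_def)
    qed
    then have "\<theta> x = 0" by (simp add: \<theta>_def)
    then show "\<zeta> x = 0" by (simp add: \<zeta>_def)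
  qed
qed

section \<open>Divergence-free Newton tensors\<close>

lemma continuous_extend_zero:
  fixes g :: "'a::euclidean_space \<Rightarrow> 'b::real_normed_vector"
  assumes "open \<Omega>" "compact K" "K \<subseteq> \<Omega>" "continuous_on \<Omega> g" "\<And>x. x \<in> \<Omega> - K \<Longrightarrow> g x = 0"
  shows "continuous_on UNIV (\<lambda>x. if x \<in> \<Omega> then g x else 0)"
proof -
  have op: "open (- K)" using assms(2) by (simp add: compact_imp_closed open_Compl)
  have 1: "continuous_on \<Omega> (\<lambda>x. if x \<in> \<Omega> then g x else 0)"
    using assms(4) by (rule continuous_on_eq) auto
  have 2: "continuous_on (- K) (\<lambda>x. if x \<in> \<Omega> then g x else 0)"
    by (rule continuous_on_eq[OF continuous_on_const[of _ 0]]) (use assms(5) in auto)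
  have "UNIV = \<Omega> \<union> - K" using assms(3) by auto
  then show ?thesis using continuous_on_open_Un[OF assms(1) op 1 2] by simp
qed

lemma has_derivative_extend_zero:
  fixes g :: "'a::euclidean_space \<Rightarrow> 'b::real_normed_vector"
  assumes "open \<Omega>" "compact K" "K \<subseteq> \<Omega>" "\<And>x. x \<in> \<Omega> \<Longrightarrow> (g has_derivative g' x) (at x)" "\<And>x. x \<in> \<Omega> - K \<Longrightarrow> g x = 0"
  shows "((\<lambda>x. if x \<in> \<Omega> then g x else 0) has_derivative (if x \<in> \<Omega> then g' x else (\<lambda>h. 0))) (at x)"
proof (cases "x \<in> \<Omega>")
  case True
  show ?thesis using True
    by simp (rule has_derivative_transform_within_open[OF assms(4)[OF True] assms(1) True], simp)
next
  case False
  have op: "open (- K)" using assms(2) by (simp add: compact_imp_closed open_Compl)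
  have x: "x \<in> - K" using False assms(3) by blast
  show ?thesis using False
    by simp (rule has_derivative_transform_within_open[OF has_derivative_const[of 0] op x], use assms(5) in auto)
qed

lemma deriv_zero_off_support:
  fixes g :: "'a::euclidean_space \<Rightarrow> 'b::real_normed_vector"
  assumes "open \<Omega>" "compact K" "(g has_derivative g') (at x)" "\<And>x. x \<in> \<Omega> - K \<Longrightarrow> g x = 0" "x \<in> \<Omega> - K"
  shows "g' = (\<lambda>h. 0)"
proof -
  have op: "open (\<Omega> - K)" using assms(1,2) by (simp add: compact_imp_closed open_Diff)
  have "((\<lambda>y. 0) has_derivative g') (at x)"
    by (rule has_derivative_transform_within_open[OF assms(3) op assms(5)]) (use assms(4) in auto)
  then show ?thesis using has_derivative_const has_derivative_unique by blast
qed

lemma set_integrable_csupp: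
  fixes g :: "'a::euclidean_space \<Rightarrow> real"
  assumes "open \<Omega>" "compact K" "K \<subseteq> \<Omega>" "continuous_on \<Omega> g" "\<And>x. x \<in> \<Omega> - K \<Longrightarrow> g x = 0"
  shows "set_integrable lborel \<Omega> g"
proof -
  have "integrable lborel (\<lambda>x. if x \<in> \<Omega> then g x else 0)"
    using assms by (intro integrable_compact_support[OF continuous_extend_zero[OF assms] _ assms(2)]) auto
  moreover have "(\<lambda>x. if x \<in> \<Omega> then g x else 0) = (\<lambda>x. indicator \<Omega> x *\<^sub>R g x)" by (auto simp: fun_eq_iff indicator_def)
  ultimately show ?thesis by (simp add: set_integrable_def)
qed

lemma matrix_eq_0: "(\<And>h. (A::real^'n^'n) *v h = 0) \<Longrightarrow> A = 0"
  by (simp add: matrix_eq)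

lemma integral_msig_jacobian_zero:
  fixes \<eta> :: "real^'n \<Rightarrow> real^'n"
  assumes \<Omega>: "open \<Omega>" "compact K" "K \<subseteq> \<Omega>"
    and d: "\<And>x. x \<in> \<Omega> \<Longrightarrow> (\<eta> has_derivative (\<lambda>h. J x *v h)) (at x)"
    and c: "\<And>i j. continuous_on \<Omega> (\<lambda>x. J x $ i $ j)"
    and z: "\<And>x. x \<in> \<Omega> - K \<Longrightarrow> \<eta> x = 0" and k: "k \<ge> 1"
  shows "(LINT x|lborel. msig k (if x \<in> \<Omega> then J x else 0)) = 0"
proof -
  obtain R where R: "R > 0" "\<And>x. x \<in> K \<Longrightarrow> norm x < R"
    using compact_imp_bounded[OF \<Omega>(2)] by (metis bounded_pos_less)
  have J0: "J x = 0" if "x \<in> \<Omega> - K" for x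
    using deriv_zero_off_support[OF \<Omega>(1,2) d z that] that by (intro matrix_eq_0) (auto dest: fun_cong)
  show ?thesis
  proof (rule null_lagrangian[where f="\<lambda>x. if x \<in> \<Omega> then \<eta> x else 0" and R=R])
    fix x
    have eq: "(if x \<in> \<Omega> then (\<lambda>h. J x *v h) else (\<lambda>h. 0)) = (\<lambda>h. (if x \<in> \<Omega> then J x else 0) *v h)" by auto
    show "((\<lambda>x. if x \<in> \<Omega> then \<eta> x else 0) has_derivative (\<lambda>h. (if x \<in> \<Omega> then J x else 0) *v h)) (at x)"
      unfolding eq[symmetric] by (rule has_derivative_extend_zero[OF \<Omega> d z])
  next
    fix i j
    have eq: "(\<lambda>x. (if x \<in> \<Omega> then J x else 0) $ i $ j) = (\<lambda>x. if x \<in> \<Omega> then J x $ i $ j else 0)" by auto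
    show "continuous_on UNIV (\<lambda>x. (if x \<in> \<Omega> then J x else 0) $ i $ j)"
      unfolding eq by (rule continuous_extend_zero[OF \<Omega> c]) (simp add: J0)
  next
    fix x :: "real^'n" assume "R \<le> norm x"
    then show "(if x \<in> \<Omega> then \<eta> x else 0) = 0" using R(2)[of x] z[of x] by auto
  qed (use R k in auto)
qed

lemma mixsig_zero_zero:
  assumes "k \<ge> 1" "m \<le> CARD('n)"
  shows "mixsig k m (0::real^'n^'n) 0 = 0"
proof -
  have eq: "(\<Sum>m\<le>CARD('n). s ^ m * mixsig k m (0::real^'n^'n) 0) = (\<Sum>m\<le>CARD('n). s ^ m * 0)" for s
  proof -
    have "(\<chi> i j. (0::real^'n^'n) $ i $ j + s * (0::real^'n^'n) $ i $ j) = 0" by (simp add: vec_eq_iff)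
    then show ?thesis unfolding msig_affine_expand[symmetric] using msig_zero[OF assms(1)] by simp
  qed
  show ?thesis by (rule power_sum_coeffs_unique[OF eq assms(2)])
qed

text \<open>
  For smooth \<open>w\<close> this says that the Newton tensors of the Hessian are divergence
  free. Only two derivatives of \<open>w\<close> are available, so it is obtained instead from
  the null Lagrangian \<open>msig k\<close>, applied to the vector field \<open>\<zeta>
  \<nabla>w + \<tau> \<eta>\<close> with a cutoff \<open>\<zeta>\<close> that equals
  \<open>1\<close> on the support of \<open>\<eta>\<close>: the integral is a polynomial in
  \<open>\<tau>\<close> that vanishes identically, and the asserted integral is its coefficient
  of \<open>\<tau>\<close>.
\<close>
lemma integral_newton_tensor_zero:
  fixes \<eta> :: "real^'n \<Rightarrow> real^'n"
  assumes w: "w \<in> C2_on \<Omega>" and \<Omega>: "open \<Omega>" "compact K" "K \<subseteq> \<Omega>"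
    and d: "\<And>x. x \<in> \<Omega> \<Longrightarrow> (\<eta> has_derivative (\<lambda>h. J x *v h)) (at x)"
    and c: "\<And>i j. continuous_on \<Omega> (\<lambda>x. J x $ i $ j)"
    and z: "\<And>x. x \<in> \<Omega> - K \<Longrightarrow> \<eta> x = 0"
  shows "(LINT x:\<Omega>|lborel. dsig k (hess w x) (J x)) = 0" "set_integrable lborel \<Omega> (\<lambda>x. dsig k (hess w x) (J x))"
proof -
  have J0: "J x = 0" if "x \<in> \<Omega> - K" for x
    using deriv_zero_off_support[OF \<Omega>(1,2) d z that] that by (intro matrix_eq_0) (auto dest: fun_cong)
  show "set_integrable lborel \<Omega> (\<lambda>x. dsig k (hess w x) (J x))"
    by (rule set_integrable_csupp[OF \<Omega>]) (auto intro!: continuous_on_dsig C2_on_continuous[OF w] c simp: J0 dsig_zero)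
  show "(LINT x:\<Omega>|lborel. dsig k (hess w x) (J x)) = 0"
  proof (cases "k = 0")
    case False
    then have k: "k \<ge> 1" by simp
    obtain \<zeta> D\<zeta> K' where \<zeta>: "\<And>x. (\<zeta> has_derivative (\<lambda>h. D\<zeta> x \<bullet> h)) (at x)" "continuous_on UNIV D\<zeta>"
      "\<And>x. x \<in> K \<Longrightarrow> \<zeta> x = (1::real)" "\<And>x. x \<in> K \<Longrightarrow> D\<zeta> x = 0" "compact K'" "K' \<subseteq> \<Omega>" "\<And>x. x \<notin> K' \<Longrightarrow> \<zeta> x = 0"
      using cutoff_exists[OF \<Omega>(2,3,1)] by blast
    have c\<zeta>: "continuous_on S \<zeta>" for S
      using \<zeta>(1) has_derivative_continuous continuous_at_imp_continuous_on by blast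
    define H where "H x = (\<chi> i j. \<zeta> x * hess w x $ i $ j + grad w x $ i * D\<zeta> x $ j)" for x
    have dH: "((\<lambda>x. \<zeta> x *\<^sub>R grad w x) has_derivative (\<lambda>h. H x *v h)) (at x)" if "x \<in> \<Omega>" for x
    proof -
      have "((\<lambda>x. \<zeta> x *\<^sub>R grad w x) has_derivative (\<lambda>h. \<zeta> x *\<^sub>R (hess w x *v h) + (D\<zeta> x \<bullet> h) *\<^sub>R grad w x)) (at x)"
        by (rule has_derivative_scaleR[OF \<zeta>(1) grad_has_derivative[OF w \<Omega>(1) that]])
      moreover have "\<zeta> x *\<^sub>R (hess w x *v h) + (D\<zeta> x \<bullet> h) *\<^sub>R grad w x = H x *v h" for h
        by (simp add: H_def vec_eq_iff matrix_vector_mult_def inner_vec_def sum_distrib_left sum_distrib_right sum.distrib algebra_simps)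
      ultimately show ?thesis by simp
    qed
    have cH: "continuous_on \<Omega> (\<lambda>x. H x $ i $ j)" for i j
      unfolding H_def by (auto intro!: continuous_intros c\<zeta> C2_on_continuous[OF w] continuous_on_subset[OF \<zeta>(2)])
    have K2: "compact (K \<union> K')" "K \<union> K' \<subseteq> \<Omega>" using \<Omega> \<zeta>(5,6) by auto
    have H0: "H x = 0" if "x \<in> \<Omega> - (K \<union> K')" for x
    proof (rule matrix_eq_0)
      have "(\<lambda>h. H x *v h) = (\<lambda>h. 0)"
        by (rule deriv_zero_off_support[OF \<Omega>(1) \<zeta>(5) dH]) (use that \<zeta>(7) in auto)
      then show "H x *v h = 0" for h by (rule fun_cong)
    qed
    define M1 where "M1 x = (if x \<in> \<Omega> then H x else 0)" for x
    define M2 where "M2 x = (if x \<in> \<Omega> then J x else 0)" for x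
    have cM: "continuous_on UNIV (\<lambda>x. M1 x $ i $ j)" "continuous_on UNIV (\<lambda>x. M2 x $ i $ j)" for i j
    proof -
      have eq: "(\<lambda>x. M1 x $ i $ j) = (\<lambda>x. if x \<in> \<Omega> then H x $ i $ j else 0)" "(\<lambda>x. M2 x $ i $ j) = (\<lambda>x. if x \<in> \<Omega> then J x $ i $ j else 0)"
        by (auto simp: M1_def M2_def)
      show "continuous_on UNIV (\<lambda>x. M1 x $ i $ j)"
        unfolding eq by (rule continuous_extend_zero[OF \<Omega>(1) K2 cH]) (simp add: H0)
      show "continuous_on UNIV (\<lambda>x. M2 x $ i $ j)"
        unfolding eq by (rule continuous_extend_zero[OF \<Omega> c]) (simp add: J0)
    qed
    have M0: "M1 x = 0" "M2 x = 0" if "x \<notin> K \<union> K'" for x using H0[of x] J0[of x] that by (auto simp: M1_def M2_def)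
    have im: "integrable lborel (\<lambda>x. mixsig k m (M1 x) (M2 x))" if "m \<le> CARD('n)" for m
      by (rule integrable_compact_support[OF continuous_on_mixsig[OF cM] _ K2(1)]) (simp add: M0 mixsig_zero_zero[OF k that])
    have eq: "(\<Sum>m\<le>CARD('n). \<tau> ^ m * (LINT x|lborel. mixsig k m (M1 x) (M2 x))) = (\<Sum>m\<le>CARD('n). \<tau> ^ m * 0)" for \<tau>
    proof -
      have "(LINT x|lborel. msig k (if x \<in> \<Omega> then (\<chi> i j. H x $ i $ j + \<tau> * J x $ i $ j) else 0)) = 0"
      proof (rule integral_msig_jacobian_zero[OF \<Omega>(1) K2, where \<eta>="\<lambda>x. \<zeta> x *\<^sub>R grad w x + \<tau> *\<^sub>R \<eta> x"])
        fix x assume x: "x \<in> \<Omega>"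
        have "((\<lambda>x. \<zeta> x *\<^sub>R grad w x + \<tau> *\<^sub>R \<eta> x) has_derivative (\<lambda>h. H x *v h + \<tau> *\<^sub>R (J x *v h))) (at x)"
          by (intro has_derivative_add has_derivative_scaleR_right dH d x)
        moreover have "H x *v h + \<tau> *\<^sub>R (J x *v h) = (\<chi> i j. H x $ i $ j + \<tau> * J x $ i $ j) *v h" for h
          by (simp add: vec_eq_iff matrix_vector_mult_def sum_distrib_left sum.distrib algebra_simps)
        ultimately show "((\<lambda>x. \<zeta> x *\<^sub>R grad w x + \<tau> *\<^sub>R \<eta> x) has_derivative (\<lambda>h. (\<chi> i j. H x $ i $ j + \<tau> * J x $ i $ j) *v h)) (at x)" by simp
      next
        fix x assume "x \<in> \<Omega> - (K \<union> K')"
        then show "\<zeta> x *\<^sub>R grad w x + \<tau> *\<^sub>R \<eta> x = 0" using z[of x] \<zeta>(7)[of x] by auto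
      qed (use k in \<open>auto intro!: continuous_intros cH c\<close>)
      moreover have "(if x \<in> \<Omega> then (\<chi> i j. H x $ i $ j + \<tau> * J x $ i $ j) else 0) = (\<chi> i j. M1 x $ i $ j + \<tau> * M2 x $ i $ j)" for x
        by (auto simp: M1_def M2_def vec_eq_iff)
      ultimately have "(LINT x|lborel. (\<Sum>m\<le>CARD('n). \<tau> ^ m * mixsig k m (M1 x) (M2 x))) = 0"
        by (simp only: msig_affine_expand)
      then show ?thesis by (subst (asm) Bochner_Integration.integral_sum) (auto intro!: im)
    qed
    have "Suc 0 \<le> CARD('n)" using zero_less_card_finite[where 'a='n] by linarith
    from power_sum_coeffs_unique[OF eq this] have "(LINT x|lborel. dsig k (M1 x) (M2 x)) = 0" by (simp add: mixsig_1)
    moreover have "dsig k (M1 x) (M2 x) = indicator \<Omega> x *\<^sub>R dsig k (hess w x) (J x)" for x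
    proof (cases "x \<in> K")
      case True
      then have "H x = hess w x" using \<zeta>(3,4) by (simp add: H_def vec_eq_iff)
      then show ?thesis using True \<Omega>(3) by (auto simp: M1_def M2_def)
    next
      case False
      then show ?thesis using J0[of x] by (auto simp: M2_def indicator_def dsig_zero)
    qed
    ultimately show ?thesis by (simp add: set_lebesgue_integral_def)
  qed (simp add: set_lebesgue_integral_def)
qed

section \<open>The cone condition in the closed class\<close>

lemma msig_1_trace: "msig (Suc 0) (J::'a::field^'n^'n) = (\<Sum>i\<in>UNIV. J $ i $ i)"
proof -
  have "det (minor_mat {l} J) = J $ l $ l" for l
  proof -
    have row1: "row i (mat 1 :: 'a^'n^'n) = axis i 1" for i
      by (auto simp: row_def vec_eq_iff axis_def mat_def)
    have "(\<Sum>i\<in>UNIV. J $ l $ i *s axis i 1) = J $ l" by (rule basis_expansion)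
    then have "minor_mat {l} J = (\<chi> i. if i = l then (\<Sum>i\<in>UNIV. J $ l $ i *s row i (mat 1)) else row i (mat 1))"
      unfolding row1 by (auto simp: minor_mat_def vec_eq_iff)
    then show ?thesis by (simp only: cramer_lemma_transpose det_I mult_1_right)
  qed
  then show ?thesis by (simp add: msig_def sum_card_1)
qed

text \<open>
  The integrand of the difference is the divergence of \<open>\<phi> B\<nabla>w - w
  B\<^sup>T\<nabla>\<phi> - c w \<phi> p\<close>, and the divergence is the null Lagrangian
  \<open>msig 1\<close> of the Jacobian matrix.
\<close>
lemma second_order_operator_adjoint:
  fixes B :: "real^'n^'n" and p :: "real^'n" and w :: "real^'n \<Rightarrow> real"
  assumes w: "w \<in> C2_on \<Omega>" and \<Omega>: "open \<Omega>" "compact K" "K \<subseteq> \<Omega>"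
    and \<phi>: "\<And>x. (\<phi> has_derivative (\<lambda>h. G x \<bullet> h)) (at x)" "\<And>x. (G has_derivative (\<lambda>h. D x *v h)) (at x)"
    "\<And>i j. continuous_on UNIV (\<lambda>x. D x $ i $ j)" "\<And>x. x \<notin> K \<Longrightarrow> \<phi> x = (0::real)" "\<And>x. x \<notin> K \<Longrightarrow> G x = 0"
  shows "(LINT x:\<Omega>|lborel. \<phi> x * (B \<bullet> hess w x - c * (p \<bullet> grad w x) + e * w x)) =
    (LINT x:\<Omega>|lborel. w x * ((\<Sum>i\<in>UNIV. \<Sum>j\<in>UNIV. B $ i $ j * D x $ i $ j) + c * (p \<bullet> G x) + e * \<phi> x))"
    "set_integrable lborel \<Omega> (\<lambda>x. \<phi> x * (B \<bullet> hess w x - c * (p \<bullet> grad w x) + e * w x))"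
    "set_integrable lborel \<Omega> (\<lambda>x. w x * ((\<Sum>i\<in>UNIV. \<Sum>j\<in>UNIV. B $ i $ j * D x $ i $ j) + c * (p \<bullet> G x) + e * \<phi> x))"
proof -
  have c\<phi>: "continuous_on S \<phi>" for S
    using \<phi>(1) has_derivative_continuous continuous_at_imp_continuous_on by blast
  have cG: "continuous_on S G" for S
    using \<phi>(2) has_derivative_continuous continuous_at_imp_continuous_on by blast
  have cD: "continuous_on S (\<lambda>x. D x $ i $ j)" for S i j by (rule continuous_on_subset[OF \<phi>(3)]) simp
  note cw = C2_on_continuous[OF w]
  have D0: "D x = 0" if "x \<notin> K" for x
  proof (rule matrix_eq_0)
    have "(\<lambda>h. D x *v h) = (\<lambda>h. 0)"
      by (rule deriv_zero_off_support[OF open_UNIV \<Omega>(2) \<phi>(2)]) (use \<phi>(5) that in auto)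
    then show "D x *v h = 0" for h by (rule fun_cong)
  qed
  let ?f = "\<lambda>x. \<phi> x * (B \<bullet> hess w x - c * (p \<bullet> grad w x) + e * w x)"
  let ?g = "\<lambda>x. w x * ((\<Sum>i\<in>UNIV. \<Sum>j\<in>UNIV. B $ i $ j * D x $ i $ j) + c * (p \<bullet> G x) + e * \<phi> x)"
  show f: "set_integrable lborel \<Omega> ?f"
    by (rule set_integrable_csupp[OF \<Omega>]) (auto simp: inner_vec_def \<phi>(4) intro!: continuous_intros c\<phi> cw)
  show g: "set_integrable lborel \<Omega> ?g"
    by (rule set_integrable_csupp[OF \<Omega>]) (auto simp: inner_vec_def \<phi>(4,5) D0 intro!: continuous_intros c\<phi> cw cD continuous_on_component cG)
  define J where "J x = (\<chi> i j. (B *v grad w x) $ i * G x $ j + \<phi> x * (B ** hess w x) $ i $ j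
     - ((G x v* B) $ i * grad w x $ j + w x * (transpose B ** D x) $ i $ j)
     - c * (p $ i * (w x * G x $ j + \<phi> x * grad w x $ j)))" for x
  have "(LINT x|lborel. msig 1 (if x \<in> \<Omega> then J x else 0)) = 0"
  proof (rule integral_msig_jacobian_zero[OF \<Omega>, where \<eta>="\<lambda>x. \<phi> x *\<^sub>R (B *v grad w x) - w x *\<^sub>R (transpose B *v G x) - (c * (w x * \<phi> x)) *\<^sub>R p"])
    fix x assume x: "x \<in> \<Omega>"
    have "((\<lambda>x. \<phi> x *\<^sub>R (B *v grad w x) - w x *\<^sub>R (transpose B *v G x) - (c * (w x * \<phi> x)) *\<^sub>R p) has_derivative
      (\<lambda>h. (\<phi> x *\<^sub>R (B *v (hess w x *v h)) + (G x \<bullet> h) *\<^sub>R (B *v grad w x))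
        - (w x *\<^sub>R (transpose B *v (D x *v h)) + (grad w x \<bullet> h) *\<^sub>R (transpose B *v G x))
        - (c * (w x * (G x \<bullet> h) + (grad w x \<bullet> h) * \<phi> x)) *\<^sub>R p)) (at x)"
      by (intro has_derivative_diff has_derivative_scaleR has_derivative_scaleR_left has_derivative_mult_right has_derivative_mult
          bounded_linear.has_derivative[OF matrix_vector_mul_bounded_linear] \<phi> C2_onD(1)[OF w x] grad_has_derivative[OF w \<Omega>(1) x])
    moreover have "(\<phi> x *\<^sub>R (B *v (hess w x *v h)) + (G x \<bullet> h) *\<^sub>R (B *v grad w x))
        - (w x *\<^sub>R (transpose B *v (D x *v h)) + (grad w x \<bullet> h) *\<^sub>R (transpose B *v G x))
        - (c * (w x * (G x \<bullet> h) + (grad w x \<bullet> h) * \<phi> x)) *\<^sub>R p = J x *v h" for h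
    proof -
      have a: "(B *v (hess w x *v h)) $ i = (\<Sum>j\<in>UNIV. (B ** hess w x) $ i $ j * h $ j)" for i
        unfolding matrix_vector_mul_assoc by (simp add: matrix_vector_mult_def)
      have b: "(transpose B *v (D x *v h)) $ i = (\<Sum>j\<in>UNIV. (transpose B ** D x) $ i $ j * h $ j)" for i
        unfolding matrix_vector_mul_assoc by (simp add: matrix_vector_mult_def)
      have c: "(J x *v h) $ i = (\<Sum>j\<in>UNIV. J x $ i $ j * h $ j)" for i
        by (simp add: matrix_vector_mult_def)
      have d: "transpose B *v G x = G x v* B" by (simp add: transpose_matrix_vector)
      show ?thesis
        unfolding vec_eq_iff vector_minus_component vector_add_component vector_scaleR_component a b c d
        unfolding inner_vec_def J_def
        by (simp add: sum_distrib_left sum_distrib_right sum.distrib sum_subtractf algebra_simps)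
    qed
    ultimately show "((\<lambda>x. \<phi> x *\<^sub>R (B *v grad w x) - w x *\<^sub>R (transpose B *v G x) - (c * (w x * \<phi> x)) *\<^sub>R p) has_derivative (\<lambda>h. J x *v h)) (at x)"
      by simp
  next
    fix i j show "continuous_on \<Omega> (\<lambda>x. J x $ i $ j)"
      unfolding J_def matrix_vector_mult_def vector_matrix_mult_def matrix_matrix_mult_def
      by (auto intro!: continuous_intros c\<phi> cw cD continuous_on_component cG)
  qed (auto simp: \<phi>(4,5))
  moreover have "msig 1 (if x \<in> \<Omega> then J x else 0) = indicator \<Omega> x *\<^sub>R ?f x - indicator \<Omega> x *\<^sub>R ?g x" for x
  proof (cases "x \<in> \<Omega>")
    case True
    have hs: "hess w x $ i $ j = hess w x $ j $ i" for i j by (rule hess_symmetric[OF w \<Omega>(1) True])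
    have 1: "(\<Sum>i\<in>UNIV. (B *v grad w x) $ i * G x $ i) = (\<Sum>i\<in>UNIV. (G x v* B) $ i * grad w x $ i)"
      unfolding matrix_vector_mult_def vector_matrix_mult_def
      by (simp add: sum_distrib_right sum_distrib_left mult_ac) (rule sum.swap)
    have 2: "(\<Sum>i\<in>UNIV. (B ** hess w x) $ i $ i) = B \<bullet> hess w x"
      unfolding matrix_matrix_mult_def inner_vec_def by (simp add: hs)
    have 3: "(\<Sum>i\<in>UNIV. (transpose B ** D x) $ i $ i) = (\<Sum>i\<in>UNIV. \<Sum>j\<in>UNIV. B $ i $ j * D x $ i $ j)"
      unfolding matrix_matrix_mult_def transpose_def by simp (rule sum.swap)

    have "(\<Sum>i\<in>UNIV. J x $ i $ i) = \<phi> x * (\<Sum>i\<in>UNIV. (B ** hess w x) $ i $ i) - w x * (\<Sum>i\<in>UNIV. (transpose B ** D x) $ i $ i)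
      - c * (w x * (p \<bullet> G x) + \<phi> x * (p \<bullet> grad w x)) + ((\<Sum>i\<in>UNIV. (B *v grad w x) $ i * G x $ i) - (\<Sum>i\<in>UNIV. (G x v* B) $ i * grad w x $ i))"
      unfolding J_def inner_vec_def
      by (simp add: sum_distrib_left sum_distrib_right sum.distrib sum_subtractf algebra_simps)
    then show ?thesis using True unfolding 1 2 3 by (simp add: msig_1_trace algebra_simps)
  qed (simp add: msig_zero)
  ultimately have "(LINT x|lborel. indicator \<Omega> x *\<^sub>R ?f x - indicator \<Omega> x *\<^sub>R ?g x) = 0" by simp
  then show "(LINT x:\<Omega>|lborel. ?f x) = (LINT x:\<Omega>|lborel. ?g x)"
    using f g by (simp add: set_lebesgue_integral_def set_integrable_def)
qed

lemma continuous_on_matrix: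
  fixes M :: "'a::topological_space \<Rightarrow> real^'n^'m"
  assumes "\<And>i j. continuous_on S (\<lambda>x. M x $ i $ j)"
  shows "continuous_on S M"
proof -
  have "continuous_on S (\<lambda>x. \<chi> i j. M x $ i $ j)" by (intro continuous_on_vec_lambda assms)
  then show ?thesis by simp
qed

lemma A_matrix_alt: "A_matrix w x = w x *\<^sub>R hess w x - ((norm (grad w x))\<^sup>2 / 2) *\<^sub>R mat 1"
  by (auto simp: A_matrix_def vec_eq_iff mat_nth)

lemma Phi_tilde_gcone:
  fixes w :: "real^'n \<Rightarrow> real"
  assumes "w \<in> Phi_tilde k \<Omega>" "open \<Omega>" "x \<in> \<Omega>"
  shows "A_matrix w x \<in> gcone k"
proof -
  have w: "w \<in> C2_on \<Omega>" and e: "eigenvalue_vector (A_matrix w x) \<in> Gamma_cone k"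
    using assms by (auto simp: Phi_tilde_def)
  have t: "transpose (A_matrix w x) = A_matrix w x" by (rule A_matrix_transpose[OF w assms(2,3)])
  show ?thesis using e unfolding gcone_def Gamma_cone_def by (simp add: t esym_eigenvalue_vector[OF t])
qed

text \<open>
  Multiplied by \<open>s\<close>, the left-hand side exceeds the assumed quantity by \<open>c |g
  - s p|\<^sup>2 / 2\<close>. The vector \<open>p\<close> linearises the quadratic term in the
  gradient, with equality for \<open>p = g / s\<close>.
\<close>
lemma cone_linear_criterion:
  fixes H B :: "real^'n^'n" and g p :: "real^'n"
  assumes "s > 0" "B \<bullet> (s *\<^sub>R H - ((norm g)\<^sup>2 / 2) *\<^sub>R mat 1) \<ge> 0" "c = B \<bullet> mat 1" "c \<ge> 0"
  shows "B \<bullet> H - c * (p \<bullet> g) + c * (norm p)\<^sup>2 / 2 * s \<ge> 0"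
proof -
  have E: "(norm (g - s *\<^sub>R p))\<^sup>2 = (norm g)\<^sup>2 - 2 * s * (p \<bullet> g) + s\<^sup>2 * (norm p)\<^sup>2"
    unfolding power2_norm_eq_inner by (simp add: inner_diff_left inner_diff_right inner_commute power2_eq_square algebra_simps)
  have "s * (B \<bullet> H - c * (p \<bullet> g) + c * (norm p)\<^sup>2 / 2 * s) =
    B \<bullet> (s *\<^sub>R H - ((norm g)\<^sup>2 / 2) *\<^sub>R mat 1) + c / 2 * (norm (g - s *\<^sub>R p))\<^sup>2"
    unfolding E by (simp add: inner_diff_right assms(3)[symmetric] power2_eq_square algebra_simps)
  moreover have "c / 2 * (norm (g - s *\<^sub>R p))\<^sup>2 \<ge> 0" using assms(4) by simp
  ultimately have "s * (B \<bullet> H - c * (p \<bullet> g) + c * (norm p)\<^sup>2 / 2 * s) \<ge> 0" using assms(2) by linarith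
  then show ?thesis using assms(1) by (simp add: zero_le_mult_iff)
qed

text \<open>
  The cone is closed and convex; a hyperplane that separates it from \<open>A\<close> can be
  moved to the origin because the cone is invariant under dilations.
\<close>
lemma gcone_separation:
  fixes A :: "real^'n^'n"
  assumes "A \<notin> gcone k" "k \<le> CARD('n)"
  obtains B where "B \<bullet> A < 0" "\<And>X. X \<in> gcone k \<Longrightarrow> B \<bullet> X \<ge> 0"
proof -
  have z: "(0::real^'n^'n) \<in> gcone k" using gcone_mat[of 0 k] assms(2) by (simp add: mat_0[symmetric] del: mat_0)
  have conv: "convex (gcone k :: (real^'n^'n) set)"
    unfolding convex_def using gcone_add[OF assms(2)] gcone_scale by blast
  obtain B b where B: "B \<bullet> A < b" "\<forall>X\<in>gcone k. B \<bullet> X > b"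
    using separating_hyperplane_closed_point[OF conv gcone_closed assms(1)] by blast
  have b: "b < 0" using B(2) z by force
  have "B \<bullet> X \<ge> 0" if X: "X \<in> gcone k" for X
  proof (rule ccontr)
    assume "\<not> B \<bullet> X \<ge> 0"
    then have neg: "B \<bullet> X < 0" by simp
    have "(b / (B \<bullet> X)) *\<^sub>R X \<in> gcone k" using b neg by (intro gcone_scale[OF X]) (simp add: zero_le_divide_iff)
    then have "B \<bullet> ((b / (B \<bullet> X)) *\<^sub>R X) > b" using B(2) by blast
    then show False using neg by simp
  qed
  moreover have "B \<bullet> A < 0" using B(1) b by simp
  ultimately show ?thesis using that by blast
qed

lemma L1_limit_integral:
  fixes q :: "real^'n \<Rightarrow> real"
  assumes \<Omega>: "open \<Omega>" "compact K" "K \<subseteq> \<Omega>" and w: "\<And>m. continuous_on \<Omega> (w m)" and u: "continuous_on \<Omega> u"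
    and lim: "L1_loc_tendsto \<Omega> w u" and q: "continuous_on \<Omega> q" "\<And>x. x \<in> \<Omega> - K \<Longrightarrow> q x = 0"
  shows "(\<lambda>m. LINT x:\<Omega>|lborel. w m x * q x) \<longlonglongrightarrow> (LINT x:\<Omega>|lborel. u x * q x)"
proof -
  obtain Q where Q: "\<And>x. x \<in> K \<Longrightarrow> \<bar>q x\<bar> \<le> Q" "Q \<ge> 0"
  proof -
    have "compact (q ` K)" using \<Omega> q(1) by (intro compact_continuous_image continuous_on_subset[OF q(1)]) auto
    then obtain C where C: "\<And>y. y \<in> q ` K \<Longrightarrow> norm y \<le> C" using compact_imp_bounded bounded_iff by metis
    have "\<bar>q x\<bar> \<le> \<bar>C\<bar>" if "x \<in> K" for x using C[of "q x"] that by auto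
    then show ?thesis using that[of "\<bar>C\<bar>"] by simp
  qed
  have i1: "set_integrable lborel \<Omega> (\<lambda>x. f x * q x)" if "continuous_on \<Omega> f" for f
    by (rule set_integrable_csupp[OF \<Omega>]) (auto intro!: continuous_intros that q)
  have i2: "set_integrable lborel K (\<lambda>x. \<bar>w m x - u x\<bar>)" for m
    unfolding set_integrable_def
    by (intro borel_integrable_compact \<Omega>(2) continuous_on_subset[OF _ \<Omega>(3)] continuous_intros w u)
  have leb: "(LINT x:K|lebesgue. \<bar>w m x - u x\<bar>) = (LINT x:K|lborel. \<bar>w m x - u x\<bar>)" for m
    unfolding set_lebesgue_integral_def
    by (rule integral_completion) (rule borel_measurable_integrable[OF i2[unfolded set_integrable_def]])
  have l0: "(\<lambda>m. Q * (LINT x:K|lborel. \<bar>w m x - u x\<bar>)) \<longlonglongrightarrow> Q * 0"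
    using lim \<Omega>(2,3) unfolding L1_loc_tendsto_def leb[symmetric] by (intro tendsto_mult tendsto_const) auto
  have b: "norm ((LINT x:\<Omega>|lborel. w m x * q x) - (LINT x:\<Omega>|lborel. u x * q x)) \<le> Q * (LINT x:K|lborel. \<bar>w m x - u x\<bar>)" for m
  proof -
    have "(LINT x:\<Omega>|lborel. w m x * q x) - (LINT x:\<Omega>|lborel. u x * q x) = (LINT x:\<Omega>|lborel. w m x * q x - u x * q x)"
      by (rule set_integral_diff(2)[OF i1[OF w] i1[OF u], symmetric])
    also have "norm \<dots> \<le> (LINT x|lborel. Q * (indicator K x *\<^sub>R \<bar>w m x - u x\<bar>))"
      unfolding set_lebesgue_integral_def
    proof (rule Bochner_Integration.integral_norm_bound_integral)
      show "integrable lborel (\<lambda>x. indicator \<Omega> x *\<^sub>R (w m x * q x - u x * q x))"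
        using set_integral_diff(1)[OF i1[OF w] i1[OF u]] by (simp add: set_integrable_def)
      show "integrable lborel (\<lambda>x. Q * (indicator K x *\<^sub>R \<bar>w m x - u x\<bar>))"
        using i2[of m] by (simp add: set_integrable_def)
      fix x
      show "norm (indicator \<Omega> x *\<^sub>R (w m x * q x - u x * q x)) \<le> Q * (indicator K x *\<^sub>R \<bar>w m x - u x\<bar>)"
      proof (cases "x \<in> K")
        case True
        have "\<bar>w m x - u x\<bar> * \<bar>q x\<bar> \<le> \<bar>w m x - u x\<bar> * Q" using Q True by (intro mult_left_mono) auto
        moreover have "w m x * q x - u x * q x = (w m x - u x) * q x" by (simp add: algebra_simps)
        moreover have "x \<in> \<Omega>" using True \<Omega>(3) by blast
        ultimately show ?thesis using True by (simp add: abs_mult mult.commute[of Q])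
      next
        case False
        then show ?thesis using q(2)[of x] by (auto simp: indicator_def)
      qed
    qed
    also have "\<dots> = Q * (LINT x:K|lborel. \<bar>w m x - u x\<bar>)" by (simp add: set_lebesgue_integral_def)
    finally show ?thesis .
  qed
  have "(\<lambda>m. (LINT x:\<Omega>|lborel. w m x * q x) - (LINT x:\<Omega>|lborel. u x * q x)) \<longlonglongrightarrow> 0"
    by (rule Lim_null_comparison[OF always_eventually l0[simplified]]) (use b in blast)
  then show ?thesis by (simp add: LIM_zero_iff)
qed

lemma integral_pos_of_ball:
  fixes f :: "real^'n \<Rightarrow> real"
  assumes r: "r > 0" and f: "integrable lborel f" "\<And>x. f x \<ge> 0" and e: "e > 0" "\<And>x. x \<in> ball a r \<Longrightarrow> f x \<ge> e"
  shows "(LINT x|lborel. f x) > 0"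
proof -
  have fm: "ball a r \<in> sets lborel" "emeasure lborel (ball a r) < \<infinity>" using emeasure_lborel_ball_finite[of a r] by auto
  have "0 < e * measure lborel (ball a r)" using e(1) content_ball_pos[OF r, of a] by (simp add: measure_completion)
  also have "\<dots> = (LINT x|lborel. e * indicator (ball a r) x)" by simp
  also have "\<dots> \<le> (LINT x|lborel. f x)"
  proof (rule integral_mono[OF _ f(1)])
    show "integrable lborel (\<lambda>x. e * indicator (ball a r) x)"
      using fm by (intro integrable_mult_right integrable_real_indicator) auto
    show "e * indicator (ball a r) x \<le> f x" for x using e f(2)[of x] by (auto simp: indicator_def)
  qed
  finally show ?thesis .
qed

text \<open>
  If the condition fails at \<open>x0\<close>, a hyperplane \<open>B\<close> separates
  \<open>A(u)\<close> from the cone there, and with \<open>p = \<nabla>u / u\<close> at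
  \<open>x0\<close> the linear operator \<open>L w = B \<bullet> D\<^sup>2w - c p \<bullet>
  \<nabla>w + e w\<close> is negative on \<open>u\<close> near \<open>x0\<close>. By
  \<open>cone_linear_criterion\<close> it is nonnegative on the approximating functions, so
  \<open>\<integral> w L\<^sup>*\<phi> \<ge> 0\<close> for every nonnegative bump
  \<open>\<phi>\<close>. This inequality survives the convergence in \<open>L\<^sup>1\<close>
  and contradicts \<open>\<integral> \<phi> L u < 0\<close>.
\<close>
lemma Phi_C2_A_matrix_gcone:
  fixes u :: "real^'n \<Rightarrow> real"
  assumes k: "k \<le> CARD('n)" and \<Omega>: "open \<Omega>" and u: "u \<in> Phi k \<Omega>" "u \<in> C2_on \<Omega>" and x0: "x0 \<in> \<Omega>"
  shows "A_matrix u x0 \<in> gcone k"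
proof (rule ccontr)
  assume "A_matrix u x0 \<notin> gcone k"
  then obtain B where B: "B \<bullet> A_matrix u x0 < 0" "\<And>X. X \<in> gcone k \<Longrightarrow> B \<bullet> X \<ge> 0"
    using gcone_separation[OF _ k] by blast
  define c where "c = B \<bullet> mat 1"
  have c0: "c \<ge> 0" unfolding c_def by (intro B(2) gcone_mat k) simp
  have upos: "u x > 0" if "x \<in> \<Omega>" for x using u(1) that by (simp add: Phi_def)
  define p where "p = (1 / u x0) *\<^sub>R grad u x0"
  define e where "e = c * (norm p)\<^sup>2 / 2"
  define L where "L w x = B \<bullet> hess w x - c * (p \<bullet> grad w x) + e * w x" for w x
  have L0: "L u x0 < 0"
  proof -
    have "u x0 * L u x0 = B \<bullet> A_matrix u x0"
      using upos[OF x0] unfolding L_def e_def p_def A_matrix_alt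
      by (simp add: inner_diff_right c_def[symmetric] power2_norm_eq_inner[symmetric] power_divide field_simps power2_eq_square)
    then show ?thesis using B(1) upos[OF x0] mult_nonneg_nonneg[of "u x0" "L u x0"] by linarith
  qed
  have Lnn: "L w x \<ge> 0" if "w \<in> Phi_tilde k \<Omega>" "x \<in> \<Omega>" for w x
    unfolding L_def e_def
  proof (rule cone_linear_criterion[OF _ _ c_def c0])
    show "w x > 0" using that by (simp add: Phi_tilde_def)
    show "0 \<le> B \<bullet> (w x *\<^sub>R hess w x - ((norm (grad w x))\<^sup>2 / 2) *\<^sub>R mat 1)"
      unfolding A_matrix_alt[symmetric] by (intro B(2) Phi_tilde_gcone[OF that(1) \<Omega> that(2)])
  qed
  have cL: "continuous_on \<Omega> (L w)" if "w \<in> C2_on \<Omega>" for w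
  proof -
    have "continuous_on \<Omega> (hess w)" by (rule continuous_on_matrix, rule C2_on_continuous(3)[OF that])
    then show ?thesis unfolding L_def by (intro continuous_intros C2_on_continuous(1,4)[OF that])
  qed
  obtain r where r: "r > 0" "cball x0 r \<subseteq> \<Omega>" "\<And>x. x \<in> cball x0 r \<Longrightarrow> L u x < L u x0 / 2"
  proof -
    have "isCont (L u) x0" using cL[OF u(2)] x0 unfolding continuous_on_eq_continuous_at[OF \<Omega>] by (rule bspec)
    then have "\<forall>\<^sub>F x in nhds x0. L u x < L u x0 / 2"
      using L0 by (intro order_tendstoD(2)[where y="L u x0"]) (auto simp: isCont_def tendsto_at_iff_tendsto_nhds)
    then obtain S where S: "open S" "x0 \<in> S" "\<And>x. x \<in> S \<Longrightarrow> L u x < L u x0 / 2" by (auto simp: eventually_nhds)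
    then have "open (S \<inter> \<Omega>)" "x0 \<in> S \<inter> \<Omega>" using \<Omega> x0 by auto
    then obtain r where "r > 0" "cball x0 r \<subseteq> S \<inter> \<Omega>" using open_contains_cball by blast
    then show ?thesis using that[of r] S(3) by blast
  qed
  define \<rho> where "\<rho> x = max 0 (r\<^sup>2 - (x - x0) \<bullet> (x - x0))" for x
  \<comment> \<open>The third power makes the bump twice continuously differentiable.\<close>
  define \<phi> where "\<phi> x = \<rho> x ^ 3" for x
  define G where "G x = - (2 * real 3 * \<rho> x ^ 2) *\<^sub>R (x - x0)" for x
  define D where "D x = (\<chi> i j. 24 * \<rho> x * (x - x0) $ i * (x - x0) $ j - (if i = j then 6 * \<rho> x ^ 2 else 0))" for x
  have c\<rho>: "continuous_on S \<rho>" for S unfolding \<rho>_def by (intro continuous_intros)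
  have \<rho>0: "\<rho> x = 0" if "x \<notin> cball x0 r" for x
  proof -
    have "x \<notin> ball x0 r" using that ball_subset_cball by blast
    then have "\<not> r\<^sup>2 - (x - x0) \<bullet> (x - x0) > 0" using mem_ball_inner_iff r(1) by blast
    then show ?thesis by (simp add: \<rho>_def max_def)
  qed
  have \<rho>nn: "\<rho> x \<ge> 0" for x by (simp add: \<rho>_def)
  have d\<phi>: "(\<phi> has_derivative (\<lambda>h. G x \<bullet> h)) (at x)" for x
    unfolding \<phi>_def G_def \<rho>_def using bump_has_derivative[of 3 r x0 x] by simp
  have dG: "(G has_derivative (\<lambda>h. D x *v h)) (at x)" for x
  proof -
    have "((\<lambda>x. \<rho> x ^ 2) has_derivative (\<lambda>h. (- (2 * real 2 * \<rho> x ^ (2 - 1)) *\<^sub>R (x - x0)) \<bullet> h)) (at x)"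
      unfolding \<rho>_def by (rule bump_has_derivative) simp
    then have "((\<lambda>x. - (2 * real 3 * \<rho> x ^ 2)) has_derivative (\<lambda>h. - (2 * real 3 * ((- (2 * real 2 * \<rho> x ^ (2 - 1)) *\<^sub>R (x - x0)) \<bullet> h)))) (at x)"
      by (intro has_derivative_minus has_derivative_mult_right)
    moreover have "((\<lambda>x. x - x0) has_derivative (\<lambda>h. h)) (at x)"
      using has_derivative_diff[OF has_derivative_ident has_derivative_const[of x0]] by simp
    ultimately have "(G has_derivative (\<lambda>h. (- (2 * real 3 * \<rho> x ^ 2)) *\<^sub>R h + (- (2 * real 3 * ((- (2 * real 2 * \<rho> x ^ (2 - 1)) *\<^sub>R (x - x0)) \<bullet> h))) *\<^sub>R (x - x0))) (at x)"
      unfolding G_def by (rule has_derivative_scaleR)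
    moreover have "(- (2 * real 3 * \<rho> x ^ 2)) *\<^sub>R h + (- (2 * real 3 * ((- (2 * real 2 * \<rho> x ^ (2 - 1)) *\<^sub>R (x - x0)) \<bullet> h))) *\<^sub>R (x - x0) = D x *v h" for h
    proof -
      have "(D x *v h) $ i = (\<Sum>j\<in>UNIV. 24 * \<rho> x * (x - x0) $ i * ((x - x0) $ j * h $ j) - (if i = j then 6 * \<rho> x ^ 2 * h $ j else 0))" for i
        unfolding matrix_vector_mult_def D_def by (auto intro!: sum.cong simp: algebra_simps)
      then have "(D x *v h) $ i = 24 * \<rho> x * (x - x0) $ i * ((x - x0) \<bullet> h) - 6 * \<rho> x ^ 2 * h $ i" for i
        by (simp add: sum_subtractf sum_distrib_left[symmetric] inner_vec_def)
      then show ?thesis by (simp add: vec_eq_iff algebra_simps)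
    qed
    ultimately show ?thesis by simp
  qed
  have cDc: "continuous_on UNIV (\<lambda>x. D x $ i $ j)" for i j
    unfolding D_def by (cases "i = j") (auto intro!: continuous_intros c\<rho>)
  define q where "q x = (\<Sum>i\<in>UNIV. \<Sum>j\<in>UNIV. B $ i $ j * D x $ i $ j) + c * (p \<bullet> G x) + e * \<phi> x" for x
  have K: "compact (cball x0 r)" by simp
  have \<phi>0: "\<phi> x = 0" and G0: "G x = 0" if "x \<notin> cball x0 r" for x using \<rho>0[OF that] by (simp_all add: \<phi>_def G_def)
  have D0: "D x = 0" if "x \<notin> cball x0 r" for x using \<rho>0[OF that] by (simp add: D_def vec_eq_iff)
  have adj: "(LINT x:\<Omega>|lborel. \<phi> x * L w x) = (LINT x:\<Omega>|lborel. w x * q x)"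
    if "w \<in> C2_on \<Omega>" for w
    unfolding L_def q_def by (rule second_order_operator_adjoint(1)[OF that \<Omega> K r(2) d\<phi> dG cDc \<phi>0 G0])
  have adj2: "set_integrable lborel \<Omega> (\<lambda>x. \<phi> x * L w x)" if "w \<in> C2_on \<Omega>" for w
    unfolding L_def by (rule second_order_operator_adjoint(2)[OF that \<Omega> K r(2) d\<phi> dG cDc \<phi>0 G0])
  obtain w where w: "\<And>m. w m \<in> Phi_tilde k \<Omega>" "L1_loc_tendsto \<Omega> w u" using u(1) by (auto simp: Phi_def)
  have wC: "w m \<in> C2_on \<Omega>" for m using w(1)[of m] by (simp add: Phi_tilde_def)
  have "(\<lambda>m. LINT x:\<Omega>|lborel. w m x * q x) \<longlonglongrightarrow> (LINT x:\<Omega>|lborel. u x * q x)"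
  proof (rule L1_limit_integral[OF \<Omega> K r(2)])
    show "continuous_on \<Omega> q" unfolding q_def G_def \<phi>_def
      by (intro continuous_intros c\<rho> continuous_on_subset[OF cDc]) auto
    show "q x = 0" if "x \<in> \<Omega> - cball x0 r" for x using that \<phi>0[of x] G0[of x] D0[of x] by (simp add: q_def)
  qed (use C2_on_continuous(1) wC u(2) w(2) in auto)
  moreover have "(LINT x:\<Omega>|lborel. w m x * q x) \<ge> 0" for m
    unfolding adj[OF wC, of m, symmetric] unfolding set_lebesgue_integral_def
    using Lnn[OF w(1)] \<rho>nn by (intro Bochner_Integration.integral_nonneg) (auto simp: indicator_def \<phi>_def)
  ultimately have "(LINT x:\<Omega>|lborel. u x * q x) \<ge> 0" by (blast intro: LIMSEQ_le_const)
  then have nn: "(LINT x:\<Omega>|lborel. \<phi> x * L u x) \<ge> 0" unfolding adj[OF u(2)] .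
  have "(LINT x|lborel. - (indicator \<Omega> x *\<^sub>R (\<phi> x * L u x))) > 0"
  proof (rule integral_pos_of_ball[of "r/2" _ "(r\<^sup>2 / 2) ^ 3 * (- L u x0 / 2)" x0])
    show "integrable lborel (\<lambda>x. - (indicator \<Omega> x *\<^sub>R (\<phi> x * L u x)))"
      using adj2[OF u(2)] by (simp add: set_integrable_def)
    have neg: "L u x < 0" if "x \<in> cball x0 r" for x using r(3)[OF that] L0 by simp
    show "0 \<le> - (indicator \<Omega> x *\<^sub>R (\<phi> x * L u x))" for x
      using neg[of x] \<phi>0[of x] \<rho>nn[of x] by (cases "x \<in> cball x0 r") (auto simp: indicator_def \<phi>_def mult_nonneg_nonpos)
  next
    fix x assume x: "x \<in> ball x0 (r/2)"
    then have x': "x \<in> cball x0 r" using r(1) by (auto)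
    have "(x - x0) \<bullet> (x - x0) < (r/2)\<^sup>2" using x mem_ball_inner_iff[of x x0 "r/2"] by simp
    then have "r\<^sup>2 / 2 \<le> r\<^sup>2 - (x - x0) \<bullet> (x - x0)"
    proof -
      assume a: "(x - x0) \<bullet> (x - x0) < (r / 2)\<^sup>2"
      have "(r / 2)\<^sup>2 = r\<^sup>2 / 4" by (simp add: power_divide)
      then show ?thesis using a inner_ge_zero[of "x - x0"] by linarith
    qed
    then have "\<rho> x \<ge> r\<^sup>2 / 2" unfolding \<rho>_def by (rule order_trans[OF _ max.cobounded2])
    then have "\<phi> x \<ge> (r\<^sup>2 / 2) ^ 3" unfolding \<phi>_def by (intro power_mono) auto
    then have "(r\<^sup>2 / 2) ^ 3 * (- L u x0 / 2) \<le> \<phi> x * (- L u x)"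
      using r(3)[OF x'] L0 by (intro mult_mono) (auto simp: \<phi>_def \<rho>nn)
    then show "(r\<^sup>2 / 2) ^ 3 * (- L u x0 / 2) \<le> - (indicator \<Omega> x *\<^sub>R (\<phi> x * L u x))"
      using x' r(2) by (auto simp: indicator_def)
  next
    show "(r\<^sup>2 / 2) ^ 3 * (- L u x0 / 2) > 0" using r(1) L0 by (intro mult_pos_pos zero_less_power) auto
  qed (use r(1) in auto)
  then show False using nn by (simp add: set_lebesgue_integral_def)
qed

section \<open>The integrand as a polynomial in the Hessian\<close>

text \<open>
  With \<open>eco\<close>, the coefficients \<open>d\<^sub>j\<close> and
  \<open>e\<^sub>j\<close> of the integrand as a polynomial in the Hessian; what the variation
  uses of them is the recursion \<open>dco_rec\<close>.
\<close>
definition dco :: "real \<Rightarrow> nat \<Rightarrow> nat \<Rightarrow> real" where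
  "dco \<alpha> k j = pochhammer (\<alpha> + real j + 1) (k - j) / (2 ^ (k - j) * fact (k - j))"

definition eco :: "real \<Rightarrow> nat \<Rightarrow> nat \<Rightarrow> real" where
  "eco \<alpha> k j = (2 * real k - real j) * dco \<alpha> k j"

lemma dco_rec:
  assumes "j < k"
  shows "(\<alpha> + real j + 1) * dco \<alpha> k (Suc j) = 2 * (real k - real j) * dco \<alpha> k j"
proof -
  obtain m where m: "k = Suc (j + m)" using assms less_iff_Suc_add by auto
  define P where "P = pochhammer (\<alpha> + real j + 1 + 1) m"
  have 1: "pochhammer (\<alpha> + real j + 1) (Suc m) = (\<alpha> + real j + 1) * P"
    unfolding P_def by (rule pochhammer_rec)
  have j1: "\<alpha> + real (Suc j) + 1 = \<alpha> + real j + 1 + 1" by simp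
  have k: "k - Suc j = m" "k - j = Suc m" "real k - real j = real (Suc m)" by (simp_all add: m)
  have 2: "dco \<alpha> k (Suc j) = P / (2 ^ m * fact m)" unfolding dco_def j1 k P_def ..
  have 3: "dco \<alpha> k j = (\<alpha> + real j + 1) * P / (2 * 2 ^ m * (real (Suc m) * fact m))"
    unfolding dco_def k 1 by simp
  show ?thesis unfolding 2 3 k(3) by (simp add: divide_simps del: of_nat_Suc)
qed

lemma gbinomial_neg: "(- a) gchoose l = (- 1) ^ l * (pochhammer a l / fact l)" for a :: real
  by (simp add: gbinomial_pochhammer)

text \<open>
  The Chu--Vandermonde convolution, rewritten with \<open>(-a choose l) = (-1)\<^sup>l
  (a)\<^sub>l / l!\<close>.
\<close>
lemma vandermonde_poch:
  fixes a :: real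
  shows "(\<Sum>l\<le>N. (- 1) ^ (N - l) * (M gchoose (N - l)) * (pochhammer a l / fact l)) = pochhammer (a - M) N / fact N"
proof -
  have "(\<Sum>l\<le>N. (- 1) ^ (N - l) * (M gchoose (N - l)) * (pochhammer a l / fact l)) =
    (\<Sum>l\<le>N. (- 1) ^ N * (((- a) gchoose l) * (M gchoose (N - l))))"
  proof (intro sum.cong refl)
    fix l assume "l \<in> {..N}"
    then have "(- 1::real) ^ N = (- 1) ^ (N - l) * (- 1) ^ l" by (simp add: power_add[symmetric])
    then show "(- 1) ^ (N - l) * (M gchoose (N - l)) * (pochhammer a l / fact l) = (- 1) ^ N * (((- a) gchoose l) * (M gchoose (N - l)))"
      by (simp add: gbinomial_neg power_mult_distrib[symmetric])
  qed
  also have "\<dots> = (- 1) ^ N * ((- a + M) gchoose N)"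
    by (simp add: sum_distrib_left[symmetric] gbinomial_Vandermonde atMost_atLeast0)
  also have "- a + M = - (a - M)" by simp
  also have "(- 1) ^ N * ((- (a - M)) gchoose N) = pochhammer (a - M) N / fact N"
    unfolding gbinomial_neg by (simp add: power_mult_distrib[symmetric] mult.assoc[symmetric])
  finally show ?thesis .
qed

text \<open>
  With \<open>a = \<alpha> + n\<close> the bracket in the definition of \<open>b\<^sub>l\<close>
  is \<open>k a + l (\<alpha> + 2 k)\<close>; dividing by \<open>\<Gamma>(a + 1)\<close> leaves
  two rising factorials, one for each summand, to which the Vandermonde identity applies.
\<close>
lemma b_coeff_alt:
  assumes "\<alpha> \<ge> 0" "n \<ge> 1"
  shows "2 ^ l * b_coeff \<alpha> n k l = real k * (pochhammer (\<alpha> + real n) l / fact l) +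
    (\<alpha> + 2 * real k) * (if l = 0 then 0 else pochhammer (\<alpha> + real n + 1) (l - 1) / fact (l - 1))"
proof -
  define a where "a = \<alpha> + real n"
  have a: "a > 0" using assms by (simp add: a_def)
  have G: "Gamma a > 0" using a by (rule Gamma_real_pos)
  have "a \<notin> \<int>\<^sub>\<le>\<^sub>0" using a by (auto elim!: nonpos_Ints_cases)
  then have p: "Gamma (a + real l) = pochhammer a l * Gamma a" "Gamma (a + 1) = a * Gamma a"
    using pochhammer_Gamma[of a l] Gamma_plus1[of a] G by (simp_all add: field_simps)
  have "2 ^ l * b_coeff \<alpha> n k l = (real k * a + real l * (\<alpha> + 2 * real k)) * (pochhammer a l / (fact l * a))"
  proof -
    have 1: "gfact (\<alpha> + real n + real l - 1) = pochhammer a l * Gamma a" "gfact (\<alpha> + real n) = a * Gamma a"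
      unfolding gfact_def using p by (simp_all add: a_def)
    have 2: "(real k + real l) * \<alpha> + real k * real n + 2 * real k * real l = real k * a + real l * (\<alpha> + 2 * real k)"
      by (simp add: a_def algebra_simps)
    have "Gamma a \<noteq> 0" using G by linarith
    then show ?thesis unfolding b_coeff_def 1 2 using a by simp
  qed
  also have "\<dots> = real k * (pochhammer a l / fact l) + (\<alpha> + 2 * real k) * (real l * pochhammer a l / (fact l * a))"
    using a by (simp add: field_simps)
  also have "real l * pochhammer a l / (fact l * a) = (if l = 0 then 0 else pochhammer (a + 1) (l - 1) / fact (l - 1))"
    using a by (cases l) (simp_all add: pochhammer_rec field_simps del: of_nat_Suc)
  finally show ?thesis by (simp add: a_def)
qed

text \<open>
  By \<open>b_coeff_alt\<close> the sum splits into two Vandermonde convolutions, in which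
  \<open>\<alpha> + n\<close> is lowered to \<open>\<alpha> + j\<close>; their combination
  factors as \<open>(2 k - j) (\<alpha> + k)\<close> times a common rising factorial.
\<close>
lemma coefficient_identity:
  assumes "\<alpha> \<ge> 0" "n \<ge> 1" "j \<le> k" "k \<le> n"
  shows "(\<Sum>l\<le>k - j. b_coeff \<alpha> n k l * (real ((n - j) choose (k - l - j)) * (- 1 / 2) ^ (k - l - j))) = eco \<alpha> k j"
proof -
  define N where "N = k - j"
  define M where "M = real (n - j)"
  have a: "\<alpha> + real n - M = \<alpha> + real j" using assms by (simp add: M_def of_nat_diff)
  have term_eq: "b_coeff \<alpha> n k l * (real ((n - j) choose (k - l - j)) * (- 1 / 2) ^ (k - l - j)) =
    (1 / 2 ^ N) * ((- 1) ^ (N - l) * (M gchoose (N - l)) * (2 ^ l * b_coeff \<alpha> n k l))" if "l \<le> N" for l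
  proof -
    have 1: "k - l - j = N - l" by (simp add: N_def)
    have 2: "real ((n - j) choose (N - l)) = M gchoose (N - l)" by (simp add: M_def binomial_gbinomial)
    have "(2::real) ^ N = 2 ^ (N - l) * 2 ^ l" using that by (simp add: power_add[symmetric])
    moreover have "(- 1 / 2 :: real) ^ (N - l) = (- 1) ^ (N - l) / 2 ^ (N - l)" by (rule power_divide)
    ultimately have 3: "(- 1 / 2 :: real) ^ (N - l) = (- 1) ^ (N - l) * (2 ^ l / 2 ^ N)" by (simp only:) simp
    show ?thesis unfolding 1 2 3 by simp
  qed
  have "(\<Sum>l\<le>N. b_coeff \<alpha> n k l * (real ((n - j) choose (k - l - j)) * (- 1 / 2) ^ (k - l - j))) =
    (\<Sum>l\<le>N. (1 / 2 ^ N) * ((- 1) ^ (N - l) * (M gchoose (N - l)) * (2 ^ l * b_coeff \<alpha> n k l)))"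
    by (intro sum.cong refl term_eq) simp
  also have "\<dots> = (1 / 2 ^ N) * (real k * (\<Sum>l\<le>N. (- 1) ^ (N - l) * (M gchoose (N - l)) * (pochhammer (\<alpha> + real n) l / fact l)) +
      (\<alpha> + 2 * real k) * (\<Sum>l\<le>N. (- 1) ^ (N - l) * (M gchoose (N - l)) * (if l = 0 then 0 else pochhammer (\<alpha> + real n + 1) (l - 1) / fact (l - 1))))"
    unfolding b_coeff_alt[OF assms(1,2)] sum_distrib_left[symmetric] distrib_left sum.distrib
    by (simp only: sum_distrib_left mult_ac)
  also have "(\<Sum>l\<le>N. (- 1) ^ (N - l) * (M gchoose (N - l)) * (pochhammer (\<alpha> + real n) l / fact l)) = pochhammer (\<alpha> + real j) N / fact N"
    unfolding vandermonde_poch a ..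
  also have "(\<Sum>l\<le>N. (- 1) ^ (N - l) * (M gchoose (N - l)) * (if l = 0 then 0 else pochhammer (\<alpha> + real n + 1) (l - 1) / fact (l - 1)))
    = (if N = 0 then 0 else pochhammer (\<alpha> + real j + 1) (N - 1) / fact (N - 1))"
  proof (cases N)
    case (Suc m)
    have a': "\<alpha> + real n + 1 - M = \<alpha> + real j + 1" using a by simp
    show ?thesis unfolding Suc
      using vandermonde_poch[where a="\<alpha> + real n + 1" and N=m and M=M] a'
      by (subst sum.atMost_Suc_shift) simp
  qed simp
  also have "(1 / 2 ^ N) * (real k * (pochhammer (\<alpha> + real j) N / fact N) + (\<alpha> + 2 * real k) * (if N = 0 then 0 else pochhammer (\<alpha> + real j + 1) (N - 1) / fact (N - 1))) = eco \<alpha> k j"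
  proof (cases N)
    case 0
    then have "k = j" using assms(3) by (simp add: N_def)
    then show ?thesis by (simp add: eco_def dco_def N_def)
  next
    case (Suc m)
    then have k: "real k = real j + real m + 1" using assms(3) by (simp add: N_def)
    define P where "P = pochhammer (\<alpha> + real j + 1) m"
    have p1: "pochhammer (\<alpha> + real j) (Suc m) = (\<alpha> + real j) * P" by (simp add: pochhammer_rec P_def)
    have p2: "pochhammer (\<alpha> + real j + 1) (Suc m) = P * (\<alpha> + real j + 1 + real m)" by (simp add: pochhammer_Suc P_def)
    have "real k * ((\<alpha> + real j) * P / fact (Suc m)) + (\<alpha> + 2 * real k) * (P / fact m) =
      (real k * (\<alpha> + real j) + (\<alpha> + 2 * real k) * real (Suc m)) * (P / fact (Suc m))"
    proof -
      define Y where "Y = P / fact (Suc m)"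
      have y: "P / fact m = real (Suc m) * Y" by (simp add: Y_def del: of_nat_Suc)
      have y': "(\<alpha> + real j) * P / fact (Suc m) = (\<alpha> + real j) * Y" by (simp add: Y_def)
      show ?thesis unfolding y y' Y_def[symmetric] by (simp add: algebra_simps)
    qed
    also have "real k * (\<alpha> + real j) + (\<alpha> + 2 * real k) * real (Suc m) = (2 * real k - real j) * (\<alpha> + real j + 1 + real m)"
      unfolding k by (simp add: algebra_simps)
    finally have F: "real k * ((\<alpha> + real j) * P / fact (Suc m)) + (\<alpha> + 2 * real k) * (P / fact m) =
      (2 * real k - real j) * (\<alpha> + real j + 1 + real m) * (P / fact (Suc m))" .
    have pp: "(if Suc m = 0 then 0 else pochhammer (\<alpha> + real j + 1) (Suc m - 1) / fact (Suc m - 1)) = P / fact m"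
      by (simp add: P_def)
    show ?thesis
      unfolding eco_def dco_def N_def[symmetric] Suc p1 p2 pp F by (simp only: times_divide_eq_right times_divide_eq_left divide_divide_eq_left mult_1_left mult_ac)
  qed
  finally show ?thesis by (simp add: N_def)
qed

lemma b_coeff_nonneg:
  assumes "\<alpha> \<ge> 0" "n \<ge> 1"
  shows "b_coeff \<alpha> n k l \<ge> 0"
  unfolding b_coeff_def gfact_def using assms
  by (intro mult_nonneg_nonneg divide_nonneg_nonneg add_nonneg_nonneg less_imp_le[OF Gamma_real_pos]) auto

text \<open>
  The polynomial form of the integrand, at a point where the function has the value
  \<open>s\<close>, the square of the length of its gradient is \<open>q\<close> and its Hessian
  is \<open>H\<close>.
\<close>
definition integrand :: "real \<Rightarrow> nat \<Rightarrow> real \<Rightarrow> real \<Rightarrow> real^'n^'n \<Rightarrow> real" where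
  "integrand \<alpha> k s q H = (\<Sum>j\<le>k. eco \<alpha> k j * s powr (\<alpha> + real j) * q ^ (k - j) * msig j H)"

text \<open>
  Expand every \<open>\<sigma>\<^sub>k\<^sub>-\<^sub>l\<close> by \<open>msig_shift\<close>,
  exchange the summations, and collect the coefficient of \<open>\<sigma>\<^sub>j(H)\<close>
  with \<open>coefficient_identity\<close>.
\<close>
lemma weighted_sum_eq_integrand:
  fixes H :: "real^'n^'n"
  assumes "\<alpha> \<ge> 0" "k \<le> CARD('n)" "s > 0"
  shows "(\<Sum>l=0..k. b_coeff \<alpha> CARD('n) k l * s powr \<alpha> * q ^ l * msig (k - l) (s *\<^sub>R H - (q / 2) *\<^sub>R mat 1)) = integrand \<alpha> k s q H"
proof -
  let ?n = "CARD('n)"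
  have n1: "?n \<ge> 1" using zero_less_card_finite[where 'a='n] by linarith
  have ms: "msig m (s *\<^sub>R H - (q / 2) *\<^sub>R mat 1) = (\<Sum>j\<le>m. real ((?n - j) choose (m - j)) * s ^ j * (- q / 2) ^ (m - j) * msig j H)"
    if "m \<le> k" for m
  proof -
    have "s *\<^sub>R H - (q / 2) *\<^sub>R mat 1 = (\<chi> i j. s * H $ i $ j + (if i = j then - q / 2 else 0))"
      by (auto simp: vec_eq_iff mat_nth)
    then show ?thesis using msig_shift[of m s H "- q / 2"] that assms(2) by simp
  qed
  have "(\<Sum>l=0..k. b_coeff \<alpha> ?n k l * s powr \<alpha> * q ^ l * msig (k - l) (s *\<^sub>R H - (q / 2) *\<^sub>R mat 1))
    = (\<Sum>l\<le>k. \<Sum>j\<le>k - l. b_coeff \<alpha> ?n k l * s powr \<alpha> * q ^ l * (real ((?n - j) choose (k - l - j)) * s ^ j * (- q / 2) ^ (k - l - j) * msig j H))"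
    unfolding atMost_atLeast0[symmetric] by (intro sum.cong refl) (simp add: ms sum_distrib_left)
  also have "\<dots> = (\<Sum>j\<le>k. \<Sum>l\<le>k - j. b_coeff \<alpha> ?n k l * s powr \<alpha> * q ^ l * (real ((?n - j) choose (k - l - j)) * s ^ j * (- q / 2) ^ (k - l - j) * msig j H))"
  proof -
    have *: "{..k - l} = {j\<in>{..k}. j + l \<le> k}" if "l \<in> {..k}" for l using that by auto
    have **: "{..k - j} = {l\<in>{..k}. j + l \<le> k}" if "j \<in> {..k}" for j using that by auto
    have sw: "(\<Sum>l\<le>k. \<Sum>j\<le>k - l. f l j) = (\<Sum>j\<le>k. \<Sum>l\<le>k - j. f l j)" for f :: "nat \<Rightarrow> nat \<Rightarrow> real"
    proof -
      have "(\<Sum>l\<le>k. \<Sum>j\<le>k - l. f l j) = (\<Sum>l\<le>k. \<Sum>j | j \<in> {..k} \<and> j + l \<le> k. f l j)"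
        by (rule sum.cong[OF refl]) (simp only: *)
      also have "\<dots> = (\<Sum>j\<le>k. \<Sum>l | l \<in> {..k} \<and> j + l \<le> k. f l j)"
        by (rule sum.swap_restrict) simp_all
      also have "\<dots> = (\<Sum>j\<le>k. \<Sum>l\<le>k - j. f l j)"
        by (rule sum.cong[OF refl]) (simp only: **)
      finally show ?thesis .
    qed
    show ?thesis by (rule sw)
  qed
  also have "\<dots> = (\<Sum>j\<le>k. s powr (\<alpha> + real j) * q ^ (k - j) * msig j H * (\<Sum>l\<le>k - j. b_coeff \<alpha> ?n k l * (real ((?n - j) choose (k - l - j)) * (- 1 / 2) ^ (k - l - j))))"
  proof (intro sum.cong[OF refl])
    fix j assume j: "j \<in> {..k}"
    have "b_coeff \<alpha> ?n k l * s powr \<alpha> * q ^ l * (real ((?n - j) choose (k - l - j)) * s ^ j * (- q / 2) ^ (k - l - j) * msig j H) =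
      s powr (\<alpha> + real j) * q ^ (k - j) * msig j H * (b_coeff \<alpha> ?n k l * (real ((?n - j) choose (k - l - j)) * (- 1 / 2) ^ (k - l - j)))" if l: "l \<le> k - j" for l
    proof -
      have 1: "s powr (\<alpha> + real j) = s powr \<alpha> * s ^ j" using assms(3) by (simp add: powr_add powr_realpow)
      have "k - j = l + (k - l - j)" using l by simp
      then have 2: "q ^ (k - j) = q ^ l * q ^ (k - l - j)" by (metis power_add)
      have 3: "(- q / 2) ^ (k - l - j) = q ^ (k - l - j) * (- 1 / 2) ^ (k - l - j)"
        by (simp add: power_mult_distrib[symmetric])
      show ?thesis unfolding 1 2 3 by (simp only: mult_ac)
    qed
    then show "(\<Sum>l\<le>k - j. b_coeff \<alpha> ?n k l * s powr \<alpha> * q ^ l * (real ((?n - j) choose (k - l - j)) * s ^ j * (- q / 2) ^ (k - l - j) * msig j H)) =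
      s powr (\<alpha> + real j) * q ^ (k - j) * msig j H * (\<Sum>l\<le>k - j. b_coeff \<alpha> ?n k l * (real ((?n - j) choose (k - l - j)) * (- 1 / 2) ^ (k - l - j)))"
      by (simp only: sum_distrib_left) (intro sum.cong refl, simp)
  qed
  also have "\<dots> = integrand \<alpha> k s q H"
    unfolding integrand_def using coefficient_identity[OF assms(1) n1 _ assms(2)]
    by (intro sum.cong refl) (simp add: mult_ac)
  finally show ?thesis .
qed

section \<open>First variation\<close>

text \<open>
  The derivative of \<open>integrand\<close> when the value, the gradient and the Hessian move
  in the directions \<open>\<phi>\<close>, \<open>\<pi>\<close> and \<open>\<Phi>\<close>; see
  \<open>integrand_line_deriv\<close>. The division by \<open>s\<close> in place of a lower
  exponent keeps all powers of \<open>s\<close> in one shape.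
\<close>
definition integrand_deriv :: "real \<Rightarrow> nat \<Rightarrow> real \<Rightarrow> real^'n \<Rightarrow> real^'n^'n \<Rightarrow> real \<Rightarrow> real^'n \<Rightarrow> real^'n^'n \<Rightarrow> real" where
  "integrand_deriv \<alpha> k s p H \<phi> \<pi> \<Phi> = (\<Sum>j\<le>k. eco \<alpha> k j *
     ((\<alpha> + real j) * (s powr (\<alpha> + real j) / s) * \<phi> * (p \<bullet> p) ^ (k - j) * msig j H
      + s powr (\<alpha> + real j) * (real (k - j) * (p \<bullet> p) ^ (k - j - 1) * (2 * (p \<bullet> \<pi>)) * msig j H + (p \<bullet> p) ^ (k - j) * dsig j H \<Phi>)))"

text \<open>
  The form \<open>M\<close> that pairs the gradient of the variation with that of the test
  function.
\<close>
definition gradient_form :: "real \<Rightarrow> nat \<Rightarrow> real \<Rightarrow> real^'n \<Rightarrow> real^'n^'n \<Rightarrow> real^'n \<Rightarrow> real^'n \<Rightarrow> real" where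
  "gradient_form \<alpha> k s p H x y = (\<Sum>j\<le>k. eco \<alpha> k j * s powr (\<alpha> + real j) * (p \<bullet> p) ^ (k - j) * dsig j H (outer x y))"

text \<open>
  The form \<open>Z\<close> that pairs the variation itself with the gradient of the test
  function. Its summand for \<open>j = 0\<close> vanishes, so for \<open>\<alpha> \<ge>
  0\<close> the exponents of \<open>s\<close> that occur are nonnegative.
\<close>
definition drift_form :: "real \<Rightarrow> nat \<Rightarrow> real \<Rightarrow> real^'n \<Rightarrow> real^'n^'n \<Rightarrow> real^'n \<Rightarrow> real" where
  "drift_form \<alpha> k s p H y = (\<Sum>j\<le>k. dco \<alpha> k j * (\<alpha> + real j) * (s powr (\<alpha> + real j) / s) * (p \<bullet> p) ^ (k - j) * dsig j H (outer p y))"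

lemma telescope_zero:
  fixes a b :: "nat \<Rightarrow> real"
  assumes "\<And>j. j < k \<Longrightarrow> b j = a (Suc j)" "b k = 0" "a 0 = 0"
  shows "(\<Sum>j\<le>k. a j) = (\<Sum>j\<le>k. b j)"
proof -
  have "(\<Sum>j\<le>k. b j) = (\<Sum>j<k. a (Suc j))"
    using assms(1,2) by (simp add: lessThan_Suc_atMost[symmetric])
  also have "\<dots> = (\<Sum>j\<le>k. a j)"
    using assms(3) by (simp add: sum.atMost_shift)
  finally show ?thesis by simp
qed

lemma outer_add: "outer x (y + z) = outer x y + outer x (z::real^'n)"
  by (simp add: outer_def vec_eq_iff algebra_simps)

lemma dsig_outer_scale: "dsig j H (outer x (c *\<^sub>R y)) = c * dsig j H (outer x (y::real^'n))"
proof -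
  have "outer x (c *\<^sub>R y) = (\<chi> i l. c * outer x y $ i $ l)" by (simp add: outer_def vec_eq_iff)
  then show ?thesis by (simp only: dsig_scale)
qed

lemma dsig_scaleR: "dsig j H (c *\<^sub>R B) = c * dsig j H (B::real^'n^'n)"
proof -
  have "c *\<^sub>R B = (\<chi> i l. c * B $ i $ l)" by (simp add: vec_eq_iff)
  then show ?thesis by (simp only: dsig_scale)
qed

lemma dsig_outer_Suc:
  fixes H :: "real^'n^'n"
  assumes "transpose H = H"
  shows "dsig j H (outer x (H *v y)) = msig j H * (x \<bullet> y) - dsig (Suc j) H (outer x y)"
proof -
  have "y v* H = H *v y" using assms transpose_matrix_vector[of H y] by simp
  then show ?thesis using dsig_Suc_outer[of j H x y] by (simp add: inner_vec_def)
qed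

lemma dsig_outer_commute:
  fixes H :: "real^'n^'n"
  assumes "transpose H = H"
  shows "dsig j H (outer x y) = dsig j H (outer y x)"
  using dsig_transpose[of j H "outer x y"] by (simp add: assms outer_transpose)

text \<open>
  The pointwise algebra of the integration by parts. The left-hand side contracts the Newton
  tensors with the Jacobian matrix of the vector field \<open>\<psi> g\<^sub>j \<nabla>\<phi> +
  \<psi> h\<^sub>j \<phi> \<nabla>w\<close>, where \<open>\<kappa> = \<nabla>\<psi>\<close>; the
  recursion \<open>dsig_outer_Suc\<close> turns contractions with \<open>H p\<close> into the
  next index. The superfluous terms \<open>a1\<close>, \<open>b1\<close> and \<open>a2\<close>,
  \<open>b2\<close> then cancel by telescoping, which is where the recursion of the coefficients
  enters.
\<close>
lemma variation_algebra:
  fixes H \<Phi> :: "real^'n^'n" and p \<pi> \<kappa> :: "real^'n" and s \<alpha> \<phi> \<psi> :: real and k :: nat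
  assumes H: "transpose H = H" and s: "s > 0"
  defines "S \<equiv> \<lambda>j. s powr (\<alpha> + real j)" and "q \<equiv> p \<bullet> p"
  defines "g \<equiv> \<lambda>j. eco \<alpha> k j * S j * q ^ (k - j)"
    and "dg \<equiv> \<lambda>j. (eco \<alpha> k j * ((\<alpha> + real j) * (S j / s) * q ^ (k - j))) *\<^sub>R p
       + (eco \<alpha> k j * (S j * (real (k - j) * q ^ (k - j - 1) * 2))) *\<^sub>R (H *v p)"
    and "h \<equiv> \<lambda>j. dco \<alpha> k j * (\<alpha> + real j) * (S j / s) * q ^ (k - j)"
    and "dh \<equiv> \<lambda>j. (dco \<alpha> k j * (\<alpha> + real j) * ((\<alpha> + real j - 1) * (S j / s / s) * q ^ (k - j))) *\<^sub>R p
       + (dco \<alpha> k j * (\<alpha> + real j) * ((S j / s) * (real (k - j) * q ^ (k - j - 1) * 2))) *\<^sub>R (H *v p)"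
  shows "(\<Sum>j\<le>k. dsig j H (outer \<pi> (g j *\<^sub>R \<kappa> + \<psi> *\<^sub>R dg j) + (\<psi> * g j) *\<^sub>R \<Phi>
       + outer p ((h j * \<phi>) *\<^sub>R \<kappa> + \<psi> *\<^sub>R (h j *\<^sub>R \<pi> + \<phi> *\<^sub>R dh j)) + (\<psi> * (h j * \<phi>)) *\<^sub>R H))
    = \<psi> * integrand_deriv \<alpha> k s p H \<phi> \<pi> \<Phi> + (gradient_form \<alpha> k s p H \<pi> \<kappa> + \<phi> * drift_form \<alpha> k s p H \<kappa>)"
proof -
  define n where "n j = dsig j H (outer \<pi> p)" for j
  define r where "r j = dsig j H (outer p p)" for j
  define m where "m j = msig j H" for j
  have n': "dsig j H (outer p \<pi>) = n j" for j unfolding n_def by (rule dsig_outer_commute[OF H])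
  have nH: "dsig j H (outer \<pi> (H *v p)) = m j * (p \<bullet> \<pi>) - n (Suc j)" for j
    unfolding n_def m_def by (simp add: dsig_outer_Suc[OF H] inner_commute)
  have rH: "dsig j H (outer p (H *v p)) = m j * q - r (Suc j)" for j
    unfolding r_def m_def q_def by (simp add: dsig_outer_Suc[OF H])
  have S: "S (Suc j) = s * S j" for j
    using s unfolding S_def by (simp add: powr_add[symmetric] powr_mult_base add_ac)
  define a1 where "a1 j = (\<alpha> + real j) * ((2 * real k - real j + 1) * dco \<alpha> k j) * (S j / s) * q ^ (k - j) * n j" for j
  define b1 where "b1 j = eco \<alpha> k j * (S j * (real (k - j) * q ^ (k - j - 1) * 2)) * n (Suc j)" for j
  have t1: "(\<Sum>j\<le>k. a1 j) = (\<Sum>j\<le>k. b1 j)"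
  proof (rule telescope_zero)
    fix j assume j: "j < k"
    have rk: "real (k - j) = real k - real j" using j by simp
    have "a1 (Suc j) = ((\<alpha> + real j + 1) * dco \<alpha> k (Suc j)) * ((2 * real k - real j) * S j * q ^ (k - Suc j) * n (Suc j))"
      unfolding a1_def S using s by (simp add: field_simps)
    also have "\<dots> = b1 j" unfolding dco_rec[OF j] b1_def eco_def rk by (simp add: mult_ac)
    finally show "b1 j = a1 (Suc j)" ..
  qed (simp_all add: a1_def b1_def n_def)
  define a2 where "a2 j = dco \<alpha> k j * (\<alpha> + real j) * ((\<alpha> + real j - 1) * (S j / s / s) * q ^ (k - j)) * r j" for j
  define b2 where "b2 j = dco \<alpha> k j * (\<alpha> + real j) * ((S j / s) * (real (k - j) * q ^ (k - j - 1) * 2)) * r (Suc j)" for j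
  have t2: "(\<Sum>j\<le>k. a2 j) = (\<Sum>j\<le>k. b2 j)"
  proof (rule telescope_zero)
    fix j assume j: "j < k"
    have rk: "real (k - j) = real k - real j" using j by simp
    have "a2 (Suc j) = ((\<alpha> + real j + 1) * dco \<alpha> k (Suc j)) * ((\<alpha> + real j) * (S j / s) * q ^ (k - Suc j) * r (Suc j))"
      unfolding a2_def S using s by (simp add: field_simps)
    also have "\<dots> = b2 j" unfolding dco_rec[OF j] b2_def rk by (simp add: mult_ac)
    finally show "b2 j = a2 (Suc j)" ..
  qed (simp_all add: a2_def b2_def r_def)
  have qq: "real (k - j) * q ^ (k - j - 1) * q = real (k - j) * q ^ (k - j)" for j
    by (cases "k - j") simp_all
  have t: "dsig j H (outer \<pi> (g j *\<^sub>R \<kappa> + \<psi> *\<^sub>R dg j) + (\<psi> * g j) *\<^sub>R \<Phi>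
       + outer p ((h j * \<phi>) *\<^sub>R \<kappa> + \<psi> *\<^sub>R (h j *\<^sub>R \<pi> + \<phi> *\<^sub>R dh j)) + (\<psi> * (h j * \<phi>)) *\<^sub>R H) =
     \<psi> * (eco \<alpha> k j * ((\<alpha> + real j) * (S j / s) * \<phi> * q ^ (k - j) * msig j H
      + S j * (real (k - j) * q ^ (k - j - 1) * (2 * (p \<bullet> \<pi>)) * msig j H + q ^ (k - j) * dsig j H \<Phi>)))
     + (eco \<alpha> k j * S j * q ^ (k - j) * dsig j H (outer \<pi> \<kappa>) + \<phi> * (dco \<alpha> k j * (\<alpha> + real j) * (S j / s) * q ^ (k - j) * dsig j H (outer p \<kappa>)))
     + \<psi> * (a1 j - b1 j) + \<psi> * \<phi> * (a2 j - b2 j)" if j: "j \<le> k" for j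
  proof -
    have rk: "real (k - j) = real k - real j" using j by simp
    have e: "eco \<alpha> k j = (2 * real k - real j) * dco \<alpha> k j" by (simp add: eco_def)
    define Q where "Q = q ^ (k - j)"
    define Q1 where "Q1 = real (k - j) * q ^ (k - j - 1)"
    have Qq: "Q1 * q = (real k - real j) * Q" using qq[of j] unfolding Q_def Q1_def rk .
    have L: "dsig j H (outer \<pi> (g j *\<^sub>R \<kappa> + \<psi> *\<^sub>R dg j) + (\<psi> * g j) *\<^sub>R \<Phi>
       + outer p ((h j * \<phi>) *\<^sub>R \<kappa> + \<psi> *\<^sub>R (h j *\<^sub>R \<pi> + \<phi> *\<^sub>R dh j)) + (\<psi> * (h j * \<phi>)) *\<^sub>R H) =
      g j * dsig j H (outer \<pi> \<kappa>) + \<psi> * (eco \<alpha> k j * ((\<alpha> + real j) * (S j / s) * Q) * n j + eco \<alpha> k j * (S j * (Q1 * 2)) * (m j * (p \<bullet> \<pi>) - n (Suc j)))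
      + \<psi> * g j * dsig j H \<Phi> + h j * \<phi> * dsig j H (outer p \<kappa>)
      + \<psi> * (h j * n j + \<phi> * (dco \<alpha> k j * (\<alpha> + real j) * ((\<alpha> + real j - 1) * (S j / s / s) * Q) * r j + dco \<alpha> k j * (\<alpha> + real j) * ((S j / s) * (Q1 * 2)) * (m j * q - r (Suc j))))
      + \<psi> * (h j * \<phi>) * (real j * m j)"
      unfolding dg_def dh_def Q_def[symmetric] Q1_def[symmetric]
      by (simp only: dsig_add outer_add dsig_outer_scale dsig_scaleR scaleR_add_right nH rH n' dsig_self n_def[symmetric] r_def[symmetric] m_def[symmetric] of_nat_id)
        (simp only: distrib_left add.assoc)
    have R: "(m j * q - r (Suc j)) * Q1 = m j * ((real k - real j) * Q) - r (Suc j) * Q1"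
      unfolding Qq[symmetric] by (simp add: algebra_simps)
    have R': "dco \<alpha> k j * (\<alpha> + real j) * ((S j / s) * (Q1 * 2)) * (m j * q - r (Suc j)) =
       dco \<alpha> k j * (\<alpha> + real j) * ((S j / s) * 2) * (m j * ((real k - real j) * Q) - r (Suc j) * Q1)"
      unfolding R[symmetric] by (simp only: mult_ac)
    show ?thesis
      unfolding L unfolding R' unfolding g_def h_def a1_def a2_def b1_def b2_def m_def[symmetric] Q_def[symmetric] Q1_def[symmetric] e
      by (simp add: algebra_simps add_divide_distrib diff_divide_distrib)
  qed
  have "(\<Sum>j\<le>k. dsig j H (outer \<pi> (g j *\<^sub>R \<kappa> + \<psi> *\<^sub>R dg j) + (\<psi> * g j) *\<^sub>R \<Phi>
       + outer p ((h j * \<phi>) *\<^sub>R \<kappa> + \<psi> *\<^sub>R (h j *\<^sub>R \<pi> + \<phi> *\<^sub>R dh j)) + (\<psi> * (h j * \<phi>)) *\<^sub>R H))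
    = \<psi> * integrand_deriv \<alpha> k s p H \<phi> \<pi> \<Phi> + (gradient_form \<alpha> k s p H \<pi> \<kappa> + \<phi> * drift_form \<alpha> k s p H \<kappa>)
      + \<psi> * ((\<Sum>j\<le>k. a1 j) - (\<Sum>j\<le>k. b1 j)) + \<psi> * \<phi> * ((\<Sum>j\<le>k. a2 j) - (\<Sum>j\<le>k. b2 j))"
    by (subst sum.cong[OF refl t])
      (simp_all only: atMost_iff sum.distrib sum_distrib_left right_diff_distrib sum_subtractf integrand_deriv_def gradient_form_def drift_form_def S_def q_def)
  then show ?thesis unfolding t1 t2 by simp
qed

lemma continuous_on_integrand_deriv:
  fixes s \<phi> :: "'a::topological_space \<Rightarrow> real" and p \<pi> :: "'a \<Rightarrow> real^'n" and H \<Phi> :: "'a \<Rightarrow> real^'n^'n"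
  assumes "continuous_on X s" "\<And>x. x \<in> X \<Longrightarrow> s x > 0" "continuous_on X p" "\<And>i j. continuous_on X (\<lambda>x. H x $ i $ j)"
    "continuous_on X \<phi>" "continuous_on X \<pi>" "\<And>i j. continuous_on X (\<lambda>x. \<Phi> x $ i $ j)"
  shows "continuous_on X (\<lambda>x. integrand_deriv \<alpha> k (s x) (p x) (H x) (\<phi> x) (\<pi> x) (\<Phi> x))"
proof -
  have nz: "s x \<noteq> 0" if "x \<in> X" for x using assms(2)[OF that] by simp
  have S: "continuous_on X (\<lambda>x. s x powr a)" for a
    by (rule continuous_on_powr[OF assms(1) continuous_on_const]) (use nz in blast)
  have D: "continuous_on X (\<lambda>x. s x powr a / s x)" for a
    by (rule continuous_on_divide[OF S assms(1)]) (use nz in blast)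
  note M = continuous_on_msig[OF assms(4)] continuous_on_dsig[OF assms(4,7)]
  note q = continuous_on_inner[OF assms(3,3)] continuous_on_inner[OF assms(3,6)]
  show ?thesis
    unfolding integrand_deriv_def
    by (intro continuous_on_sum continuous_on_add continuous_on_mult continuous_on_const continuous_on_power S D M q assms(5))
qed

lemma continuous_on_integrand:
  fixes s q :: "'a::topological_space \<Rightarrow> real" and H :: "'a \<Rightarrow> real^'n^'n"
  assumes "continuous_on X s" "\<And>x. x \<in> X \<Longrightarrow> s x > 0" "continuous_on X q" "\<And>i j. continuous_on X (\<lambda>x. H x $ i $ j)"
  shows "continuous_on X (\<lambda>x. integrand \<alpha> k (s x) (q x) (H x))"
proof -
  have S: "continuous_on X (\<lambda>x. s x powr a)" for a
    by (rule continuous_on_powr[OF assms(1) continuous_on_const]) (use assms(2) in force)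
  show ?thesis
    unfolding integrand_def
    by (intro continuous_on_sum continuous_on_mult continuous_on_const continuous_on_power S continuous_on_msig[OF assms(4)] assms(3))
qed

lemma continuous_on_outer_dsig:
  fixes x y :: "'a::topological_space \<Rightarrow> real^'n" and H :: "'a \<Rightarrow> real^'n^'n"
  assumes "\<And>i j. continuous_on X (\<lambda>z. H z $ i $ j)" "continuous_on X x" "continuous_on X y"
  shows "continuous_on X (\<lambda>z. dsig j (H z) (outer (x z) (y z)))"
proof (rule continuous_on_dsig[OF assms(1)])
  fix i l
  show "continuous_on X (\<lambda>z. outer (x z) (y z) $ i $ l)"
    by (simp add: outer_def) (intro continuous_on_mult continuous_on_component assms(2,3))
qed

lemma continuous_on_variation_forms:
  fixes s :: "'a::topological_space \<Rightarrow> real" and p x y :: "'a \<Rightarrow> real^'n" and H :: "'a \<Rightarrow> real^'n^'n"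
  assumes "continuous_on X s" "\<And>x. x \<in> X \<Longrightarrow> s x > 0" "continuous_on X p" "\<And>i j. continuous_on X (\<lambda>x. H x $ i $ j)"
    "continuous_on X x" "continuous_on X y"
  shows "continuous_on X (\<lambda>z. gradient_form \<alpha> k (s z) (p z) (H z) (x z) (y z))"
    "continuous_on X (\<lambda>z. drift_form \<alpha> k (s z) (p z) (H z) (y z))"
proof -
  have nz: "s x \<noteq> 0" if "x \<in> X" for x using assms(2)[OF that] by simp
  have S: "continuous_on X (\<lambda>x. s x powr a)" for a
    by (rule continuous_on_powr[OF assms(1) continuous_on_const]) (use nz in blast)
  have D: "continuous_on X (\<lambda>x. s x powr a / s x)" for a
    by (rule continuous_on_divide[OF S assms(1)]) (use nz in blast)
  note M = continuous_on_outer_dsig[OF assms(4,5,6)] continuous_on_outer_dsig[OF assms(4,3,6)]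
  show "continuous_on X (\<lambda>z. gradient_form \<alpha> k (s z) (p z) (H z) (x z) (y z))"
    "continuous_on X (\<lambda>z. drift_form \<alpha> k (s z) (p z) (H z) (y z))"
    unfolding gradient_form_def drift_form_def
    by (intro continuous_on_sum continuous_on_mult continuous_on_const continuous_on_power S D M continuous_on_inner[OF assms(3,3)])+
qed

lemma outer_mult: "outer a b *v h = (b \<bullet> h) *\<^sub>R (a::real^'n)"
  unfolding vec_eq_iff matrix_vector_mult_def outer_def inner_vec_def by (simp add: sum_distrib_left mult.commute mult.left_commute)

lemma inner_hess_commute:
  fixes H :: "real^'n^'n"
  assumes "transpose H = H"
  shows "p \<bullet> (H *v h) = (H *v p) \<bullet> h"
proof -
  have "p v* H = H *v p" using transpose_matrix_vector[of H p] assms by simp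
  then show ?thesis using dot_lmul_matrix[of p H h] by simp
qed

lemma monomial_gradient:
  fixes w :: "real^'n \<Rightarrow> real"
  assumes w: "w \<in> C2_on \<Omega>" and \<Omega>: "open \<Omega>" and x: "x \<in> \<Omega>" and pos: "w x > 0"
  shows "((\<lambda>x. c * w x powr a * (grad w x \<bullet> grad w x) ^ m) has_derivative
    (\<lambda>h. ((c * (a * (w x powr a / w x) * (grad w x \<bullet> grad w x) ^ m)) *\<^sub>R grad w x
       + (c * (w x powr a * (real m * (grad w x \<bullet> grad w x) ^ (m - 1) * 2))) *\<^sub>R (hess w x *v grad w x)) \<bullet> h)) (at x)"
proof -
  have "w x powr (a - 1) = w x powr a / w x" using pos by (simp add: powr_diff)
  then have "((\<lambda>z. z powr a) has_real_derivative a * (w x powr a / w x)) (at (w x))"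
    using has_real_derivative_powr[OF pos, of a] by simp
  from DERIV_compose_FDERIV[OF this C2_onD(1)[OF w x]]
  have 1: "((\<lambda>x. w x powr a) has_derivative (\<lambda>h. (grad w x \<bullet> h) * (a * (w x powr a / w x)))) (at x)" .
  have 2: "((\<lambda>x. grad w x \<bullet> grad w x) has_derivative (\<lambda>h. 2 * ((hess w x *v grad w x) \<bullet> h))) (at x)"
  proof -
    have "((\<lambda>x. grad w x \<bullet> grad w x) has_derivative (\<lambda>h. grad w x \<bullet> (hess w x *v h) + (hess w x *v h) \<bullet> grad w x)) (at x)"
      by (intro has_derivative_inner grad_has_derivative[OF w \<Omega> x])
    moreover have "grad w x \<bullet> (hess w x *v h) + (hess w x *v h) \<bullet> grad w x = 2 * ((hess w x *v grad w x) \<bullet> h)" for h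
      using inner_hess_commute[OF hess_transpose[OF w \<Omega> x], of "grad w x" h] by (simp add: inner_commute)
    ultimately show ?thesis by simp
  qed
  have 3: "((\<lambda>x. (grad w x \<bullet> grad w x) ^ m) has_derivative (\<lambda>h. real m * (2 * ((hess w x *v grad w x) \<bullet> h)) * (grad w x \<bullet> grad w x) ^ (m - 1))) (at x)"
    by (rule has_derivative_power[OF 2, simplified of_nat_id])
  have "((\<lambda>x. c * w x powr a * (grad w x \<bullet> grad w x) ^ m) has_derivative
     (\<lambda>h. c * w x powr a * (real m * (2 * ((hess w x *v grad w x) \<bullet> h)) * (grad w x \<bullet> grad w x) ^ (m - 1))
        + c * ((grad w x \<bullet> h) * (a * (w x powr a / w x))) * (grad w x \<bullet> grad w x) ^ m)) (at x)"
    by (rule has_derivative_mult[OF has_derivative_mult_right[OF 1] 3])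
  then show ?thesis
    by (rule has_derivative_eq_rhs) (simp add: fun_eq_iff inner_add_left algebra_simps)
qed

text \<open>
  Apply \<open>integral_newton_tensor_zero\<close>, for each \<open>j\<close>, to the vector
  field of \<open>variation_algebra\<close> and sum over \<open>j\<close>. The factor
  \<open>g\<^sub>j\<close> is the coefficient of \<open>\<sigma>\<^sub>j\<close> in the
  integrand, and \<open>h\<^sub>j\<close> is chosen such that the terms without a derivative of
  \<open>\<psi>\<close> add up to \<open>\<psi>\<close> times the derivative of the integrand.
\<close>
lemma first_variation:
  fixes w \<phi> \<psi> :: "real^'n \<Rightarrow> real"
  assumes w: "w \<in> C2_on \<Omega>" and f: "\<phi> \<in> C2_on \<Omega>" and \<Omega>: "open \<Omega>" "compact K" "K \<subseteq> \<Omega>"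
    and pos: "\<And>x. x \<in> \<Omega> \<Longrightarrow> w x > 0"
    and \<psi>: "\<And>x. x \<in> \<Omega> \<Longrightarrow> (\<psi> has_derivative (\<lambda>h. D\<psi> x \<bullet> h)) (at x)" "continuous_on \<Omega> D\<psi>" "\<And>x. x \<in> \<Omega> - K \<Longrightarrow> \<psi> x = 0"
  shows "(LINT x:\<Omega>|lborel. \<psi> x * integrand_deriv \<alpha> k (w x) (grad w x) (hess w x) (\<phi> x) (grad \<phi> x) (hess \<phi> x)) =
    - (LINT x:\<Omega>|lborel. gradient_form \<alpha> k (w x) (grad w x) (hess w x) (grad \<phi> x) (D\<psi> x) + \<phi> x * drift_form \<alpha> k (w x) (grad w x) (hess w x) (D\<psi> x))"
proof -
  define q where "q x = grad w x \<bullet> grad w x" for x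
  define S where "S j x = w x powr (\<alpha> + real j)" for j x
  define g where "g j x = eco \<alpha> k j * S j x * q x ^ (k - j)" for j x
  define dg where "dg j x = (eco \<alpha> k j * ((\<alpha> + real j) * (S j x / w x) * q x ^ (k - j))) *\<^sub>R grad w x
       + (eco \<alpha> k j * (S j x * (real (k - j) * q x ^ (k - j - 1) * 2))) *\<^sub>R (hess w x *v grad w x)" for j x
  define h where "h j x = dco \<alpha> k j * (\<alpha> + real j) * (S j x / w x) * q x ^ (k - j)" for j x
  define dh where "dh j x = (dco \<alpha> k j * (\<alpha> + real j) * ((\<alpha> + real j - 1) * (S j x / w x / w x) * q x ^ (k - j))) *\<^sub>R grad w x
       + (dco \<alpha> k j * (\<alpha> + real j) * ((S j x / w x) * (real (k - j) * q x ^ (k - j - 1) * 2))) *\<^sub>R (hess w x *v grad w x)" for j x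
  define J where "J j x = outer (grad \<phi> x) (g j x *\<^sub>R D\<psi> x + \<psi> x *\<^sub>R dg j x) + (\<psi> x * g j x) *\<^sub>R hess \<phi> x
       + outer (grad w x) ((h j x * \<phi> x) *\<^sub>R D\<psi> x + \<psi> x *\<^sub>R (h j x *\<^sub>R grad \<phi> x + \<phi> x *\<^sub>R dh j x)) + (\<psi> x * (h j x * \<phi> x)) *\<^sub>R hess w x" for j x
  note cw = C2_on_continuous[OF w] and cf = C2_on_continuous[OF f]
  have c\<psi>: "continuous_on \<Omega> \<psi>" using \<psi>(1) has_derivative_continuous continuous_at_imp_continuous_on by blast
  have wnz: "w x \<noteq> 0" if "x \<in> \<Omega>" for x using pos[OF that] by simp
  have Sw: "S j x / w x = w x powr (\<alpha> + real j - 1)" if "x \<in> \<Omega>" for j x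
    using pos[OF that] by (simp add: S_def powr_diff)
  have cq: "continuous_on \<Omega> q" unfolding q_def by (rule continuous_on_inner[OF cw(4,4)])
  have cS: "continuous_on \<Omega> (S j)" for j
    unfolding S_def by (rule continuous_on_powr[OF cw(1) continuous_on_const]) (use wnz in blast)
  have cD: "continuous_on \<Omega> (\<lambda>x. S j x / w x)" "continuous_on \<Omega> (\<lambda>x. S j x / w x / w x)" for j
    by (rule continuous_on_divide[OF cS cw(1)], use wnz in blast)
      (rule continuous_on_divide[OF continuous_on_divide[OF cS cw(1)] cw(1)], use wnz in blast, use wnz in blast)
  have cHp: "continuous_on \<Omega> (\<lambda>x. (hess w x *v grad w x) $ i)" for i
    unfolding matrix_vector_mult_def vec_lambda_beta
    by (intro continuous_on_sum continuous_on_mult continuous_on_component cw(3,4))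
  have cgi: "continuous_on \<Omega> (\<lambda>x. grad w x $ i)" for i by (rule continuous_on_component[OF cw(4)])
  have cg: "continuous_on \<Omega> (g j)" and ch: "continuous_on \<Omega> (h j)" for j
    unfolding g_def h_def by (intro continuous_on_mult continuous_on_const continuous_on_power cS cD cq)+
  have cdg: "continuous_on \<Omega> (\<lambda>x. dg j x $ i)" and cdh: "continuous_on \<Omega> (\<lambda>x. dh j x $ i)" for j i
    unfolding dg_def dh_def vector_add_component vector_scaleR_component
    by (intro continuous_on_add continuous_on_scaleR continuous_on_mult continuous_on_const continuous_on_power cS cD cq cHp cgi)+
  have dg: "(g j has_derivative (\<lambda>y. dg j x \<bullet> y)) (at x)" if "x \<in> \<Omega>" for j x
    unfolding g_def dg_def S_def q_def
    by (rule monomial_gradient[OF w \<Omega>(1) that pos[OF that]])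
  have dh: "(h j has_derivative (\<lambda>y. dh j x \<bullet> y)) (at x)" if x: "x \<in> \<Omega>" for j x
  proof -
    have "((\<lambda>x. (dco \<alpha> k j * (\<alpha> + real j)) * w x powr (\<alpha> + real j - 1) * q x ^ (k - j)) has_derivative (\<lambda>y. dh j x \<bullet> y)) (at x)"
      unfolding dh_def Sw[OF x] q_def by (rule monomial_gradient[OF w \<Omega>(1) x pos[OF x]])
    then show ?thesis
      by (rule has_derivative_transform_within_open[OF _ \<Omega>(1) x]) (simp add: h_def Sw)
  qed
  have dJ: "((\<lambda>x. (\<psi> x * g j x) *\<^sub>R grad \<phi> x + (\<psi> x * (h j x * \<phi> x)) *\<^sub>R grad w x) has_derivative (\<lambda>y. J j x *v y)) (at x)"
    if x: "x \<in> \<Omega>" for j x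
  proof -
    have "((\<lambda>x. (\<psi> x * g j x) *\<^sub>R grad \<phi> x + (\<psi> x * (h j x * \<phi> x)) *\<^sub>R grad w x) has_derivative
      (\<lambda>y. ((\<psi> x * g j x) *\<^sub>R (hess \<phi> x *v y) + (\<psi> x * (dg j x \<bullet> y) + (D\<psi> x \<bullet> y) * g j x) *\<^sub>R grad \<phi> x)
         + ((\<psi> x * (h j x * \<phi> x)) *\<^sub>R (hess w x *v y) + (\<psi> x * (h j x * (grad \<phi> x \<bullet> y) + (dh j x \<bullet> y) * \<phi> x) + (D\<psi> x \<bullet> y) * (h j x * \<phi> x)) *\<^sub>R grad w x))) (at x)"
      by (intro has_derivative_add has_derivative_scaleR has_derivative_mult \<psi>(1)[OF x] dg[OF x] dh[OF x]
          grad_has_derivative[OF f \<Omega>(1) x] grad_has_derivative[OF w \<Omega>(1) x] C2_onD(1)[OF f x])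
    then show ?thesis
      by (rule has_derivative_eq_rhs)
        (simp add: fun_eq_iff J_def matrix_vector_mult_add_rdistrib outer_mult scaleR_matrix_vector_assoc[symmetric] inner_add_left algebra_simps)
  qed
  have cJ: "continuous_on \<Omega> (\<lambda>x. J j x $ i $ l)" for j i l
    unfolding J_def outer_def vector_add_component vector_scaleR_component vec_lambda_beta real_scaleR_def
    by (intro continuous_on_add continuous_on_mult cgi cg ch cdg cdh c\<psi> cw(1,3) cf(1,3)
        continuous_on_component[OF \<psi>(2)] continuous_on_component[OF cf(4)])
  have z: "(\<psi> x * g j x) *\<^sub>R grad \<phi> x + (\<psi> x * (h j x * \<phi> x)) *\<^sub>R grad w x = 0" if "x \<in> \<Omega> - K" for j x
    using \<psi>(3)[OF that] by simp
  have ndf: "(LINT x:\<Omega>|lborel. dsig i (hess w x) (J j x)) = 0"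
      "set_integrable lborel \<Omega> (\<lambda>x. dsig i (hess w x) (J j x))" for i j
    using integral_newton_tensor_zero[OF w \<Omega>, of "\<lambda>x. (\<psi> x * g j x) *\<^sub>R grad \<phi> x + (\<psi> x * (h j x * \<phi> x)) *\<^sub>R grad w x" "J j"] dJ cJ z
    by blast+
  define A where "A x = \<psi> x * integrand_deriv \<alpha> k (w x) (grad w x) (hess w x) (\<phi> x) (grad \<phi> x) (hess \<phi> x)" for x
  define B where "B x = gradient_form \<alpha> k (w x) (grad w x) (hess w x) (grad \<phi> x) (D\<psi> x) + \<phi> x * drift_form \<alpha> k (w x) (grad w x) (hess w x) (D\<psi> x)" for x
  have alg: "(\<Sum>j\<le>k. dsig j (hess w x) (J j x)) = A x + B x" if x: "x \<in> \<Omega>" for x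
    unfolding A_def B_def J_def g_def dg_def h_def dh_def S_def q_def
    by (rule variation_algebra[OF hess_transpose[OF w \<Omega>(1) x] pos[OF x]])
  have D\<psi>0: "D\<psi> x = 0" if "x \<in> \<Omega> - K" for x
  proof -
    have "(\<lambda>h. D\<psi> x \<bullet> h) = (\<lambda>h. 0)"
      by (rule deriv_zero_off_support[OF \<Omega>(1,2) \<psi>(1) \<psi>(3)]) (use that in auto)
    then have "D\<psi> x \<bullet> D\<psi> x = 0" by (rule fun_cong)
    then show ?thesis by simp
  qed
  have iA: "set_integrable lborel \<Omega> A"
    unfolding A_def
    by (rule set_integrable_csupp[OF \<Omega> continuous_on_mult[OF c\<psi> continuous_on_integrand_deriv[OF cw(1) pos cw(4,3) cf(1,4,3)]]])
      (simp_all add: \<psi>(3))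
  have o0: "outer x 0 = 0" for x :: "real^'n" by (simp add: outer_def vec_eq_iff)
  have iB: "set_integrable lborel \<Omega> B"
    unfolding B_def
    by (rule set_integrable_csupp[OF \<Omega> continuous_on_add[OF continuous_on_variation_forms(1)[OF cw(1) pos cw(4,3) cf(4) \<psi>(2)]
            continuous_on_mult[OF cf(1) continuous_on_variation_forms(2)[OF cw(1) pos cw(4,3) cf(4) \<psi>(2)]]]])
      (simp_all add: D\<psi>0 gradient_form_def drift_form_def o0 dsig_zero)
  have "(LINT x:\<Omega>|lborel. A x + B x) = (LINT x:\<Omega>|lborel. \<Sum>j\<le>k. dsig j (hess w x) (J j x))"
    unfolding set_lebesgue_integral_def by (intro Bochner_Integration.integral_cong) (auto simp: indicator_def alg)
  also have "\<dots> = (\<Sum>j\<le>k. (LINT x:\<Omega>|lborel. dsig j (hess w x) (J j x)))"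
    unfolding set_lebesgue_integral_def scaleR_sum_right
    using ndf(2) by (intro Bochner_Integration.integral_sum) (simp add: set_integrable_def)
  also have "\<dots> = 0" by (simp add: ndf(1))
  finally have "(LINT x:\<Omega>|lborel. A x) + (LINT x:\<Omega>|lborel. B x) = 0"
    by (simp add: set_integral_add(2)[OF iA iB])
  then show ?thesis unfolding A_def B_def by simp
qed

section \<open>Segments between two functions\<close>

lemma C2_on_lincomb:
  fixes u v :: "real^'n \<Rightarrow> real"
  assumes u: "u \<in> C2_on \<Omega>" and v: "v \<in> C2_on \<Omega>" and \<Omega>: "open \<Omega>"
  shows "(\<lambda>x. v x + t * u x) \<in> C2_on \<Omega>"
    "x \<in> \<Omega> \<Longrightarrow> grad (\<lambda>x. v x + t * u x) x = grad v x + t *\<^sub>R grad u x"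
    "x \<in> \<Omega> \<Longrightarrow> hess (\<lambda>x. v x + t * u x) x = hess v x + t *\<^sub>R hess u x"
proof -
  let ?w = "\<lambda>x. v x + t * u x"
  have d1: "(?w has_derivative (\<lambda>h. (grad v x + t *\<^sub>R grad u x) \<bullet> h)) (at x)" if "x \<in> \<Omega>" for x
    using has_derivative_add[OF C2_onD(1)[OF v that] has_derivative_mult_right[OF C2_onD(1)[OF u that], of t]]
    by (simp add: inner_add_left)
  have p1: "pderiv_vec i ?w x = pderiv_vec i v x + t * pderiv_vec i u x" if "x \<in> \<Omega>" for i x
    unfolding pderiv_vec_def[of i ?w] frechet_derivative_at[OF d1[OF that], symmetric] by (simp add: inner_axis)
  show g: "grad ?w x = grad v x + t *\<^sub>R grad u x" if "x \<in> \<Omega>" for x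
    using p1[OF that] by (simp add: vec_eq_iff)
  have d2: "(pderiv_vec i ?w has_derivative (\<lambda>h. ((\<chi> j. hess v x $ j $ i) + t *\<^sub>R (\<chi> j. hess u x $ j $ i)) \<bullet> h)) (at x)" if x: "x \<in> \<Omega>" for i x
  proof -
    have "((\<lambda>x. pderiv_vec i v x + t * pderiv_vec i u x) has_derivative (\<lambda>h. ((\<chi> j. hess v x $ j $ i) + t *\<^sub>R (\<chi> j. hess u x $ j $ i)) \<bullet> h)) (at x)"
      using has_derivative_add[OF C2_onD(2)[OF v x] has_derivative_mult_right[OF C2_onD(2)[OF u x], of t]]
      by (simp add: inner_add_left)
    then show ?thesis
      by (rule has_derivative_transform_within_open[OF _ \<Omega> x]) (simp add: p1)
  qed
  have p2: "pderiv_vec j (pderiv_vec i ?w) x = hess v x $ j $ i + t * hess u x $ j $ i" if "x \<in> \<Omega>" for i j x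
    unfolding pderiv_vec_def[of j] frechet_derivative_at[OF d2[OF that], symmetric] by (simp add: inner_axis)
  show "hess ?w x = hess v x + t *\<^sub>R hess u x" if "x \<in> \<Omega>" for x
    using p2[OF that] by (simp add: hess_def vec_eq_iff)
  have "continuous_on \<Omega> (\<lambda>x. hess v x $ j $ i + t * hess u x $ j $ i)" for i j
    by (intro continuous_intros C2_on_continuous[OF u] C2_on_continuous[OF v])
  then have "continuous_on \<Omega> (pderiv_vec j (pderiv_vec i ?w))" for i j
    by (rule continuous_on_eq) (simp add: p2)
  then show "?w \<in> C2_on \<Omega>"
    unfolding C2_on_def differentiable_def using d1 d2 by blast
qed

text \<open>
  With \<open>y = pu / a - pv / b\<close>, the matrix on the left is \<open>c1\<close> times the
  first given matrix plus \<open>c2\<close> times the second plus \<open>c3\<close> times the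
  identity, where \<open>c3 = t (1 - t) a b |y|\<^sup>2 / 2\<close>.
\<close>
lemma segment_gcone:
  fixes Hu Hv :: "real^'n^'n" and pu pv :: "real^'n"
  assumes k: "k \<le> CARD('n)" and pos: "a > 0" "b > 0" and t: "0 \<le> t" "t \<le> 1"
    and A: "a *\<^sub>R Hu - (pu \<bullet> pu / 2) *\<^sub>R mat 1 \<in> gcone k" and B: "b *\<^sub>R Hv - (pv \<bullet> pv / 2) *\<^sub>R mat 1 \<in> gcone k"
  defines "w \<equiv> (1 - t) * b + t * a" and "H \<equiv> (1 - t) *\<^sub>R Hv + t *\<^sub>R Hu" and "p \<equiv> (1 - t) *\<^sub>R pv + t *\<^sub>R pu"
  shows "w *\<^sub>R H - (p \<bullet> p / 2) *\<^sub>R mat 1 \<in> gcone k"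
proof -
  define A0 where "A0 = a *\<^sub>R Hu - (pu \<bullet> pu / 2) *\<^sub>R (mat 1 :: real^'n^'n)"
  define B0 where "B0 = b *\<^sub>R Hv - (pv \<bullet> pv / 2) *\<^sub>R (mat 1 :: real^'n^'n)"
  define c1 where "c1 = t\<^sup>2 + t * (1 - t) * (b / a)"
  define c2 where "c2 = (1 - t)\<^sup>2 + t * (1 - t) * (a / b)"
  define y where "y = (1 / a) *\<^sub>R pu - (1 / b) *\<^sub>R pv"
  define c3 where "c3 = t * (1 - t) * (a * b) * (y \<bullet> y) / 2"
  have Hu: "Hu = (1 / a) *\<^sub>R (A0 + (pu \<bullet> pu / 2) *\<^sub>R mat 1)" using pos by (simp add: A0_def)
  have Hv: "Hv = (1 / b) *\<^sub>R (B0 + (pv \<bullet> pv / 2) *\<^sub>R mat 1)" using pos by (simp add: B0_def)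
  have c1': "w * t / a = c1" and c2': "w * (1 - t) / b = c2" using pos by (simp_all add: w_def c1_def c2_def field_simps power2_eq_square)
  have yy: "y \<bullet> y = (pu \<bullet> pu) / a\<^sup>2 + (pv \<bullet> pv) / b\<^sup>2 - 2 * (pu \<bullet> pv) / (a * b)"
    unfolding y_def by (simp add: inner_diff_left inner_diff_right inner_commute power2_eq_square algebra_simps)
  have pp: "p \<bullet> p = (1 - t)\<^sup>2 * (pv \<bullet> pv) + t\<^sup>2 * (pu \<bullet> pu) + 2 * t * (1 - t) * (pu \<bullet> pv)"
    unfolding p_def by (simp add: inner_add_left inner_add_right inner_commute power2_eq_square algebra_simps)
  have sc: "c1 * (pu \<bullet> pu / 2) + c2 * (pv \<bullet> pv / 2) - p \<bullet> p / 2 = c3"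
    unfolding c3_def yy pp c1_def c2_def using pos by (simp add: field_simps power2_eq_square)
  have "w *\<^sub>R H = (w * (1 - t)) *\<^sub>R Hv + (w * t) *\<^sub>R Hu" by (simp add: H_def scaleR_add_right)
  also have "\<dots> = c2 *\<^sub>R (B0 + (pv \<bullet> pv / 2) *\<^sub>R mat 1) + c1 *\<^sub>R (A0 + (pu \<bullet> pu / 2) *\<^sub>R mat 1)"
    by (subst Hu, subst Hv) (simp only: scaleR_scaleR c1'[symmetric] c2'[symmetric] times_divide_eq_right mult_1_right)
  finally have "w *\<^sub>R H - (p \<bullet> p / 2) *\<^sub>R mat 1 = c1 *\<^sub>R A0 + c2 *\<^sub>R B0 + (c1 * (pu \<bullet> pu / 2) + c2 * (pv \<bullet> pv / 2) - p \<bullet> p / 2) *\<^sub>R mat 1"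
    by (simp add: algebra_simps)
  also have "\<dots> = c1 *\<^sub>R A0 + c2 *\<^sub>R B0 + c3 *\<^sub>R mat 1" unfolding sc ..
  finally have eq: "w *\<^sub>R H - (p \<bullet> p / 2) *\<^sub>R mat 1 = c1 *\<^sub>R A0 + c2 *\<^sub>R B0 + c3 *\<^sub>R mat 1" .
  have "c1 \<ge> 0" "c2 \<ge> 0" "c3 \<ge> 0" using pos t by (auto simp: c1_def c2_def c3_def intro!: add_nonneg_nonneg mult_nonneg_nonneg divide_nonneg_nonneg)
  then show ?thesis unfolding eq
    using A B by (intro gcone_add[OF k] gcone_scale gcone_mat) (auto simp: A0_def B0_def k)
qed

text \<open>
  The polynomial expansion of \<open>msig k (M + \<tau> B)\<close> around each point of the line
  has linear coefficient \<open>dsig k M B\<close>.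
\<close>
lemma msig_line_deriv:
  fixes H B :: "real^'n^'n"
  shows "((\<lambda>t. msig k (H + t *\<^sub>R B)) has_real_derivative dsig k (H + t *\<^sub>R B) B) (at t)"
proof -
  have n: "Suc 0 \<le> CARD('n)" using zero_less_card_finite[where 'a='n] by linarith
  have e: "msig k (M + \<tau> *\<^sub>R B) = (\<Sum>m\<le>CARD('n). \<tau> ^ m * mixsig k m M B)" for M \<tau>
  proof -
    have "M + \<tau> *\<^sub>R B = (\<chi> i j. M $ i $ j + \<tau> * B $ i $ j)" by (simp add: vec_eq_iff)
    then show ?thesis by (simp only: msig_affine_expand)
  qed
  have "((\<lambda>\<tau>. \<Sum>m\<le>CARD('n). \<tau> ^ m * mixsig k m M B) has_real_derivative (\<Sum>m\<le>CARD('n). real m * 0 ^ (m - 1) * mixsig k m M B)) (at 0)" for M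
    by (auto intro!: derivative_eq_intros simp: mult_ac)
  moreover have "(\<Sum>m\<le>CARD('n). real m * 0 ^ (m - 1) * mixsig k m M B) = (\<Sum>m\<le>CARD('n). if m = Suc 0 then dsig k M B else 0)" for M
    by (intro sum.cong refl) (auto simp: mixsig_1 power_0_left)
  ultimately have "((\<lambda>\<tau>. msig k (M + \<tau> *\<^sub>R B)) has_real_derivative dsig k M B) (at 0)" for M
    unfolding e using n by simp
  from this[of "H + t *\<^sub>R B"] have "((\<lambda>\<tau>. msig k (H + (\<tau> + t) *\<^sub>R B)) has_real_derivative dsig k (H + t *\<^sub>R B) B) (at 0)"
    by (simp add: algebra_simps)
  then show ?thesis using DERIV_at_within_shift[of "\<lambda>t. msig k (H + t *\<^sub>R B)" "dsig k (H + t *\<^sub>R B) B" t 0 UNIV]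
    by (simp add: DERIV_shift[of _ _ 0 t, simplified])
qed

lemma integrand_line_deriv:
  fixes H \<Phi> :: "real^'n^'n" and p \<pi> :: "real^'n"
  assumes "s + t * \<phi> > 0"
  shows "((\<lambda>t. integrand \<alpha> k (s + t * \<phi>) ((p + t *\<^sub>R \<pi>) \<bullet> (p + t *\<^sub>R \<pi>)) (H + t *\<^sub>R \<Phi>)) has_real_derivative
    integrand_deriv \<alpha> k (s + t * \<phi>) (p + t *\<^sub>R \<pi>) (H + t *\<^sub>R \<Phi>) \<phi> \<pi> \<Phi>) (at t)"
proof -
  let ?s = "s + t * \<phi>" and ?p = "p + t *\<^sub>R \<pi>" and ?H = "H + t *\<^sub>R \<Phi>"
  have 1: "((\<lambda>t. (s + t * \<phi>) powr a) has_real_derivative a * (?s powr a / ?s) * \<phi>) (at t)" for a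
  proof -
    have "((\<lambda>t. s + t * \<phi>) has_real_derivative \<phi>) (at t)" by (auto intro!: derivative_eq_intros)
    from DERIV_chain2[OF has_real_derivative_powr[OF assms] this]
    show ?thesis using assms by (simp add: powr_diff)
  qed
  have 2: "((\<lambda>t. (p + t *\<^sub>R \<pi>) \<bullet> (p + t *\<^sub>R \<pi>)) has_real_derivative 2 * (?p \<bullet> \<pi>)) (at t)"
  proof -
    have e: "(p + t *\<^sub>R \<pi>) \<bullet> (p + t *\<^sub>R \<pi>) = p \<bullet> p + 2 * t * (p \<bullet> \<pi>) + t\<^sup>2 * (\<pi> \<bullet> \<pi>)" for t
      by (simp add: inner_add_left inner_add_right inner_commute power2_eq_square algebra_simps)
    show ?thesis unfolding e
      by (auto intro!: derivative_eq_intros simp: inner_add_left algebra_simps)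
  qed
  have 3: "((\<lambda>t. ((p + t *\<^sub>R \<pi>) \<bullet> (p + t *\<^sub>R \<pi>)) ^ m) has_real_derivative real m * (2 * (?p \<bullet> \<pi>)) * (?p \<bullet> ?p) ^ (m - 1)) (at t)" for m
    using DERIV_power[OF 2, of m] by (simp add: mult_ac)
  have "((\<lambda>t. \<Sum>j\<le>k. eco \<alpha> k j * (((s + t * \<phi>) powr (\<alpha> + real j) * ((p + t *\<^sub>R \<pi>) \<bullet> (p + t *\<^sub>R \<pi>)) ^ (k - j)) * msig j (H + t *\<^sub>R \<Phi>))) has_real_derivative
    (\<Sum>j\<le>k. eco \<alpha> k j * ((((\<alpha> + real j) * (?s powr (\<alpha> + real j) / ?s) * \<phi>) * (?p \<bullet> ?p) ^ (k - j)
        + (real (k - j) * (2 * (?p \<bullet> \<pi>)) * (?p \<bullet> ?p) ^ (k - j - 1)) * ?s powr (\<alpha> + real j)) * msig j ?H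
        + dsig j ?H \<Phi> * (?s powr (\<alpha> + real j) * (?p \<bullet> ?p) ^ (k - j))))) (at t)"
    by (intro DERIV_sum DERIV_cmult DERIV_mult 1 3 msig_line_deriv)
  moreover have "(\<Sum>j\<le>k. eco \<alpha> k j * ((((\<alpha> + real j) * (?s powr (\<alpha> + real j) / ?s) * \<phi>) * (?p \<bullet> ?p) ^ (k - j)
        + (real (k - j) * (2 * (?p \<bullet> \<pi>)) * (?p \<bullet> ?p) ^ (k - j - 1)) * ?s powr (\<alpha> + real j)) * msig j ?H
        + dsig j ?H \<Phi> * (?s powr (\<alpha> + real j) * (?p \<bullet> ?p) ^ (k - j)))) = integrand_deriv \<alpha> k ?s ?p ?H \<phi> \<pi> \<Phi>"
    unfolding integrand_deriv_def by (intro sum.cong refl arg_cong[where f="\<lambda>z. eco \<alpha> k _ * z"]) (simp only: distrib_left distrib_right mult_ac add_ac)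
  moreover have "(\<lambda>t. integrand \<alpha> k (s + t * \<phi>) ((p + t *\<^sub>R \<pi>) \<bullet> (p + t *\<^sub>R \<pi>)) (H + t *\<^sub>R \<Phi>)) =
    (\<lambda>t. \<Sum>j\<le>k. eco \<alpha> k j * (((s + t * \<phi>) powr (\<alpha> + real j) * ((p + t *\<^sub>R \<pi>) \<bullet> (p + t *\<^sub>R \<pi>)) ^ (k - j)) * msig j (H + t *\<^sub>R \<Phi>)))"
    by (simp only: integrand_def mult.assoc)
  ultimately show ?thesis by simp
qed

text \<open>
  Adding \<open>x \<otimes> x\<close> to the Hessian changes the integrand by exactly this form,
  because the integrand is affine in such directions. In the original form of the integrand,
  with its nonnegative weights, the change is nonnegative by \<open>dsig_nonneg\<close>.
\<close>
lemma gradient_form_nonneg: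
  fixes H :: "real^'n^'n"
  assumes a: "\<alpha> \<ge> 0" and k: "k \<le> CARD('n)" and s: "s > 0" and cone: "s *\<^sub>R H - (p \<bullet> p / 2) *\<^sub>R mat 1 \<in> gcone k"
  shows "gradient_form \<alpha> k s p H x x \<ge> 0"
proof -
  define A where "A = s *\<^sub>R H - (p \<bullet> p / 2) *\<^sub>R (mat 1 :: real^'n^'n)"
  have n1: "CARD('n) \<ge> 1" using zero_less_card_finite[where 'a='n] by linarith
  have r: "msig j (M + c *\<^sub>R outer x x) = msig j M + c * dsig j M (outer x x)" for j c and M :: "real^'n^'n"
  proof -
    have "M + c *\<^sub>R outer x x = (\<chi> i j. M $ i $ j + c * outer x x $ i $ j)" by (simp add: vec_eq_iff)
    then show ?thesis by (simp only: msig_rank_one)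
  qed
  have "gradient_form \<alpha> k s p H x x = integrand \<alpha> k s (p \<bullet> p) (H + 1 *\<^sub>R outer x x) - integrand \<alpha> k s (p \<bullet> p) H"
    unfolding integrand_def gradient_form_def r by (simp add: sum_subtractf[symmetric] algebra_simps)
  also have "\<dots> = (\<Sum>l=0..k. b_coeff \<alpha> CARD('n) k l * s powr \<alpha> * (p \<bullet> p) ^ l * (msig (k - l) (A + s *\<^sub>R outer x x) - msig (k - l) A))"
  proof -
    have "s *\<^sub>R (H + 1 *\<^sub>R outer x x) - (p \<bullet> p / 2) *\<^sub>R mat 1 = A + s *\<^sub>R outer x x" by (simp add: A_def algebra_simps)
    then show ?thesis
      unfolding weighted_sum_eq_integrand[OF a k s, symmetric] A_def[symmetric] by (simp add: sum_subtractf[symmetric] right_diff_distrib)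
  qed
  also have "\<dots> \<ge> 0"
  proof (intro sum_nonneg mult_nonneg_nonneg b_coeff_nonneg a n1)
    fix l
    have "dsig (k - l) A (outer x x) \<ge> 0"
      by (rule dsig_nonneg) (use k in simp, rule gcone_mono[OF cone[folded A_def]], simp)
    then show "0 \<le> msig (k - l) (A + s *\<^sub>R outer x x) - msig (k - l) A" using s by (simp add: r)
  qed auto
  finally show ?thesis .
qed

section \<open>Contact sets\<close>

text \<open>
  Near a point of the set, with \<open>d\<close> the gradient there, \<open>g\<close> differs
  from the linear function \<open>d\<close> by a map of small Lipschitz constant, so two zeros
  \<open>x\<close>, \<open>y\<close> of \<open>g\<close> satisfy \<open>|d \<bullet> (x - y)|
  \<le> |d| |x - y| / 2\<close>. Hence the orthogonal projection to the hyperplane normal to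
  \<open>d\<close> is Lipschitz invertible on the zeros near that point, and the inverse maps
  null sets to null sets.
\<close>
lemma level_set_negligible:
  fixes g :: "'a::euclidean_space \<Rightarrow> real"
  assumes \<Omega>: "open \<Omega>" and d: "\<And>x. x \<in> \<Omega> \<Longrightarrow> (g has_derivative (\<lambda>h. Dg x \<bullet> h)) (at x)"
    and c: "continuous_on \<Omega> Dg"
  shows "negligible {x \<in> \<Omega>. g x = 0 \<and> Dg x \<noteq> 0}" (is "negligible ?N")
proof (rule locally_negligible_alt[THEN iffD2], rule ballI)
  fix x0 assume x0: "x0 \<in> ?N"
  define d where "d = Dg x0"
  have d0: "norm d > 0" using x0 by (simp add: d_def)
  obtain r1 where r1: "r1 > 0" "ball x0 r1 \<subseteq> \<Omega>" using \<Omega> x0 open_contains_ball by blast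
  have "isCont Dg x0" using c \<Omega> x0 continuous_on_eq_continuous_at by blast
  then obtain r2 where r2: "r2 > 0" "\<And>z. dist z x0 < r2 \<Longrightarrow> dist (Dg z) (Dg x0) < norm d / 2"
    using d0 unfolding continuous_at_eps_delta by (meson half_gt_zero)
  define U where "U = ball x0 (min r1 r2)"
  have UO: "U \<subseteq> \<Omega>" using r1 by (auto simp: U_def)
  have x0U: "x0 \<in> U" using r1 r2 by (simp add: U_def)
  have flat: "\<bar>d \<bullet> (x - y)\<bar> \<le> norm d / 2 * norm (x - y)" if "x \<in> ?N \<inter> U" "y \<in> ?N \<inter> U" for x y
  proof -
    have "norm ((g x - d \<bullet> x) - (g y - d \<bullet> y)) \<le> norm d / 2 * norm (x - y)"
    proof (rule differentiable_bound[where S=U])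
      show "convex U" by (simp add: U_def)
      fix z assume z: "z \<in> U"
      show "((\<lambda>x. g x - d \<bullet> x) has_derivative (\<lambda>h. (Dg z - d) \<bullet> h)) (at z within U)"
        unfolding inner_diff_left
        by (intro has_derivative_diff has_derivative_at_withinI[OF d] has_derivative_inner_right has_derivative_ident) (use z UO in blast)
      have n: "norm (Dg z - d) \<le> norm d / 2" using r2(2)[of z] z by (simp add: U_def d_def dist_norm norm_minus_commute)
      show "onorm (\<lambda>h. (Dg z - d) \<bullet> h) \<le> norm d / 2"
      proof (rule onorm_le)
        fix h
        have "norm ((Dg z - d) \<bullet> h) \<le> norm (Dg z - d) * norm h" by (simp add: Cauchy_Schwarz_ineq2)
        also have "\<dots> \<le> norm d / 2 * norm h" by (intro mult_right_mono n) simp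
        finally show "norm ((Dg z - d) \<bullet> h) \<le> norm d / 2 * norm h" .
      qed
    qed (use that in auto)
    then show ?thesis using that by (simp add: inner_diff_right abs_minus_commute)
  qed
  define P where "P x = x - ((d \<bullet> x) / (d \<bullet> d)) *\<^sub>R d" for x
  have dd: "d \<bullet> d > 0" using d0 by simp
  have lip: "norm (x - y) \<le> 2 * norm (P x - P y)" if xy: "x \<in> ?N \<inter> U" "y \<in> ?N \<inter> U" for x y
  proof -
    have "x - y = (P x - P y) + ((d \<bullet> (x - y)) / (d \<bullet> d)) *\<^sub>R d"
      by (simp add: P_def inner_diff_right diff_divide_distrib algebra_simps)
    then have "norm (x - y) \<le> norm (P x - P y) + norm (((d \<bullet> (x - y)) / (d \<bullet> d)) *\<^sub>R d)"
      by (metis norm_triangle_ineq)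
    also have "norm (((d \<bullet> (x - y)) / (d \<bullet> d)) *\<^sub>R d) = \<bar>d \<bullet> (x - y)\<bar> / norm d"
      using d0 by (simp add: dot_square_norm power2_eq_square)
    also have "\<dots> \<le> norm (x - y) / 2"
      using flat[OF xy] d0 by (simp add: divide_le_eq mult.commute)
    finally show ?thesis by simp
  qed
  define Q where "Q = inv_into (?N \<inter> U) P"
  have inj: "inj_on P (?N \<inter> U)"
  proof (rule inj_onI)
    fix x y assume "x \<in> ?N \<inter> U" "y \<in> ?N \<inter> U" "P x = P y"
    then show "x = y" using lip[of x y] by simp
  qed
  have QP: "Q (P x) = x" if "x \<in> ?N \<inter> U" for x
    unfolding Q_def by (rule inv_into_f_f[OF inj that])
  have "P ` (?N \<inter> U) \<subseteq> {y. d \<bullet> y = 0}"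
    using dd by (auto simp: P_def inner_diff_right)
  then have nP: "negligible (P ` (?N \<inter> U))"
    using negligible_subset[OF negligible_hyperplane[of d 0]] d0 by simp
  have "negligible (Q ` (P ` (?N \<inter> U)))"
  proof (rule negligible_locally_Lipschitz_image[OF _ nP])
    fix y assume "y \<in> P ` (?N \<inter> U)"
    then obtain x where x: "x \<in> ?N \<inter> U" "y = P x" by blast
    have "norm (Q z - Q y) \<le> 2 * norm (z - y)" if z: "z \<in> P ` (?N \<inter> U) \<inter> UNIV" for z
    proof -
      obtain x' where x': "x' \<in> ?N \<inter> U" "z = P x'" using z by blast
      show ?thesis unfolding x(2) x'(2) QP[OF x(1)] QP[OF x'(1)] by (rule lip[OF x'(1) x(1)])
    qed
    then show "\<exists>T B. open T \<and> y \<in> T \<and> (\<forall>z\<in>P ` (?N \<inter> U) \<inter> T. norm (Q z - Q y) \<le> B * norm (z - y))"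
      using open_UNIV UNIV_I by blast
  qed simp
  moreover have "Q ` (P ` (?N \<inter> U)) = ?N \<inter> U"
    using QP by (auto simp: image_iff)
  ultimately have "negligible (?N \<inter> U)" by simp
  moreover have "openin (top_of_set ?N) (?N \<inter> U)" by (rule openin_open_Int) (simp add: U_def)
  ultimately show "\<exists>V. openin (top_of_set ?N) V \<and> x0 \<in> V \<and> negligible V" using x0 x0U by blast
qed

text \<open>
  A zero is a minimum, so the gradient vanishes. Apply \<open>level_set_negligible\<close> to
  each partial derivative: almost everywhere on its zero set, its own gradient vanishes.
\<close>
lemma contact_set_jets_vanish:
  fixes \<phi> :: "real^'n \<Rightarrow> real"
  assumes f: "\<phi> \<in> C2_on \<Omega>" and \<Omega>: "open \<Omega>" and nn: "\<And>x. x \<in> \<Omega> \<Longrightarrow> \<phi> x \<ge> 0"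
  shows "x \<in> \<Omega> \<Longrightarrow> \<phi> x = 0 \<Longrightarrow> grad \<phi> x = 0"
    "AE x in lebesgue. x \<in> \<Omega> \<longrightarrow> \<phi> x = 0 \<longrightarrow> hess \<phi> x = 0"
proof -
  show g0: "grad \<phi> x = 0" if x: "x \<in> \<Omega>" "\<phi> x = 0" for x
  proof -
    have "(\<lambda>h. grad \<phi> x \<bullet> h) = (\<lambda>h. 0)"
      by (rule differential_zero_maxmin[OF x(1) \<Omega> C2_onD(1)[OF f x(1)]]) (use nn x(2) in auto)
    then have "grad \<phi> x \<bullet> grad \<phi> x = 0" by (rule fun_cong)
    then show ?thesis by simp
  qed
  define N where "N i = {x \<in> \<Omega>. pderiv_vec i \<phi> x = 0 \<and> (\<chi> j. hess \<phi> x $ j $ i) \<noteq> 0}" for i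
  have "negligible (N i)" for i
    unfolding N_def
    by (rule level_set_negligible[OF \<Omega> C2_onD(2)[OF f]]) (auto intro!: continuous_on_vec_lambda C2_on_continuous[OF f])
  then have "negligible (\<Union>i. N i)" by (intro negligible_Union) auto
  then have null: "(\<Union>i. N i) \<in> null_sets lebesgue" by (simp add: negligible_iff_null_sets)
  have "hess \<phi> x = 0" if x: "x \<in> \<Omega>" "\<phi> x = 0" "x \<notin> (\<Union>i. N i)" for x
  proof -
    have "pderiv_vec i \<phi> x = 0" for i using g0[OF x(1,2)] by (metis grad_nth zero_index)
    then have "(\<chi> j. hess \<phi> x $ j $ i) = 0" for i using x unfolding N_def by blast
    then have "hess \<phi> x $ j $ i = 0" for i j by (metis vec_lambda_beta zero_index)
    then show ?thesis by (simp add: vec_eq_iff)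
  qed
  then have "{x \<in> space lebesgue. \<not> (x \<in> \<Omega> \<longrightarrow> \<phi> x = 0 \<longrightarrow> hess \<phi> x = 0)} \<subseteq> (\<Union>i. N i)" by blast
  then show "AE x in lebesgue. x \<in> \<Omega> \<longrightarrow> \<phi> x = 0 \<longrightarrow> hess \<phi> x = 0"
    by (rule AE_I'[OF null])
qed

section \<open>A smoothed indicator function\<close>

text \<open>
  An approximation of the indicator of the positive reals that vanishes for \<open>s \<le>
  \<epsilon>\<close>, which gives the test functions compact support, and for which
  \<open>s\<close> times the derivative is bounded independently of \<open>\<epsilon>\<close>.
\<close>
definition smooth_step :: "real \<Rightarrow> real \<Rightarrow> real" where
  "smooth_step \<epsilon> s = (max 0 (s - \<epsilon>))\<^sup>2 / (\<epsilon>\<^sup>2 + (max 0 (s - \<epsilon>))\<^sup>2)"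

definition smooth_step' :: "real \<Rightarrow> real \<Rightarrow> real" where
  "smooth_step' \<epsilon> s = 2 * max 0 (s - \<epsilon>) * \<epsilon>\<^sup>2 / (\<epsilon>\<^sup>2 + (max 0 (s - \<epsilon>))\<^sup>2)\<^sup>2"

lemma smooth_step_deriv:
  assumes "\<epsilon> > 0"
  shows "(smooth_step \<epsilon> has_real_derivative smooth_step' \<epsilon> s) (at s)" "continuous_on UNIV (smooth_step' \<epsilon>)"
    "smooth_step' \<epsilon> s \<ge> 0" "s \<le> \<epsilon> \<Longrightarrow> smooth_step \<epsilon> s = 0" "s \<le> \<epsilon> \<Longrightarrow> smooth_step' \<epsilon> s = 0"
    "smooth_step \<epsilon> s \<ge> 0" "smooth_step \<epsilon> s \<le> 1"
proof -
  have pos: "\<epsilon>\<^sup>2 + (max 0 (s - \<epsilon>))\<^sup>2 > 0" for s by (rule add_pos_nonneg) (use assms in simp_all)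
  have m: "((\<lambda>s. (max 0 (s - \<epsilon>))\<^sup>2) has_real_derivative 2 * max 0 (s - \<epsilon>)) (at s)"
  proof -
    have "((\<lambda>t. (max 0 t)\<^sup>2) has_real_derivative real 2 * max 0 (s - \<epsilon>) ^ (2 - 1)) (at (s - \<epsilon>))"
      by (rule max_power_deriv) simp
    moreover have "((\<lambda>s. s - \<epsilon>) has_real_derivative 1) (at s)" by (auto intro!: derivative_eq_intros)
    ultimately have "((\<lambda>s. (max 0 (s - \<epsilon>))\<^sup>2) has_real_derivative real 2 * max 0 (s - \<epsilon>) ^ (2 - 1) * 1) (at s)"
      by (rule DERIV_chain2[where f="\<lambda>t. (max 0 t)\<^sup>2" and g="\<lambda>s. s - \<epsilon>"])
    then show ?thesis by simp
  qed
  have "((\<lambda>s. (max 0 (s - \<epsilon>))\<^sup>2 / (\<epsilon>\<^sup>2 + (max 0 (s - \<epsilon>))\<^sup>2)) has_real_derivative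
     (2 * max 0 (s - \<epsilon>) * (\<epsilon>\<^sup>2 + (max 0 (s - \<epsilon>))\<^sup>2) - (max 0 (s - \<epsilon>))\<^sup>2 * (0 + 2 * max 0 (s - \<epsilon>))) /
      ((\<epsilon>\<^sup>2 + (max 0 (s - \<epsilon>))\<^sup>2) * (\<epsilon>\<^sup>2 + (max 0 (s - \<epsilon>))\<^sup>2))) (at s)"
    by (rule DERIV_divide[OF m DERIV_add[OF DERIV_const m]]) (use pos[of s] in linarith)
  moreover have "(2 * y * (\<epsilon>\<^sup>2 + y\<^sup>2) - y\<^sup>2 * (0 + 2 * y)) / ((\<epsilon>\<^sup>2 + y\<^sup>2) * (\<epsilon>\<^sup>2 + y\<^sup>2)) = 2 * y * \<epsilon>\<^sup>2 / (\<epsilon>\<^sup>2 + y\<^sup>2)\<^sup>2" for y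
    by (simp add: power2_eq_square algebra_simps)
  ultimately show "(smooth_step \<epsilon> has_real_derivative smooth_step' \<epsilon> s) (at s)"
    unfolding smooth_step_def smooth_step'_def by simp
  show "continuous_on UNIV (smooth_step' \<epsilon>)"
    unfolding smooth_step'_def
    by (intro continuous_on_divide continuous_on_mult continuous_on_const continuous_on_power continuous_on_add continuous_on_max continuous_on_diff continuous_on_id ballI)
      (use pos in \<open>metis less_irrefl zero_eq_power2\<close>)
  show "smooth_step' \<epsilon> s \<ge> 0" unfolding smooth_step'_def by simp
  show "smooth_step \<epsilon> s \<ge> 0" "smooth_step \<epsilon> s \<le> 1" unfolding smooth_step_def using pos[of s] by (auto simp: divide_le_eq)
qed (auto simp: smooth_step_def smooth_step'_def)

text \<open>
  For \<open>s > \<epsilon>\<close> the product is \<open>(2 y\<^sup>2 \<epsilon>\<^sup>2 + 2 y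
  \<epsilon>\<^sup>3) / (\<epsilon>\<^sup>2 + y\<^sup>2)\<^sup>2\<close> with \<open>y = s -
  \<epsilon>\<close>, and \<open>2 y \<epsilon> \<le> \<epsilon>\<^sup>2 + y\<^sup>2\<close>.
  This is the dominating constant when \<open>\<epsilon>\<close> tends to \<open>0\<close>.
\<close>
lemma smooth_step'_bound:
  assumes "\<epsilon> > 0"
  shows "\<bar>s * smooth_step' \<epsilon> s\<bar> \<le> 2"
proof (cases "s \<le> \<epsilon>")
  case True then show ?thesis by (simp add: smooth_step_deriv(5)[OF assms])
next
  case False
  define y where "y = s - \<epsilon>"
  have y: "y > 0" "max 0 (s - \<epsilon>) = y" "s = y + \<epsilon>" using False by (auto simp: y_def)
  have p: "(\<epsilon>\<^sup>2 + y\<^sup>2)\<^sup>2 > 0" using assms by (simp add: add_pos_nonneg)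
  have a: "2 * (y * \<epsilon>) \<le> \<epsilon>\<^sup>2 + y\<^sup>2" using sum_squares_bound[of y \<epsilon>] by (simp add: power2_eq_square algebra_simps)
  have ye: "0 \<le> y * \<epsilon>" using y assms by simp
  have "2 * (y * \<epsilon>) * (2 * (y * \<epsilon>)) \<le> (\<epsilon>\<^sup>2 + y\<^sup>2) * (\<epsilon>\<^sup>2 + y\<^sup>2)" by (intro mult_mono a) (use ye in auto)
  moreover have "2 * (y * \<epsilon>) * \<epsilon>\<^sup>2 \<le> (\<epsilon>\<^sup>2 + y\<^sup>2) * (\<epsilon>\<^sup>2 + y\<^sup>2)" by (intro mult_mono a) (use ye in auto)
  moreover have "s * (2 * y * \<epsilon>\<^sup>2) = 2 * (y * \<epsilon>) * (y * \<epsilon>) + 2 * (y * \<epsilon>) * \<epsilon>\<^sup>2"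
    unfolding y(3) by (simp add: power2_eq_square algebra_simps)
  moreover have "0 \<le> y * \<epsilon> * (y * \<epsilon>)" by simp
  ultimately have "s * (2 * y * \<epsilon>\<^sup>2) \<le> 2 * (\<epsilon>\<^sup>2 + y\<^sup>2)\<^sup>2" unfolding power2_eq_square[of "\<epsilon>\<^sup>2 + y\<^sup>2"] by linarith
  then have "s * (2 * y * \<epsilon>\<^sup>2) / (\<epsilon>\<^sup>2 + y\<^sup>2)\<^sup>2 \<le> 2" using p by (simp add: divide_le_eq)
  moreover have "0 \<le> s * (2 * y * \<epsilon>\<^sup>2) / (\<epsilon>\<^sup>2 + y\<^sup>2)\<^sup>2" using y assms by simp
  ultimately show ?thesis unfolding smooth_step'_def y(2) by simp
qed

lemma smooth_step_limit:
  assumes "s \<ge> 0" and e: "e \<longlonglongrightarrow> 0" and "\<And>m. e m > 0"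
  shows "(\<lambda>m. smooth_step (e m) s) \<longlonglongrightarrow> (if s > 0 then 1 else 0)" "(\<lambda>m. s * smooth_step' (e m) s) \<longlonglongrightarrow> 0"
proof -
  show "(\<lambda>m. smooth_step (e m) s) \<longlonglongrightarrow> (if s > 0 then 1 else 0)"
  proof (cases "s > 0")
    case True
    have "(\<lambda>m. (max 0 (s - e m))\<^sup>2 / ((e m)\<^sup>2 + (max 0 (s - e m))\<^sup>2)) \<longlonglongrightarrow> (max 0 (s - 0))\<^sup>2 / (0\<^sup>2 + (max 0 (s - 0))\<^sup>2)"
      by (intro tendsto_intros e) (use True in simp)
    then show ?thesis using True by (simp add: smooth_step_def)
  qed (use assms smooth_step_deriv(4) in \<open>simp add: less_imp_le\<close>)
  show "(\<lambda>m. s * smooth_step' (e m) s) \<longlonglongrightarrow> 0"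
  proof (cases "s > 0")
    case True
    have "(\<lambda>m. s * (2 * max 0 (s - e m) * (e m)\<^sup>2 / ((e m)\<^sup>2 + (max 0 (s - e m))\<^sup>2)\<^sup>2)) \<longlonglongrightarrow>
       s * (2 * max 0 (s - 0) * 0\<^sup>2 / (0\<^sup>2 + (max 0 (s - 0))\<^sup>2)\<^sup>2)"
      by (intro tendsto_intros e) (use True in simp)
    then show ?thesis by (simp add: smooth_step'_def)
  qed (use assms in simp)
qed

section \<open>Uniform bounds\<close>

lemma continuous_bounded_on_cball:
  fixes f :: "'a::euclidean_space \<Rightarrow> real"
  assumes "continuous_on UNIV f"
  shows "\<exists>D\<ge>0. \<forall>x. norm x \<le> r \<longrightarrow> \<bar>f x\<bar> \<le> D"
proof -
  have "bounded (f ` cball 0 r)"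
    by (rule compact_imp_bounded[OF compact_continuous_image[OF continuous_on_subset[OF assms subset_UNIV] compact_cball]])
  then obtain D where "D > 0" "\<forall>y\<in>f ` cball 0 r. norm y \<le> D" using bounded_pos by blast
  then show ?thesis by (intro exI[of _ D]) (auto simp: less_imp_le)
qed

lemma integrand_bound:
  assumes a: "\<alpha> \<ge> 0"
  shows "\<exists>C\<ge>0. \<forall>s q (H::real^'n^'n). 0 < s \<and> s \<le> R \<and> 0 \<le> q \<and> q \<le> R\<^sup>2 \<and> norm H \<le> R \<longrightarrow> \<bar>integrand \<alpha> k s q H\<bar> \<le> C"
proof -
  have "\<exists>D\<ge>0. \<forall>H::real^'n^'n. norm H \<le> R \<longrightarrow> \<bar>msig j H\<bar> \<le> D" for j
    by (rule continuous_bounded_on_cball) (intro continuous_on_msig continuous_on_component continuous_on_id)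
  then obtain D where D: "\<And>j. D j \<ge> 0" "\<And>j (H::real^'n^'n). norm H \<le> R \<Longrightarrow> \<bar>msig j H\<bar> \<le> D j" by metis
  show ?thesis
  proof (intro exI[of _ "\<Sum>j\<le>k. \<bar>eco \<alpha> k j\<bar> * R powr (\<alpha> + real j) * (R\<^sup>2) ^ (k - j) * D j"] conjI allI impI)
    show "0 \<le> (\<Sum>j\<le>k. \<bar>eco \<alpha> k j\<bar> * R powr (\<alpha> + real j) * (R\<^sup>2) ^ (k - j) * D j)"
      by (intro sum_nonneg mult_nonneg_nonneg D) auto
    fix s q and H :: "real^'n^'n" assume h: "0 < s \<and> s \<le> R \<and> 0 \<le> q \<and> q \<le> R\<^sup>2 \<and> norm H \<le> R"
    show "\<bar>integrand \<alpha> k s q H\<bar> \<le> (\<Sum>j\<le>k. \<bar>eco \<alpha> k j\<bar> * R powr (\<alpha> + real j) * (R\<^sup>2) ^ (k - j) * D j)"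
      unfolding integrand_def
    proof (rule order_trans[OF sum_abs sum_mono], unfold abs_mult)
      fix j
      have "\<bar>s powr (\<alpha> + real j)\<bar> \<le> R powr (\<alpha> + real j)" using h a by (simp add: powr_mono2)
      moreover have "\<bar>q ^ (k - j)\<bar> \<le> (R\<^sup>2) ^ (k - j)" using h by (simp add: power_mono)
      moreover have "\<bar>msig j H\<bar> \<le> D j" using h D(2) by blast
      ultimately show "\<bar>eco \<alpha> k j\<bar> * \<bar>s powr (\<alpha> + real j)\<bar> * \<bar>q ^ (k - j)\<bar> * \<bar>msig j H\<bar> \<le> \<bar>eco \<alpha> k j\<bar> * R powr (\<alpha> + real j) * (R\<^sup>2) ^ (k - j) * D j"
        by (intro mult_mono mult_nonneg_nonneg) auto
    qed
  qed
qed

text \<open>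
  The bound holds down to \<open>s = 0\<close>: the term with \<open>j = 0\<close> vanishes, and
  for \<open>j \<ge> 1\<close> the exponent \<open>\<alpha> + j - 1\<close> is nonnegative.
\<close>
lemma drift_form_bound:
  assumes a: "\<alpha> \<ge> 0"
  shows "\<exists>C\<ge>0. \<forall>s (p::real^'n) H y. 0 < s \<and> s \<le> R \<and> norm p \<le> R \<and> norm H \<le> R \<and> norm y \<le> R \<longrightarrow> \<bar>drift_form \<alpha> k s p H y\<bar> \<le> C"
proof -
  have "\<exists>D\<ge>0. \<forall>z::(real^'n^'n) \<times> (real^'n) \<times> (real^'n). norm z \<le> 3 * R \<longrightarrow> \<bar>dsig j (fst z) (outer (fst (snd z)) (snd (snd z)))\<bar> \<le> D" for j
    by (rule continuous_bounded_on_cball)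
      (intro continuous_on_outer_dsig continuous_on_component continuous_on_fst continuous_on_snd continuous_on_id)
  then obtain D where D: "\<And>j. D j \<ge> 0" "\<And>j (z::(real^'n^'n) \<times> (real^'n) \<times> (real^'n)). norm z \<le> 3 * R \<Longrightarrow> \<bar>dsig j (fst z) (outer (fst (snd z)) (snd (snd z)))\<bar> \<le> D j"
    by metis
  show ?thesis
  proof (intro exI[of _ "\<Sum>j\<le>k. \<bar>dco \<alpha> k j * (\<alpha> + real j)\<bar> * R powr (\<alpha> + real j - 1) * (R\<^sup>2) ^ (k - j) * D j"] conjI allI impI)
    show "0 \<le> (\<Sum>j\<le>k. \<bar>dco \<alpha> k j * (\<alpha> + real j)\<bar> * R powr (\<alpha> + real j - 1) * (R\<^sup>2) ^ (k - j) * D j)"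
      by (intro sum_nonneg mult_nonneg_nonneg D) auto
    fix s and p y :: "real^'n" and H :: "real^'n^'n" assume h: "0 < s \<and> s \<le> R \<and> norm p \<le> R \<and> norm H \<le> R \<and> norm y \<le> R"
    show "\<bar>drift_form \<alpha> k s p H y\<bar> \<le> (\<Sum>j\<le>k. \<bar>dco \<alpha> k j * (\<alpha> + real j)\<bar> * R powr (\<alpha> + real j - 1) * (R\<^sup>2) ^ (k - j) * D j)"
      unfolding drift_form_def
    proof (rule order_trans[OF sum_abs sum_mono])
      fix j
      show "\<bar>dco \<alpha> k j * (\<alpha> + real j) * (s powr (\<alpha> + real j) / s) * (p \<bullet> p) ^ (k - j) * dsig j H (outer p y)\<bar>
        \<le> \<bar>dco \<alpha> k j * (\<alpha> + real j)\<bar> * R powr (\<alpha> + real j - 1) * (R\<^sup>2) ^ (k - j) * D j"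
      proof (cases "j = 0")
        case True
        then have "dco \<alpha> k j * (\<alpha> + real j) * (s powr (\<alpha> + real j) / s) * (p \<bullet> p) ^ (k - j) * dsig j H (outer p y) = 0" by simp
        moreover have "0 \<le> \<bar>dco \<alpha> k j * (\<alpha> + real j)\<bar> * R powr (\<alpha> + real j - 1) * (R\<^sup>2) ^ (k - j) * D j"
          by (intro mult_nonneg_nonneg D) auto
        ultimately show ?thesis by (simp only: abs_zero)
      next
        case False
        have "s powr (\<alpha> + real j) / s = s powr (\<alpha> + real j - 1)" using h by (simp add: powr_diff)
        then have "\<bar>s powr (\<alpha> + real j) / s\<bar> \<le> R powr (\<alpha> + real j - 1)" using h a False by (simp add: powr_mono2)
        moreover have "p \<bullet> p \<le> R\<^sup>2" using h by (simp add: dot_square_norm power_mono)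
        then have "\<bar>(p \<bullet> p) ^ (k - j)\<bar> \<le> (R\<^sup>2) ^ (k - j)" by (simp add: power_mono)
        moreover have "\<bar>dsig j H (outer p y)\<bar> \<le> D j"
        proof -
          have "norm (H, p, y) \<le> norm H + (norm p + norm y)"
            by (rule order_trans[OF norm_Pair_le]) (simp add: norm_Pair_le)
          then show ?thesis using D(2)[of "(H, p, y)" j] h by simp
        qed
        ultimately show ?thesis
          unfolding abs_mult by (intro mult_mono mult_nonneg_nonneg) auto
      qed
    qed
  qed
qed

lemma norm_vec_le_sum: "norm (x::'a::real_normed_vector^'n) \<le> (\<Sum>i\<in>UNIV. norm (x $ i))"
  unfolding norm_vec_def by (rule L2_set_le_sum) simp

lemma C2_closure_bounds:
  fixes f :: "real^'n \<Rightarrow> real"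
  assumes f: "f \<in> C2_closure \<Omega>" and \<Omega>: "bounded \<Omega>"
  shows "\<exists>R. \<forall>x\<in>\<Omega>. \<bar>f x\<bar> \<le> R \<and> norm (grad f x) \<le> R \<and> norm (hess f x) \<le> R"
proof -
  have cl: "compact (closure \<Omega>)" using \<Omega> by simp
  have bd: "\<exists>B. \<forall>x\<in>\<Omega>. \<bar>g x\<bar> \<le> B" if "continuous_on (closure \<Omega>) h" "\<forall>x\<in>\<Omega>. h x = g x" for g h :: "real^'n \<Rightarrow> real"
  proof -
    have "bounded (h ` closure \<Omega>)" by (rule compact_imp_bounded[OF compact_continuous_image[OF that(1) cl]])
    then obtain B where "\<forall>y\<in>h ` closure \<Omega>. norm y \<le> B" unfolding bounded_iff by blast
    then show ?thesis using that(2) closure_subset by (intro exI[of _ B]) fastforce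
  qed
  from f have c: "continuous_on (closure \<Omega>) f" "\<And>i. \<exists>g. continuous_on (closure \<Omega>) g \<and> (\<forall>x\<in>\<Omega>. g x = pderiv_vec i f x)"
    "\<And>i j. \<exists>g. continuous_on (closure \<Omega>) g \<and> (\<forall>x\<in>\<Omega>. g x = pderiv_vec i (pderiv_vec j f) x)"
    unfolding C2_closure_def by auto
  obtain B0 where B0: "\<forall>x\<in>\<Omega>. \<bar>f x\<bar> \<le> B0" using bd[OF c(1)] by blast
  have "\<exists>B. \<forall>x\<in>\<Omega>. \<bar>pderiv_vec i f x\<bar> \<le> B" for i using bd c(2)[of i] by blast
  then obtain B1 where B1: "\<And>i x. x \<in> \<Omega> \<Longrightarrow> \<bar>pderiv_vec i f x\<bar> \<le> B1 i" by metis
  have "\<exists>B. \<forall>x\<in>\<Omega>. \<bar>pderiv_vec i (pderiv_vec j f) x\<bar> \<le> B" for i j using bd c(3)[of i j] by blast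
  then obtain B2 where B2: "\<And>i j x. x \<in> \<Omega> \<Longrightarrow> \<bar>pderiv_vec i (pderiv_vec j f) x\<bar> \<le> B2 i j" by metis
  define b1 where "b1 = (\<Sum>i\<in>UNIV. B1 i)"
  define b2 where "b2 = (\<Sum>i\<in>UNIV. \<Sum>j\<in>UNIV. B2 i j)"
  have "norm (grad f x) \<le> b1" if "x \<in> \<Omega>" for x
    unfolding b1_def by (rule order_trans[OF norm_vec_le_sum sum_mono]) (simp add: B1[OF that])
  moreover have "norm (hess f x) \<le> b2" if "x \<in> \<Omega>" for x
    unfolding b2_def
    by (rule order_trans[OF norm_vec_le_sum sum_mono[OF order_trans[OF norm_vec_le_sum sum_mono]]]) (simp add: hess_def B2[OF that])
  ultimately show ?thesis using B0 by (intro exI[of _ "max B0 (max b1 b2)"]) (auto simp: le_max_iff_disj)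
qed

section \<open>Comparison of the functionals\<close>

lemma variation_forms_scale:
  "gradient_form \<alpha> k s p H x (c *\<^sub>R y) = c * gradient_form \<alpha> k s p H x (y::real^'n)"
  "drift_form \<alpha> k s p H (c *\<^sub>R y) = c * drift_form \<alpha> k s p H (y::real^'n)"
  unfolding gradient_form_def drift_form_def dsig_outer_scale by (simp_all add: sum_distrib_left mult_ac)

text \<open>
  Let \<open>I t\<close> be the integral of \<open>h(\<phi>)\<close> times the integrand of
  \<open>v + t \<phi>\<close>. By \<open>first_variation\<close> with \<open>\<psi> =
  h(\<phi>)\<close>, whose gradient is \<open>h'(\<phi>) \<nabla>\<phi>\<close>, the derivative
  of \<open>I\<close> is at most \<open>- \<integral> \<phi> h'(\<phi>)
  Z(\<nabla>\<phi>)\<close>, hence at most the right-hand side; the mean value theorem on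
  \<open>[0,1]\<close> concludes.
\<close>
lemma truncated_energy_comparison:
  fixes v \<phi> :: "real^'n \<Rightarrow> real" and h h' :: "real \<Rightarrow> real"
  assumes v: "v \<in> C2_on \<Omega>" and f: "\<phi> \<in> C2_on \<Omega>" and \<Omega>: "open \<Omega>" "compact K" "K \<subseteq> \<Omega>"
    and a: "\<alpha> \<ge> 0" and k: "k \<le> CARD('n)"
    and nn: "\<And>x. x \<in> \<Omega> \<Longrightarrow> \<phi> x \<ge> 0"
    and pos: "\<And>x t. x \<in> \<Omega> \<Longrightarrow> 0 \<le> t \<Longrightarrow> t \<le> 1 \<Longrightarrow> v x + t * \<phi> x > 0"
    and cone: "\<And>x t. x \<in> \<Omega> \<Longrightarrow> 0 \<le> t \<Longrightarrow> t \<le> 1 \<Longrightarrow>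
      (v x + t * \<phi> x) *\<^sub>R (hess v x + t *\<^sub>R hess \<phi> x) - ((grad v x + t *\<^sub>R grad \<phi> x) \<bullet> (grad v x + t *\<^sub>R grad \<phi> x) / 2) *\<^sub>R mat 1 \<in> gcone k"
    and C: "\<And>x t. x \<in> \<Omega> \<Longrightarrow> 0 \<le> t \<Longrightarrow> t \<le> 1 \<Longrightarrow>
      \<bar>drift_form \<alpha> k (v x + t * \<phi> x) (grad v x + t *\<^sub>R grad \<phi> x) (hess v x + t *\<^sub>R hess \<phi> x) (grad \<phi> x)\<bar> \<le> C"
    and h: "\<And>s. (h has_real_derivative h' s) (at s)" "continuous_on UNIV h'" "\<And>s. h' s \<ge> 0"
      "\<And>x. x \<in> \<Omega> - K \<Longrightarrow> h (\<phi> x) = 0" "\<And>x. x \<in> \<Omega> - K \<Longrightarrow> h' (\<phi> x) = 0"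
  shows "(LINT x:\<Omega>|lborel. h (\<phi> x) *
      (integrand \<alpha> k (v x + \<phi> x) ((grad v x + grad \<phi> x) \<bullet> (grad v x + grad \<phi> x)) (hess v x + hess \<phi> x)
       - integrand \<alpha> k (v x) (grad v x \<bullet> grad v x) (hess v x)))
    \<le> C * (LINT x:\<Omega>|lborel. \<phi> x * h' (\<phi> x))"
proof -
  define w where "w t x = v x + t * \<phi> x" for t x
  define p where "p t x = grad v x + t *\<^sub>R grad \<phi> x" for t x
  define H where "H t x = hess v x + t *\<^sub>R hess \<phi> x" for t x
  define F where "F t x = (if x \<in> \<Omega> then h (\<phi> x) * integrand \<alpha> k (w t x) (p t x \<bullet> p t x) (H t x) else 0)" for t x
  define F' where "F' t x = (if x \<in> \<Omega> then h (\<phi> x) * integrand_deriv \<alpha> k (w t x) (p t x) (H t x) (\<phi> x) (grad \<phi> x) (hess \<phi> x) else 0)" for t x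
  define I where "I = (\<lambda>t. LINT x:\<Omega>|lborel. h (\<phi> x) * integrand \<alpha> k (w t x) (p t x \<bullet> p t x) (H t x))"
  note cv = C2_on_continuous[OF v] and cf = C2_on_continuous[OF f]
  have ch: "continuous_on UNIV h" using h(1) DERIV_continuous continuous_at_imp_continuous_on by blast
  have chf: "continuous_on \<Omega> (\<lambda>x. h (\<phi> x))" "continuous_on \<Omega> (\<lambda>x. h' (\<phi> x))"
    using continuous_on_compose2[OF ch cf(1)] continuous_on_compose2[OF h(2) cf(1)] by auto
  have wC2: "w t \<in> C2_on \<Omega>" "x \<in> \<Omega> \<Longrightarrow> grad (w t) x = p t x" "x \<in> \<Omega> \<Longrightarrow> hess (w t) x = H t x" for t x
    using C2_on_lincomb[OF f v \<Omega>(1), where t=t] unfolding w_def p_def H_def by auto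
  have cw: "continuous_on \<Omega> (w t)" "continuous_on \<Omega> (p t)" "continuous_on \<Omega> (\<lambda>x. H t x $ i $ j)" for t i j
    unfolding w_def p_def H_def vector_add_component vector_scaleR_component
    by (intro continuous_on_add continuous_on_mult continuous_on_scaleR continuous_on_const cv cf)+
  have wp: "x \<in> \<Omega> \<Longrightarrow> w t x > 0" if "t \<in> {0..1}" for t x using pos that unfolding w_def by auto

  obtain a b :: "real^'n" where ab: "K \<subseteq> cbox a b" using bounded_subset_cbox_symmetric[OF compact_imp_bounded[OF \<Omega>(2)]] by blast
  have conv: "g integrable_on cbox a b" "(LINT x:\<Omega>|lborel. g0 x) = integral (cbox a b) g"
    if g: "continuous_on \<Omega> g0" "\<And>x. x \<in> \<Omega> - K \<Longrightarrow> g0 x = 0" "g = (\<lambda>x. if x \<in> \<Omega> then g0 x else 0)" for g g0 :: "real^'n \<Rightarrow> real"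
  proof -
    have i: "integrable lborel g" unfolding g(3)
      by (rule integrable_compact_support[OF continuous_extend_zero[OF \<Omega> g(1,2)] _ \<Omega>(2)]) (use g(2) in auto)
    have e: "(\<lambda>x. indicator (cbox a b) x *\<^sub>R g x) = g"
      using ab g(2) unfolding g(3) by (fastforce simp: fun_eq_iff indicator_def)
    have s: "set_integrable lborel (cbox a b) g" unfolding set_integrable_def e by (rule i)
    show "g integrable_on cbox a b" by (rule set_borel_integral_eq_integral(1)[OF s])
    have "(LINT x:\<Omega>|lborel. g0 x) = integral\<^sup>L lborel g"
      unfolding set_lebesgue_integral_def by (rule Bochner_Integration.integral_cong) (auto simp: g(3) indicator_def)
    also have "\<dots> = (LINT x:cbox a b|lborel. g x)" unfolding set_lebesgue_integral_def e ..
    finally show "(LINT x:\<Omega>|lborel. g0 x) = integral (cbox a b) g"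
      using set_borel_integral_eq_integral(2)[OF s] by simp
  qed
  have cFi: "F t integrable_on cbox a b" "I t = integral (cbox a b) (F t)" if t: "t \<in> {0..1}" for t
  proof -
    have c: "continuous_on \<Omega> (\<lambda>x. h (\<phi> x) * integrand \<alpha> k (w t x) (p t x \<bullet> p t x) (H t x))"
      by (rule continuous_on_mult[OF chf(1) continuous_on_integrand[OF cw(1) wp[OF t] continuous_on_inner[OF cw(2,2)] cw(3)]])
    show "F t integrable_on cbox a b" "I t = integral (cbox a b) (F t)"
      unfolding I_def by (rule conv[OF c]; simp add: h(4) F_def fun_eq_iff)+
  qed
  have dF: "((\<lambda>t. F t x) has_field_derivative F' t x) (at t within {0..1})" if t: "t \<in> {0..1}" for t x
  proof (cases "x \<in> \<Omega>")
    case True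
    have "((\<lambda>t. h (\<phi> x) * integrand \<alpha> k (w t x) (p t x \<bullet> p t x) (H t x)) has_real_derivative
        h (\<phi> x) * integrand_deriv \<alpha> k (w t x) (p t x) (H t x) (\<phi> x) (grad \<phi> x) (hess \<phi> x)) (at t)"
      using DERIV_cmult[OF integrand_line_deriv[OF wp[OF t True, unfolded w_def]]] unfolding w_def p_def H_def .
    then show ?thesis unfolding F_def F'_def using True by (simp add: has_field_derivative_at_within)
  qed (simp add: F_def F'_def)
  \<comment> \<open>The integrand vanishes outside \<open>K\<close>, so its extension by zero is
    jointly continuous on the whole box, as differentiation under the integral requires.\<close>
  have cF': "continuous_on ({0..1} \<times> cbox a b) (\<lambda>(t, x). F' t x)"
  proof -
    have cs: "continuous_on ({0..1} \<times> \<Omega>) (\<lambda>z. g (snd z))" if "continuous_on \<Omega> g" for g :: "real^'n \<Rightarrow> 'b::topological_space"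
      by (rule continuous_on_compose2[OF that continuous_on_snd[OF continuous_on_id]]) auto
    have ct: "continuous_on ({0..1} \<times> \<Omega>) (\<lambda>z::real \<times> (real^'n). fst z)" by (intro continuous_on_fst continuous_on_id)
    have 1: "continuous_on ({0..1} \<times> \<Omega>) (\<lambda>z. h (\<phi> (snd z)) * integrand_deriv \<alpha> k (w (fst z) (snd z)) (p (fst z) (snd z)) (H (fst z) (snd z)) (\<phi> (snd z)) (grad \<phi> (snd z)) (hess \<phi> (snd z)))"
    proof (rule continuous_on_mult[OF cs[OF chf(1)] continuous_on_integrand_deriv])
      show "continuous_on ({0..1} \<times> \<Omega>) (\<lambda>z. w (fst z) (snd z))"
        unfolding w_def by (intro continuous_on_add continuous_on_mult ct cs[OF cv(1)] cs[OF cf(1)])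
      show "continuous_on ({0..1} \<times> \<Omega>) (\<lambda>z. p (fst z) (snd z))"
        unfolding p_def by (intro continuous_on_add continuous_on_scaleR ct cs[OF cv(4)] cs[OF cf(4)])
      show "continuous_on ({0..1} \<times> \<Omega>) (\<lambda>z. H (fst z) (snd z) $ i $ j)" for i j
        unfolding H_def vector_add_component vector_scaleR_component real_scaleR_def
        by (intro continuous_on_add continuous_on_mult ct cs[OF cv(3)] cs[OF cf(3)])
      show "w (fst z) (snd z) > 0" if "z \<in> {0..1} \<times> \<Omega>" for z using wp that by auto
    qed (intro cs[OF cf(1)] cs[OF cf(4)] cs[OF cf(3)])+
    have "continuous_on ({0..1} \<times> \<Omega> \<union> {0..1} \<times> (- K)) (\<lambda>(t, x). F' t x)"
    proof (rule continuous_on_Un_local_open)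
      have oK: "open (- K)" using \<Omega>(2) by (simp add: compact_imp_closed open_Compl)
      have U: "{0..1} \<times> \<Omega> = ({0..1} \<times> \<Omega> \<union> {0..1::real} \<times> (- K)) \<inter> (UNIV \<times> \<Omega>)"
        "{0..1} \<times> (- K) = ({0..1} \<times> \<Omega> \<union> {0..1::real} \<times> (- K)) \<inter> (UNIV \<times> (- K))" by auto
      show "openin (top_of_set ({0..1} \<times> \<Omega> \<union> {0..1::real} \<times> (- K))) ({0..1} \<times> \<Omega>)"
        by (subst (2) U(1), rule openin_open_Int) (simp add: open_Times \<Omega>(1))
      show "openin (top_of_set ({0..1} \<times> \<Omega> \<union> {0..1::real} \<times> (- K))) ({0..1} \<times> (- K))"
        by (subst (2) U(2), rule openin_open_Int) (simp add: open_Times oK)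
      show "continuous_on ({0..1} \<times> \<Omega>) (\<lambda>(t, x). F' t x)"
        by (rule continuous_on_eq[OF 1]) (auto simp: F'_def)
      have "F' t x = 0" if "x \<in> - K" for t x using that h(4) unfolding F'_def by auto
      then show "continuous_on ({0..1} \<times> (- K)) (\<lambda>(t, x). F' t x)"
        by (intro continuous_on_eq[OF continuous_on_const[of _ 0]]) auto
    qed
    moreover have "{0..1::real} \<times> cbox a b \<subseteq> {0..1} \<times> \<Omega> \<union> {0..1} \<times> (- K)" using \<Omega>(3) by auto
    ultimately show ?thesis by (rule continuous_on_subset)
  qed
  have dI: "(I has_field_derivative integral (cbox a b) (F' t)) (at t within {0..1})" if t: "t \<in> {0..1}" for t
  proof -
    have "((\<lambda>t. integral (cbox a b) (F t)) has_field_derivative integral (cbox a b) (F' t)) (at t within {0..1})"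
      by (rule leibniz_rule_field_derivative[OF dF cFi(1) cF' t]) auto
    then show ?thesis
      by (rule has_field_derivative_transform_within[OF _ zero_less_one t]) (simp add: cFi(2))
  qed
  have up: "integral (cbox a b) (F' t) \<le> C * (LINT x:\<Omega>|lborel. \<phi> x * h' (\<phi> x))" if t: "t \<in> {0..1}" for t
  proof -
    have wpt: "\<And>x. x \<in> \<Omega> \<Longrightarrow> w t x > 0" using wp[OF t] .
    have c: "continuous_on \<Omega> (\<lambda>x. h (\<phi> x) * integrand_deriv \<alpha> k (w t x) (p t x) (H t x) (\<phi> x) (grad \<phi> x) (hess \<phi> x))"
      by (rule continuous_on_mult[OF chf(1) continuous_on_integrand_deriv[OF cw(1) wpt cw(2,3) cf(1,4,3)]])
    have e1: "integral (cbox a b) (F' t) = (LINT x:\<Omega>|lborel. h (\<phi> x) * integrand_deriv \<alpha> k (w t x) (p t x) (H t x) (\<phi> x) (grad \<phi> x) (hess \<phi> x))"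
      by (rule conv(2)[OF c, symmetric]) (simp_all add: h(4) F'_def fun_eq_iff)
    define B where "B x = gradient_form \<alpha> k (w t x) (p t x) (H t x) (grad \<phi> x) (h' (\<phi> x) *\<^sub>R grad \<phi> x) + \<phi> x * drift_form \<alpha> k (w t x) (p t x) (H t x) (h' (\<phi> x) *\<^sub>R grad \<phi> x)" for x
    have dpsi: "((\<lambda>x. h (\<phi> x)) has_derivative (\<lambda>y. (h' (\<phi> x) *\<^sub>R grad \<phi> x) \<bullet> y)) (at x)" if "x \<in> \<Omega>" for x
      using DERIV_compose_FDERIV[OF h(1) C2_onD(1)[OF f that]] by (simp add: mult.commute)
    have cD: "continuous_on \<Omega> (\<lambda>x. h' (\<phi> x) *\<^sub>R grad \<phi> x)" by (rule continuous_on_scaleR[OF chf(2) cf(4)])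
    have sc: "(LINT x:\<Omega>|lborel. g x) = (LINT x:\<Omega>|lborel. g' x)" if "\<And>x. x \<in> \<Omega> \<Longrightarrow> g x = g' x" for g g' :: "real^'n \<Rightarrow> real"
      unfolding set_lebesgue_integral_def by (rule Bochner_Integration.integral_cong) (auto simp: that indicator_def)
    have "(LINT x:\<Omega>|lborel. h (\<phi> x) * integrand_deriv \<alpha> k (w t x) (p t x) (H t x) (\<phi> x) (grad \<phi> x) (hess \<phi> x))
        = (LINT x:\<Omega>|lborel. h (\<phi> x) * integrand_deriv \<alpha> k (w t x) (grad (w t) x) (hess (w t) x) (\<phi> x) (grad \<phi> x) (hess \<phi> x))"
      by (rule sc) (simp add: wC2)
    also have "\<dots> = - (LINT x:\<Omega>|lborel. gradient_form \<alpha> k (w t x) (grad (w t) x) (hess (w t) x) (grad \<phi> x) (h' (\<phi> x) *\<^sub>R grad \<phi> x)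
         + \<phi> x * drift_form \<alpha> k (w t x) (grad (w t) x) (hess (w t) x) (h' (\<phi> x) *\<^sub>R grad \<phi> x))"
      by (rule first_variation[OF wC2(1) f \<Omega> wpt dpsi cD h(4)])
    also have "\<dots> = - (LINT x:\<Omega>|lborel. B x)" unfolding B_def by (rule arg_cong[where f=uminus], rule sc) (simp add: wC2)
    also have "\<dots> \<le> C * (LINT x:\<Omega>|lborel. \<phi> x * h' (\<phi> x))"
    proof -
      have iB: "set_integrable lborel \<Omega> B"
        unfolding B_def
        by (rule set_integrable_csupp[OF \<Omega> continuous_on_add[OF continuous_on_variation_forms(1)[OF cw(1) wpt cw(2,3) cf(4) cD]
             continuous_on_mult[OF cf(1) continuous_on_variation_forms(2)[OF cw(1) wpt cw(2,3) cf(4) cD]]]])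
          (simp_all add: h(5) variation_forms_scale(1)[where c=0, simplified] variation_forms_scale(2)[where c=0, simplified])
      have iP: "set_integrable lborel \<Omega> (\<lambda>x. C * (\<phi> x * h' (\<phi> x)))"
        by (rule set_integrable_csupp[OF \<Omega> continuous_on_mult[OF continuous_on_const continuous_on_mult[OF cf(1) chf(2)]]]) (simp add: h(5))
      have "- B x \<le> C * (\<phi> x * h' (\<phi> x))" if x: "x \<in> \<Omega>" for x
      proof -
        have "0 \<le> gradient_form \<alpha> k (w t x) (p t x) (H t x) (grad \<phi> x) (grad \<phi> x)"
          by (rule gradient_form_nonneg[OF a k wpt[OF x]]) (use cone[OF x, of t] t in \<open>simp add: w_def p_def H_def\<close>)
        then have 1: "0 \<le> h' (\<phi> x) * gradient_form \<alpha> k (w t x) (p t x) (H t x) (grad \<phi> x) (grad \<phi> x)" using h(3) by simp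
        have "- drift_form \<alpha> k (w t x) (p t x) (H t x) (grad \<phi> x) \<le> C"
          using C[OF x, of t] t unfolding w_def p_def H_def by auto
        then have "(\<phi> x * h' (\<phi> x)) * (- drift_form \<alpha> k (w t x) (p t x) (H t x) (grad \<phi> x)) \<le> (\<phi> x * h' (\<phi> x)) * C"
          using nn[OF x] h(3) by (intro mult_left_mono) auto
        then show ?thesis using 1 unfolding B_def variation_forms_scale by (simp add: mult_ac)
      qed
      then have "(LINT x:\<Omega>|lborel. - B x) \<le> (LINT x:\<Omega>|lborel. C * (\<phi> x * h' (\<phi> x)))"
        using iB iP unfolding set_integrable_def set_lebesgue_integral_def
        by (intro integral_mono) (auto simp: indicator_def)
      then show ?thesis by (simp add: set_lebesgue_integral_def)
    qed
    finally show ?thesis unfolding e1 .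
  qed
  obtain t where t: "t \<in> {0<..<1}" "I 1 - I 0 = integral (cbox a b) (F' t) * (1 - 0)"
    using mvt_simple[of 0 1 I "\<lambda>t d. integral (cbox a b) (F' t) * d"] dI
    unfolding has_field_derivative_def by auto
  have "(LINT x:\<Omega>|lborel. h (\<phi> x) *
      (integrand \<alpha> k (v x + \<phi> x) ((grad v x + grad \<phi> x) \<bullet> (grad v x + grad \<phi> x)) (hess v x + hess \<phi> x)
       - integrand \<alpha> k (v x) (grad v x \<bullet> grad v x) (hess v x))) = I 1 - I 0"
  proof -
    have c: "set_integrable lborel \<Omega> (\<lambda>x. h (\<phi> x) * integrand \<alpha> k (w t x) (p t x \<bullet> p t x) (H t x))" if t: "t \<in> {0..1}" for t
      by (rule set_integrable_csupp[OF \<Omega> continuous_on_mult[OF chf(1) continuous_on_integrand[OF cw(1) wp[OF t] continuous_on_inner[OF cw(2,2)] cw(3)]]])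
        (simp_all add: h(4))
    have "I 1 - I 0 = (LINT x:\<Omega>|lborel. h (\<phi> x) * integrand \<alpha> k (w 1 x) (p 1 x \<bullet> p 1 x) (H 1 x) - h (\<phi> x) * integrand \<alpha> k (w 0 x) (p 0 x \<bullet> p 0 x) (H 0 x))"
      unfolding I_def by (rule set_integral_diff(2)[symmetric]; rule c) auto
    then show ?thesis by (simp add: w_def p_def H_def right_diff_distrib)
  qed
  also have "\<dots> \<le> C * (LINT x:\<Omega>|lborel. \<phi> x * h' (\<phi> x))" using up[of t] t by auto
  finally show ?thesis .
qed

text \<open>
  Apply \<open>truncated_energy_comparison\<close> with \<open>h = smooth_step
  \<epsilon>\<close> for \<open>\<epsilon> = 1 / (m + 1)\<close> and let \<open>m\<close> tend
  to infinity by dominated convergence. In the limit only the set \<open>u > v\<close>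
  contributes; the contact set is dealt with by \<open>contact_set_jets_vanish\<close>.
\<close>
lemma energy_comparison:
  fixes u v :: "real^'n \<Rightarrow> real"
  assumes u: "u \<in> C2_closure \<Omega>" and v: "v \<in> C2_closure \<Omega>" and \<Omega>: "open \<Omega>" "bounded \<Omega>"
    and a: "\<alpha> \<ge> 0" and k: "k \<le> CARD('n)"
    and pos: "\<And>x. x \<in> \<Omega> \<Longrightarrow> u x > 0" "\<And>x. x \<in> \<Omega> \<Longrightarrow> v x > 0"
    and cone: "\<And>x. x \<in> \<Omega> \<Longrightarrow> A_matrix u x \<in> gcone k" "\<And>x. x \<in> \<Omega> \<Longrightarrow> A_matrix v x \<in> gcone k"
    and le: "\<And>x. x \<in> \<Omega> \<Longrightarrow> v x \<le> u x" and bd: "\<And>x. x \<in> frontier \<Omega> \<Longrightarrow> u x = v x"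
  shows "(LINT x:\<Omega>|lebesgue. integrand \<alpha> k (u x) (grad u x \<bullet> grad u x) (hess u x))
    \<le> (LINT x:\<Omega>|lebesgue. integrand \<alpha> k (v x) (grad v x \<bullet> grad v x) (hess v x))"
proof -
  define L where "L f x = integrand \<alpha> k (f x) (grad f x \<bullet> grad f x) (hess f x)" for f :: "real^'n \<Rightarrow> real" and x
  define \<phi> where "\<phi> x = u x + (-1) * v x" for x
  have uC2: "u \<in> C2_on \<Omega>" and vC2: "v \<in> C2_on \<Omega>" using u v by (auto simp: C2_closure_def)
  have f: "\<phi> \<in> C2_on \<Omega>" "x \<in> \<Omega> \<Longrightarrow> grad \<phi> x = grad u x + (-1) *\<^sub>R grad v x" "x \<in> \<Omega> \<Longrightarrow> hess \<phi> x = hess u x + (-1) *\<^sub>R hess v x" for x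
    using C2_on_lincomb[OF vC2 uC2 \<Omega>(1), where t="-1"] unfolding \<phi>_def by auto
  have nn: "\<phi> x \<ge> 0" if "x \<in> \<Omega>" for x using le[OF that] by (simp add: \<phi>_def)
  note cf = C2_on_continuous[OF f(1)]
  obtain Ru Rv where Ru: "\<forall>x\<in>\<Omega>. \<bar>u x\<bar> \<le> Ru \<and> norm (grad u x) \<le> Ru \<and> norm (hess u x) \<le> Ru"
    and Rv: "\<forall>x\<in>\<Omega>. \<bar>v x\<bar> \<le> Rv \<and> norm (grad v x) \<le> Rv \<and> norm (hess v x) \<le> Rv"
    using C2_closure_bounds[OF u \<Omega>(2)] C2_closure_bounds[OF v \<Omega>(2)] by blast
  define R0 where "R0 = max 0 (max Ru Rv)"
  define R where "R = 2 * R0"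
  have R0: "R0 \<ge> 0" by (simp add: R0_def)
  have Bu: "u x \<le> R0" "norm (grad u x) \<le> R0" "norm (hess u x) \<le> R0" "v x \<le> R0" "norm (grad v x) \<le> R0" "norm (hess v x) \<le> R0"
    if "x \<in> \<Omega>" for x using Ru Rv that unfolding R0_def by (force simp: le_max_iff_disj)+
  have mix: "norm (y + t *\<^sub>R (z + (-1) *\<^sub>R y)) \<le> R0" if "norm y \<le> R0" "norm z \<le> R0" "0 \<le> t" "t \<le> 1" for t and y z :: "'b::real_normed_vector"
  proof -
    have "y + t *\<^sub>R (z + (-1) *\<^sub>R y) = (1 - t) *\<^sub>R y + t *\<^sub>R z" by (simp add: algebra_simps)
    also have "norm \<dots> \<le> (1 - t) * norm y + t * norm z" using that by (intro order_trans[OF norm_triangle_ineq]) simp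
    also have "\<dots> \<le> (1 - t) * R0 + t * R0" using that by (intro add_mono mult_left_mono) auto
    finally show ?thesis by (simp add: algebra_simps)
  qed
  obtain C where C: "C \<ge> 0" "\<And>s (p::real^'n) H y. 0 < s \<Longrightarrow> s \<le> R \<Longrightarrow> norm p \<le> R \<Longrightarrow> norm H \<le> R \<Longrightarrow> norm y \<le> R \<Longrightarrow> \<bar>drift_form \<alpha> k s p H y\<bar> \<le> C"
    using drift_form_bound[OF a, of R k] by meson
  obtain C1 where C1: "C1 \<ge> 0" "\<And>s q (H::real^'n^'n). 0 < s \<Longrightarrow> s \<le> R0 \<Longrightarrow> 0 \<le> q \<Longrightarrow> q \<le> R0\<^sup>2 \<Longrightarrow> norm H \<le> R0 \<Longrightarrow> \<bar>integrand \<alpha> k s q H\<bar> \<le> C1"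
    using integrand_bound[OF a, of R0 k] by meson
  have Lb: "\<bar>L u x\<bar> \<le> C1" "\<bar>L v x\<bar> \<le> C1" if x: "x \<in> \<Omega>" for x
    unfolding L_def using Bu[OF x] pos[OF x] by (intro C1(2); simp add: dot_square_norm power_mono)+
  have wpos: "v x + t * \<phi> x > 0" if x: "x \<in> \<Omega>" and t: "0 \<le> t" "t \<le> 1" for x t
    using nn[OF x] pos(2)[OF x] t by (simp add: add_pos_nonneg)
  have wcone: "(v x + t * \<phi> x) *\<^sub>R (hess v x + t *\<^sub>R hess \<phi> x) - ((grad v x + t *\<^sub>R grad \<phi> x) \<bullet> (grad v x + t *\<^sub>R grad \<phi> x) / 2) *\<^sub>R mat 1 \<in> gcone k"
    if x: "x \<in> \<Omega>" and t: "0 \<le> t" "t \<le> 1" for x t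
  proof -
    have e: "v x + t * \<phi> x = (1 - t) * v x + t * u x" "hess v x + t *\<^sub>R hess \<phi> x = (1 - t) *\<^sub>R hess v x + t *\<^sub>R hess u x"
      "grad v x + t *\<^sub>R grad \<phi> x = (1 - t) *\<^sub>R grad v x + t *\<^sub>R grad u x"
      unfolding f(2)[OF x] f(3)[OF x] \<phi>_def by (simp_all add: algebra_simps)
    show ?thesis unfolding e
      by (rule segment_gcone[OF k pos(1)[OF x] pos(2)[OF x] t])
        (use cone[OF x] in \<open>simp_all add: A_matrix_alt dot_square_norm\<close>)
  qed
  have Zb: "\<bar>drift_form \<alpha> k (v x + t * \<phi> x) (grad v x + t *\<^sub>R grad \<phi> x) (hess v x + t *\<^sub>R hess \<phi> x) (grad \<phi> x)\<bar> \<le> C"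
    if x: "x \<in> \<Omega>" and t: "0 \<le> t" "t \<le> 1" for x t
  proof (rule C(2)[OF wpos[OF x t]])
    have "norm (v x + t *\<^sub>R (u x + (-1) *\<^sub>R v x)) \<le> R0" using Bu[OF x] pos[OF x] t by (intro mix) auto
    then show "v x + t * \<phi> x \<le> R" using R0 by (simp add: \<phi>_def R_def)
    show "norm (grad v x + t *\<^sub>R grad \<phi> x) \<le> R" unfolding f(2)[OF x] using mix[OF Bu(5,2)[OF x] t] R0 by (simp add: R_def)
    show "norm (hess v x + t *\<^sub>R hess \<phi> x) \<le> R" unfolding f(3)[OF x] using mix[OF Bu(6,3)[OF x] t] R0 by (simp add: R_def)
    show "norm (grad \<phi> x) \<le> R"
      unfolding f(2)[OF x] by (rule order_trans[OF norm_triangle_ineq]) (use Bu[OF x] in \<open>simp add: R_def\<close>)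
  qed
  define e where "e m = inverse (real (Suc m))" for m
  have e: "e m > 0" for m by (simp add: e_def)
  have e0: "e \<longlonglongrightarrow> 0" unfolding e_def by (rule LIMSEQ_inverse_real_of_nat)
  have step: "(LINT x:\<Omega>|lborel. smooth_step (e m) (\<phi> x) * (L u x - L v x)) \<le> C * (LINT x:\<Omega>|lborel. \<phi> x * smooth_step' (e m) (\<phi> x))" for m
  proof -
    \<comment> \<open>Compactly contained in \<open>\<Omega>\<close>, because \<open>\<phi>\<close>
      vanishes on the boundary.\<close>
    define K where "K = {x \<in> closure \<Omega>. e m \<le> \<phi> x}"
    have "continuous_on (closure \<Omega>) \<phi>"
      using u v unfolding \<phi>_def C2_closure_def by (auto intro!: continuous_on_diff)
    then have "closed K" unfolding K_def by (intro continuous_on_closed_Collect_le continuous_on_const closed_closure)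
    then have K: "compact K" using bounded_closure[OF \<Omega>(2)] unfolding K_def
      by (intro compact_eq_bounded_closed[THEN iffD2]) (auto intro: bounded_subset)
    have "\<phi> x = 0" if "x \<in> frontier \<Omega>" for x using bd[OF that] by (simp add: \<phi>_def)
    then have "K \<inter> frontier \<Omega> = {}" using e[of m] unfolding K_def by force
    then have KO: "K \<subseteq> \<Omega>" using \<Omega>(1) unfolding K_def frontier_def by (auto simp: interior_open)
    have off: "\<phi> x \<le> e m" if "x \<in> \<Omega> - K" for x using that closure_subset[of \<Omega>] unfolding K_def by auto
    have "(LINT x:\<Omega>|lborel. smooth_step (e m) (\<phi> x) *
        (integrand \<alpha> k (v x + \<phi> x) ((grad v x + grad \<phi> x) \<bullet> (grad v x + grad \<phi> x)) (hess v x + hess \<phi> x)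
         - integrand \<alpha> k (v x) (grad v x \<bullet> grad v x) (hess v x)))
      \<le> C * (LINT x:\<Omega>|lborel. \<phi> x * smooth_step' (e m) (\<phi> x))"
      by (rule truncated_energy_comparison[OF vC2 f(1) \<Omega>(1) K KO a k nn wpos wcone Zb])
        (use smooth_step_deriv[OF e] off in auto)
    moreover have "(LINT x:\<Omega>|lborel. smooth_step (e m) (\<phi> x) *
        (integrand \<alpha> k (v x + \<phi> x) ((grad v x + grad \<phi> x) \<bullet> (grad v x + grad \<phi> x)) (hess v x + hess \<phi> x)
         - integrand \<alpha> k (v x) (grad v x \<bullet> grad v x) (hess v x)))
       = (LINT x:\<Omega>|lborel. smooth_step (e m) (\<phi> x) * (L u x - L v x))"
      unfolding set_lebesgue_integral_def
      by (rule Bochner_Integration.integral_cong) (auto simp: indicator_def L_def f(2,3) \<phi>_def)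
    ultimately show ?thesis by simp
  qed
  have meas: "(\<lambda>x. indicator \<Omega> x *\<^sub>R g x) \<in> borel_measurable lborel" if "continuous_on \<Omega> g" for g :: "real^'n \<Rightarrow> real"
    using borel_measurable_continuous_on_indicator[OF _ that] \<Omega>(1) by simp
  have cL: "continuous_on \<Omega> (L u)" "continuous_on \<Omega> (L v)"
    unfolding L_def
    using continuous_on_integrand[OF C2_on_continuous(1)[OF uC2] pos(1) continuous_on_inner[OF C2_on_continuous(4,4)[OF uC2]] C2_on_continuous(3)[OF uC2]]
      continuous_on_integrand[OF C2_on_continuous(1)[OF vC2] pos(2) continuous_on_inner[OF C2_on_continuous(4,4)[OF vC2]] C2_on_continuous(3)[OF vC2]]
    by auto
  have iw: "integrable lborel (\<lambda>x. indicator \<Omega> x *\<^sub>R B)" for B :: real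
    using emeasure_bounded_finite[OF \<Omega>(2)] \<Omega>(1) by (simp add: integrable_real_indicator)
  have chs: "continuous_on UNIV (smooth_step (e m))" for m
    using smooth_step_deriv(1)[OF e] DERIV_continuous continuous_at_imp_continuous_on by blast
  have css: "continuous_on \<Omega> (\<lambda>x. smooth_step (e m) (\<phi> x))" "continuous_on \<Omega> (\<lambda>x. smooth_step' (e m) (\<phi> x))" for m
    using continuous_on_compose2[OF chs cf(1)] continuous_on_compose2[OF smooth_step_deriv(2)[OF e] cf(1)] by auto
  have mA: "(\<lambda>x. indicator \<Omega> x *\<^sub>R (smooth_step (e m) (\<phi> x) * (L u x - L v x))) \<in> borel_measurable lborel" for m
    by (rule meas[OF continuous_on_mult[OF css(1) continuous_on_diff[OF cL]]])
  define A where "A x = indicator \<Omega> x *\<^sub>R ((if \<phi> x > 0 then 1 else 0) * (L u x - L v x))" for x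
  have lA: "(\<lambda>m. indicator \<Omega> x *\<^sub>R (smooth_step (e m) (\<phi> x) * (L u x - L v x))) \<longlonglongrightarrow> A x" for x
  proof (cases "x \<in> \<Omega>")
    case True
    show ?thesis unfolding A_def
      by (intro tendsto_scaleR tendsto_const tendsto_mult smooth_step_limit(1)[OF nn[OF True] e0 e])
  qed (simp add: A_def)
  have mAl: "A \<in> borel_measurable lborel" by (rule borel_measurable_LIMSEQ_metric[OF mA lA])
  have "(\<lambda>m. integral\<^sup>L lborel (\<lambda>x. indicator \<Omega> x *\<^sub>R (smooth_step (e m) (\<phi> x) * (L u x - L v x)))) \<longlonglongrightarrow> integral\<^sup>L lborel A"
  proof (rule integral_dominated_convergence[OF mAl mA iw[of "2 * C1"]])
    show "AE x in lborel. norm (indicator \<Omega> x *\<^sub>R (smooth_step (e m) (\<phi> x) * (L u x - L v x))) \<le> indicator \<Omega> x *\<^sub>R (2 * C1)" for m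
    proof (rule AE_I2, cases)
      fix x assume x: "x \<in> \<Omega>"
      have "\<bar>smooth_step (e m) (\<phi> x)\<bar> * \<bar>L u x - L v x\<bar> \<le> 1 * (2 * C1)"
        using Lb[OF x] smooth_step_deriv(6,7)[OF e] by (intro mult_mono) auto
      then show "norm (indicator \<Omega> x *\<^sub>R (smooth_step (e m) (\<phi> x) * (L u x - L v x))) \<le> indicator \<Omega> x *\<^sub>R (2 * C1)"
        using x by (simp add: abs_mult)
    qed simp
  qed (use lA in simp)
  then have limA: "(\<lambda>m. LINT x:\<Omega>|lborel. smooth_step (e m) (\<phi> x) * (L u x - L v x)) \<longlonglongrightarrow> integral\<^sup>L lborel A"
    by (simp only: set_lebesgue_integral_def)
  have mB: "(\<lambda>x. indicator \<Omega> x *\<^sub>R (\<phi> x * smooth_step' (e m) (\<phi> x))) \<in> borel_measurable lborel" for m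
    by (rule meas[OF continuous_on_mult[OF cf(1) css(2)]])
  have "(\<lambda>m. integral\<^sup>L lborel (\<lambda>x. indicator \<Omega> x *\<^sub>R (\<phi> x * smooth_step' (e m) (\<phi> x)))) \<longlonglongrightarrow> integral\<^sup>L lborel (\<lambda>x::real^'n. 0)"
  proof (rule integral_dominated_convergence[OF _ mB iw[of 2]])
    show "AE x in lborel. (\<lambda>m. indicator \<Omega> x *\<^sub>R (\<phi> x * smooth_step' (e m) (\<phi> x))) \<longlonglongrightarrow> 0"
    proof (rule AE_I2, cases)
      fix x assume x: "x \<in> \<Omega>"
      show "(\<lambda>m. indicator \<Omega> x *\<^sub>R (\<phi> x * smooth_step' (e m) (\<phi> x))) \<longlonglongrightarrow> 0"
        using smooth_step_limit(2)[OF nn[OF x] e0 e] x by simp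
    qed simp
    show "AE x in lborel. norm (indicator \<Omega> x *\<^sub>R (\<phi> x * smooth_step' (e m) (\<phi> x))) \<le> indicator \<Omega> x *\<^sub>R 2" for m
      using smooth_step'_bound[OF e] by (auto intro!: AE_I2 simp: indicator_def)
  qed simp
  then have limB: "(\<lambda>m. C * (LINT x:\<Omega>|lborel. \<phi> x * smooth_step' (e m) (\<phi> x))) \<longlonglongrightarrow> C * 0"
    by (intro tendsto_mult tendsto_const) (simp add: set_lebesgue_integral_def)
  have neg: "integral\<^sup>L lborel A \<le> 0"
    using LIMSEQ_le[OF limA limB] step by auto
  define D where "D x = indicator \<Omega> x *\<^sub>R (L u x - L v x)" for x
  have mD: "D \<in> borel_measurable lborel" unfolding D_def by (rule meas[OF continuous_on_diff[OF cL]])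
  have jets: "AE x in lebesgue. x \<in> \<Omega> \<longrightarrow> \<phi> x = 0 \<longrightarrow> hess \<phi> x = 0"
    by (rule contact_set_jets_vanish(2)[OF f(1) \<Omega>(1)]) (rule nn)
  have "AE x in lebesgue. A x = D x"
    using jets
  proof eventually_elim
    case (elim x)
    show ?case
    proof (cases "x \<in> \<Omega> \<and> \<phi> x = 0")
      case True
      have "grad \<phi> x = 0" using contact_set_jets_vanish(1)[OF f(1) \<Omega>(1)] nn True by blast
      moreover have "hess \<phi> x = 0" using elim True by blast
      ultimately have "grad u x = grad v x" "hess u x = hess v x" "u x = v x" using True f(2,3)[of x] by (auto simp: \<phi>_def)
      then show ?thesis by (simp add: A_def D_def L_def)
    next
      case False
      then have "x \<in> \<Omega> \<Longrightarrow> \<phi> x > 0" using nn[of x] by fastforce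
      then show ?thesis by (auto simp: A_def D_def indicator_def)
    qed
  qed
  then have "integral\<^sup>L lebesgue A = integral\<^sup>L lebesgue D"
    by (intro integral_cong_AE measurable_completion mAl mD)
  then have DA: "integral\<^sup>L lborel D = integral\<^sup>L lborel A" using integral_completion[OF mAl] integral_completion[OF mD] by simp
  have iL: "integrable lborel (\<lambda>x. indicator \<Omega> x *\<^sub>R g x)" if "continuous_on \<Omega> g" "\<And>x. x \<in> \<Omega> \<Longrightarrow> \<bar>g x\<bar> \<le> C1" for g
    by (rule Bochner_Integration.integrable_bound[OF iw[of C1] meas[OF that(1)]]) (auto intro!: AE_I2 simp: indicator_def that(2) C1(1))
  have "integral\<^sup>L lborel D = integral\<^sup>L lborel (\<lambda>x. indicator \<Omega> x *\<^sub>R L u x) - integral\<^sup>L lborel (\<lambda>x. indicator \<Omega> x *\<^sub>R L v x)"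
    unfolding D_def scaleR_diff_right by (rule Bochner_Integration.integral_diff[OF iL[OF cL(1) Lb(1)] iL[OF cL(2) Lb(2)]])
  then have "integral\<^sup>L lebesgue (\<lambda>x. indicator \<Omega> x *\<^sub>R L u x) \<le> integral\<^sup>L lebesgue (\<lambda>x. indicator \<Omega> x *\<^sub>R L v x)"
    using neg DA integral_completion[OF meas[OF cL(1)]] integral_completion[OF meas[OF cL(2)]] by simp
  then show ?thesis unfolding set_lebesgue_integral_def L_def .
qed

lemma weighted_sum_S_op_eq_integrand:
  fixes f :: "real^'n \<Rightarrow> real"
  assumes "f \<in> C2_on \<Omega>" "open \<Omega>" "x \<in> \<Omega>" "\<alpha> \<ge> 0" "k \<le> CARD('n)" "f x > 0"
  shows "(\<Sum>l=0..k. b_coeff \<alpha> CARD('n) k l * f x powr \<alpha> * norm (grad f x) ^ (2 * l) * S_op (k - l) f x)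
    = integrand \<alpha> k (f x) (grad f x \<bullet> grad f x) (hess f x)"
  unfolding weighted_sum_eq_integrand[OF assms(4-6), symmetric]
  by (rule sum.cong[OF refl]) (simp add: S_op_msig[OF assms(1-3)] A_matrix_alt dot_square_norm power_mult)

theorem theorem1p2:
  fixes \<Omega> :: "(real ^ 'n) set"
    and u v :: "real ^ 'n \<Rightarrow> real"
    and k :: nat
    and \<alpha> :: real
  assumes "1 \<le> k" and "k \<le> CARD('n)" and "CARD('n) \<ge> 3"
    and "open \<Omega>" and "connected \<Omega>" and "\<Omega> \<noteq> {}" and "bounded \<Omega>"
    and "u \<in> Phi k \<Omega> \<inter> C2_closure \<Omega>" and "v \<in> Phi k \<Omega> \<inter> C2_closure \<Omega>"
    and "\<forall>x\<in>\<Omega>. u x \<ge> v x"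
    and "\<forall>x\<in>frontier \<Omega>. u x = v x"
    and "\<alpha> \<ge> 0"
  shows "(LINT x:\<Omega>|lebesgue. (\<Sum>l=0..k. b_coeff \<alpha> CARD('n) k l * u x powr \<alpha>
             * norm (grad u x) ^ (2 * l) * S_op (k - l) u x))
         \<le> (LINT x:\<Omega>|lebesgue. (\<Sum>l=0..k. b_coeff \<alpha> CARD('n) k l * v x powr \<alpha>
             * norm (grad v x) ^ (2 * l) * S_op (k - l) v x))
       \<and> (\<forall>l\<in>{0..k}. b_coeff \<alpha> CARD('n) k l \<ge> 0)"
proof
  have conv: "f \<in> C2_on \<Omega>" "\<And>x. x \<in> \<Omega> \<Longrightarrow> f x > 0" "\<And>x. x \<in> \<Omega> \<Longrightarrow> A_matrix f x \<in> gcone k"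
    "(LINT x:\<Omega>|lebesgue. (\<Sum>l=0..k. b_coeff \<alpha> CARD('n) k l * f x powr \<alpha> * norm (grad f x) ^ (2 * l) * S_op (k - l) f x))
      = (LINT x:\<Omega>|lebesgue. integrand \<alpha> k (f x) (grad f x \<bullet> grad f x) (hess f x))"
    if f: "f \<in> Phi k \<Omega> \<inter> C2_closure \<Omega>" for f
  proof -
    show C2: "f \<in> C2_on \<Omega>" using f by (simp add: C2_closure_def)
    show pos: "f x > 0" if "x \<in> \<Omega>" for x using f that by (simp add: Phi_def)
    show "A_matrix f x \<in> gcone k" if "x \<in> \<Omega>" for x
      using Phi_C2_A_matrix_gcone[OF assms(2,4) _ C2 that] f by simp
    show "(LINT x:\<Omega>|lebesgue. (\<Sum>l=0..k. b_coeff \<alpha> CARD('n) k l * f x powr \<alpha> * norm (grad f x) ^ (2 * l) * S_op (k - l) f x))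
      = (LINT x:\<Omega>|lebesgue. integrand \<alpha> k (f x) (grad f x \<bullet> grad f x) (hess f x))"
      unfolding set_lebesgue_integral_def
    proof (rule Bochner_Integration.integral_cong[OF refl])
      fix x
      show "indicator \<Omega> x *\<^sub>R (\<Sum>l=0..k. b_coeff \<alpha> CARD('n) k l * f x powr \<alpha> * norm (grad f x) ^ (2 * l) * S_op (k - l) f x)
        = indicator \<Omega> x *\<^sub>R integrand \<alpha> k (f x) (grad f x \<bullet> grad f x) (hess f x)"
        using weighted_sum_S_op_eq_integrand[OF C2 assms(4) _ assms(12,2) pos, of x] by (cases "x \<in> \<Omega>") simp_all
    qed
  qed
  show "(LINT x:\<Omega>|lebesgue. (\<Sum>l=0..k. b_coeff \<alpha> CARD('n) k l * u x powr \<alpha>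
             * norm (grad u x) ^ (2 * l) * S_op (k - l) u x))
         \<le> (LINT x:\<Omega>|lebesgue. (\<Sum>l=0..k. b_coeff \<alpha> CARD('n) k l * v x powr \<alpha>
             * norm (grad v x) ^ (2 * l) * S_op (k - l) v x))"
    unfolding conv(4)[OF assms(8)] conv(4)[OF assms(9)]
    by (rule energy_comparison[OF _ _ assms(4,7,12,2) conv(2)[OF assms(8)] conv(2)[OF assms(9)] conv(3)[OF assms(8)] conv(3)[OF assms(9)]])
      (use assms in auto)
  have "CARD('n) \<ge> 1" using assms(3) by linarith
  then show "\<forall>l\<in>{0..k}. b_coeff \<alpha> CARD('n) k l \<ge> 0" using b_coeff_nonneg[OF assms(12)] by blast
qed

end
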